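(* Let $\psi:\mathbb R_+\to\mathbb R_+$ be a non-increasing positive function, and let $t_0\ge 1$ be such that $t\psi(t)<1$ for all $t\ge t_0$. Put $$\Psi(t):=\frac{t\psi(t)}{1-t\psi(t)}\qquad (t\ge t_0),$$ and assume that $\Psi$ is non-decreasing on $[t_0,\infty)$. Let $f$ be a dimension function such that $$\lim_{x\to 0}\frac{f(x)}{x}=\infty,$$ and such that there exist $C\ge 1$ and $x_0>0$ with $$\frac{f(x_2)}{x_2}\le C\,\frac{f(x_1)}{x_1}\quad\text{whenever } 0<x_1<x_2<x_0 .$$ Consider the series of positive terms $$\Sigma:=\sum_{k\ge 1,\ 2^k\ge t_0}\ \ \sum_{j\in\mathbb Z,\ 0\le j<\max(1,\log_2\Psi(2^k))} 2^{2k+j}\,f\!\left(\frac{2^{-(2k+j)}}{\Psi(2^{k+j})}\right).$$ Then $$\mathcal H^f\big(D^c(\psi)\big)=\begin{cases}0 & \text{if } \Sigma<\infty;\\ \infty & \text{if } \Sigma=\infty.\end{cases}$$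
   Context: A dimension function is an increasing, continuous function $f:\mathbb R_+\to\mathbb R_+$ with $f(r)\to 0$ as $r\to 0$. $\mathcal H^f$ denotes the $f$-dimensional Hausdorff measure: $\mathcal H^f(E)=\lim_{\rho\to0}\inf\sum_i f(\mathrm{diam}(B_i))$, the infimum being over countable covers $\{B_i\}$ of $E$ by balls of diameter at most $\rho$. For a non-increasing $\psi:\mathbb R_+\to\mathbb R_+$, the set $D(\psi)$ of $\psi$-Dirichlet improvable numbers is the set of all $x\in[0,1)$ for which there exists $N$ such that for every real $t>N$ the system $|qx-p|<\psi(t)$, $|q|<t$ has a non-trivial solution in integers $(p,q)\neq(0,0)$. $D^c(\psi):=[0,1)\setminus D(\psi)$ is the set of $\psi$-Dirichlet non-improvable numbers. *)

theory Defs
  imports "HOL-Analysis.Analysis"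
begin

text \<open>Functions on the positive half-line are total functions on the reals of which only the
  values on \<open>{0<..}\<close> matter. ``Increasing'' is read as ``non-decreasing''.\<close>

definition dimension_function :: "(real \<Rightarrow> real) \<Rightarrow> bool" where
  "dimension_function f \<longleftrightarrow>
     (\<forall>r>0. 0 \<le> f r) \<and> mono_on {0<..} f \<and> continuous_on {0<..} f \<and> (f \<longlongrightarrow> 0) (at_right 0)"

definition ball_covers :: "real \<Rightarrow> real set \<Rightarrow> real set set set" where
  "ball_covers \<rho> E =
     {\<B>. countable \<B> \<and> (\<forall>B\<in>\<B>. \<exists>c. \<exists>r>0. B = ball c r \<and> diameter B \<le> \<rho>) \<and> E \<subseteq> \<Union>\<B>}"

definition hausdorff_pre :: "(real \<Rightarrow> real) \<Rightarrow> real \<Rightarrow> real set \<Rightarrow> ennreal" where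
  "hausdorff_pre f \<rho> E = (INF \<B>\<in>ball_covers \<rho> E. \<Sum>\<^sub>\<infinity>B\<in>\<B>. ennreal (f (diameter B)))"

definition hausdorff_measure :: "(real \<Rightarrow> real) \<Rightarrow> real set \<Rightarrow> ennreal" where
  "hausdorff_measure f E = Lim (at_right 0) (\<lambda>\<rho>. hausdorff_pre f \<rho> E)"

text \<open>The limit always exists, so the use of \<open>Lim\<close> is harmless.\<close>

lemma hausdorff_pre_antimono:
  assumes "\<rho> \<le> \<rho>'"
  shows "hausdorff_pre f \<rho>' E \<le> hausdorff_pre f \<rho> E"
proof -
  have "ball_covers \<rho> E \<subseteq> ball_covers \<rho>' E"
    unfolding ball_covers_def using order_trans[OF _ assms] by fastforce
  then show ?thesis
    unfolding hausdorff_pre_def by (rule INF_superset_mono) simp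
qed

lemma hausdorff_pre_tendsto_SUP:
  "((\<lambda>\<rho>. hausdorff_pre f \<rho> E) \<longlongrightarrow> (SUP \<rho>\<in>{0<..}. hausdorff_pre f \<rho> E)) (at_right 0)"
proof (rule order_tendstoI)
  fix a assume "a < (SUP \<rho>\<in>{0<..}. hausdorff_pre f \<rho> E)"
  then obtain \<rho> where \<rho>: "\<rho> > 0" "a < hausdorff_pre f \<rho> E"
    by (auto simp: less_SUP_iff)
  have "a < hausdorff_pre f \<sigma> E" if "\<sigma> < \<rho>" for \<sigma>
    using \<rho>(2) hausdorff_pre_antimono[of \<sigma> \<rho> f E] that by simp
  then show "\<forall>\<^sub>F \<sigma> in at_right 0. a < hausdorff_pre f \<sigma> E"
    using \<rho>(1) by (auto simp: eventually_at_right_field)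
next
  fix a assume a: "(SUP \<rho>\<in>{0<..}. hausdorff_pre f \<rho> E) < a"
  have "hausdorff_pre f \<sigma> E < a" if "0 < \<sigma>" for \<sigma>
    using that by (intro le_less_trans[OF SUP_upper a]) simp
  then show "\<forall>\<^sub>F \<sigma> in at_right 0. hausdorff_pre f \<sigma> E < a"
    by (auto simp: eventually_at_right_field intro: exI[of _ 1])
qed

lemma hausdorff_measure_eq_SUP:
  "hausdorff_measure f E = (SUP \<rho>\<in>{0<..}. hausdorff_pre f \<rho> E)"
  unfolding hausdorff_measure_def
  by (rule tendsto_Lim[OF _ hausdorff_pre_tendsto_SUP]) simp

definition dirichlet_improvable :: "(real \<Rightarrow> real) \<Rightarrow> real set" where
  "dirichlet_improvable \<psi> =
     {x \<in> {0..<1}. \<exists>N. \<forall>t>N. \<exists>p q :: int. (p, q) \<noteq> (0, 0) \<and>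
        \<bar>of_int q * x - of_int p\<bar> < \<psi> t \<and> \<bar>of_int q\<bar> < t}"

definition dirichlet_nonimprovable :: "(real \<Rightarrow> real) \<Rightarrow> real set" where
  "dirichlet_nonimprovable \<psi> = {0..<1} - dirichlet_improvable \<psi>"

definition Psi :: "(real \<Rightarrow> real) \<Rightarrow> real \<Rightarrow> real" where
  "Psi \<psi> t = t * \<psi> t / (1 - t * \<psi> t)"

text \<open>The inner index set is finite, so the inner \<open>\<Sum>\<close> is a genuine finite sum; the outer sum is
  an unconditional sum in the extended non-negative reals, with value \<open>\<infinity>\<close> when it diverges.\<close>

definition dirichlet_series :: "(real \<Rightarrow> real) \<Rightarrow> (real \<Rightarrow> real) \<Rightarrow> real \<Rightarrow> ennreal" where
  "dirichlet_series f \<psi> t0 =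
     (\<Sum>\<^sub>\<infinity>k\<in>{k::nat. 1 \<le> k \<and> t0 \<le> 2 ^ k}.
        \<Sum>j\<in>{j::nat. real j < max 1 (log 2 (Psi \<psi> (2 ^ k)))}.
          ennreal (2 ^ (2 * k + j) * f ((1 / 2 ^ (2 * k + j)) / Psi \<psi> (2 ^ (k + j)))))"

end

theory Submission
  imports Defs
begin

text \<open>Let \<open>P/Q\<close> and \<open>R/q\<close> with \<open>Q < q\<close> be consecutive best approximations of an irrational \<open>x\<close>.
  No denominator below \<open>q\<close> does better than \<open>Q\<close>, and \<open>q \<bar>Q x - P\<bar> + Q \<bar>q x - R\<bar> = 1\<close>. Hence the system
  with \<open>t = q\<close> is unsolvable precisely when \<open>Q \<bar>q x - R\<bar> \<le> 1 - q \<psi>(q) = 1 / (1 + \<Psi>(q))\<close>, that is, when \<open>x\<close> lies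
  within about \<open>1 / (Q q \<Psi>(q))\<close> of \<open>R/q\<close>. So the non-improvable numbers form a limsup set. Sort its
  intervals by \<open>Q \<sim> 2\<^sup>k\<close> and \<open>q \<sim> 2\<^bsup>k+j\<^esup>\<close>: a block has about \<open>2\<^bsup>2k+j\<^esup>\<close> intervals of length about
  \<open>2\<^bsup>-2k-j\<^esup> / \<Psi>(2\<^bsup>k+j\<^esup>)\<close>, and its term in the series is the cost of covering it. Once \<open>2\<^sup>j\<close> exceeds
  \<open>\<Psi>(2\<^sup>k)\<close>, the point is so close to \<open>P/Q\<close> that one interval of the size occurring in block \<open>j = 0\<close>, centred
  at \<open>P/Q\<close>, contains all these blocks at once; this is why \<open>j\<close> is cut off there. If the series converges,
  these covers have arbitrarily small cost (\<open>covered_at_level\<close>, \<open>level_cost\<close>).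

  If the series diverges, any cover whose sets have small diameter and finite total cost \<open>\<eta>\<close> misses a
  non-improvable point. No mass distribution is constructed: the point is the intersection of nested
  intervals, found one at a time. Since \<open>f(x)/x \<rightarrow> \<infinity>\<close>, the total length of the cover is tiny compared with
  the initial interval, and the step \<open>spoke_avoiding_cover\<close> preserves this: inside an interval \<open>I\<close> there is,
  at arbitrarily high level, one of the intervals above (a ``spoke'') that only meets covering sets shorter
  than itself, of total length again tiny compared with it. For if every spoke \<open>s\<close> of a large finite
  family failed, then the cover would have to pay for the total weight \<open>\<Sum>s. f \<bar>s\<bar>\<close>. Sets longer than the
  spacing \<open>2\<^bsup>-2k\<^esup>\<close> hit no more than their share of \<open>I\<close>, which is a small fraction; shorter sets of
  diameter \<open>b\<close> are responsible only for weight \<open>O(f b)\<close>, in total \<open>O(\<eta>)\<close>. But the total weight is at least a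
  constant times \<open>\<bar>I\<bar>\<close> times a partial sum of the series, and so exceeds any bound.

  Two points make this work. First, the spokes of the family must be disjoint; a spoke can only meet a
  spoke of a smaller level \<open>k\<close> if it is much finer, so the spokes lost in this way are few
  (\<open>overlap_nested\<close>, \<open>fresh_family\<close>). Second, spokes cluster: \<open>2\<^sup>j\<close> of them accumulate at distance
  \<open>2\<^bsup>-2k-j\<^esup>\<close> from each \<open>P/Q\<close>, and a set of diameter \<open>b = 2\<^bsup>-2k-j\<^esup>\<close> hits them all. Their joint weight is \<open>O(f b)\<close>
  only for those \<open>j\<close> called \<open>good\<close> below. By \<open>diagonal_sum_le\<close> the good \<open>j\<close> carry a fixed proportion of the
  series: along \<open>k + j = m\<close> the terms are almost decreasing in \<open>j\<close>, and a bad \<open>j\<close> makes the term drop by a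
  large factor between \<open>j\<close> and \<open>3j\<close>. Given this, \<open>hit_weight\<close> follows from elementary geometry of
  fractions: the spokes hit by one short set come from at most two fractions \<open>P/Q\<close>.

  Throughout the divergence part \<open>\<Psi>\<close> is replaced by \<open>max 1 \<Psi>\<close>, which shrinks the set and keeps the series
  divergent.\<close>

section \<open>Preliminaries\<close>

lemma finite_pow2_less: "finite {j::nat. j = 0 \<or> 2 ^ j < (c :: real)}"
proof -
  obtain n where n: "c < 2 ^ n" using real_arch_pow[of 2 c] by auto
  have "j \<le> n" if "j = 0 \<or> 2 ^ j < c" for j
  proof (rule ccontr)
    assume "\<not> j \<le> n"
    then have "(2::real) ^ n \<le> 2 ^ j" "j \<noteq> 0" by (auto intro: power_increasing)
    moreover have "2 ^ j < c" using that \<open>j \<noteq> 0\<close> by blast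
    ultimately show False using n by linarith
  qed
  then have "{j::nat. j = 0 \<or> 2 ^ j < c} \<subseteq> {..n}" by blast
  then show ?thesis by (rule finite_subset) simp
qed

lemma inverse_pow4_small:
  fixes e :: real
  assumes "0 < e"
  shows "\<exists>K::nat. \<forall>k\<ge>K. 1 / 2 ^ (2 * k) < e"
proof -
  obtain K where K: "(1/2) ^ K < e" using real_arch_pow_inv[of e "1/2"] assms by auto
  have "1 / 2 ^ (2 * k) < e" if "k \<ge> K" for k
  proof -
    have "1 / 2 ^ (2 * k) \<le> (1 / 2 ^ K :: real)"
      using that by (intro divide_left_mono power_increasing) auto
    then show ?thesis using K by (simp add: power_divide)
  qed
  then show ?thesis by blast
qed

lemma sum_Un_le:
  fixes h :: "'a \<Rightarrow> real"
  assumes "finite X" "finite Y" "\<And>x. x \<in> X \<inter> Y \<Longrightarrow> 0 \<le> h x"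
  shows "sum h (X \<union> Y) \<le> sum h X + sum h Y"
  using sum.union_inter[OF assms(1,2), of h] sum_nonneg[of "X \<inter> Y" h] assms(3) by simp

lemma sum_UN_le:
  fixes h :: "'a \<Rightarrow> real"
  assumes "finite I" "\<And>i. i \<in> I \<Longrightarrow> finite (X i)" "\<And>i x. i \<in> I \<Longrightarrow> x \<in> X i \<Longrightarrow> 0 \<le> h x"
  shows "sum h (\<Union>i\<in>I. X i) \<le> (\<Sum>i\<in>I. sum h (X i))"
  using assms
proof (induction I)
  case (insert i I)
  have "sum h (\<Union>i\<in>I. X i) \<le> (\<Sum>i\<in>I. sum h (X i))"
  proof (rule insert.IH)
    show "finite (X k)" if "k \<in> I" for k by (rule insert.prems(1)) (simp add: that)
    show "0 \<le> h x" if "k \<in> I" "x \<in> X k" for k x by (rule insert.prems(2)[of k]) (simp_all add: that)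
  qed
  moreover have "sum h (X i \<union> (\<Union>i\<in>I. X i)) \<le> sum h (X i) + sum h (\<Union>i\<in>I. X i)"
  proof (rule sum_Un_le)
    show "finite (X i)" by (rule insert.prems(1)) simp
    show "finite (\<Union>i\<in>I. X i)" by (rule finite_UN_I[OF insert.hyps(1)], rule insert.prems(1)) simp
    show "0 \<le> h x" if "x \<in> X i \<inter> (\<Union>i\<in>I. X i)" for x by (rule insert.prems(2)[of i]) (use that in auto)
  qed
  ultimately show ?case using insert.hyps by simp
qed simp

section \<open>Farey neighbours\<close>

lemma fraction_gap:
  fixes P Q P' Q' :: int
  assumes "Q > 0" "Q' > 0" "P * Q' \<noteq> P' * Q"
  shows "1 / (of_int Q * of_int Q') \<le> \<bar>of_int P / of_int Q - of_int P' / (of_int Q' :: real)\<bar>"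
proof -
  have "1 \<le> \<bar>P * Q' - P' * Q\<bar>" using assms(3) by linarith
  then have "(1::real) \<le> \<bar>of_int (P * Q' - P' * Q)\<bar>" by linarith
  moreover have "of_int P / of_int Q - of_int P' / (of_int Q' :: real)
      = of_int (P * Q' - P' * Q) / (of_int Q * of_int Q')"
    using assms(1,2) by (simp add: field_simps)
  moreover have "(0::real) < of_int Q * of_int Q'" using assms(1,2) by simp
  ultimately show ?thesis
    using divide_right_mono[of 1 _ "of_int Q * of_int Q' :: real"] by (simp add: abs_divide)
qed

lemma fraction_less_cross:
  fixes P Q P' Q' :: int
  assumes "of_int P / of_int Q < (of_int P' / of_int Q' :: real)" "Q > 0" "Q' > 0"
  shows "P * Q' \<noteq> P' * Q"
  using assms by (auto simp: field_simps simp flip: of_int_mult)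

lemma coprime_fraction_unique:
  fixes P Q P' Q' :: int
  assumes "coprime P Q" "coprime P' Q'" "Q > 0" "Q' > 0" "P * Q' = P' * Q"
  shows "P = P' \<and> Q = Q'"
proof -
  have "Q dvd Q'"
    using assms by (metis coprime_commute coprime_dvd_mult_right_iff dvd_triv_right)
  moreover have "Q' dvd Q"
    using assms by (metis coprime_commute coprime_dvd_mult_right_iff dvd_triv_right)
  ultimately have "Q = Q'" using assms by (simp add: zdvd_antisym_nonneg)
  then show ?thesis using assms by auto
qed

text \<open>The fractions \<open>R/q\<close> with \<open>R Q - P q = 1\<close> are the Farey neighbours of \<open>P/Q\<close> on its right; their
  denominators form a residue class modulo \<open>Q\<close>. The companion is its least non-negative member, and the
  children below run through the class.\<close>

definition companion :: "int \<Rightarrow> int \<Rightarrow> int" where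
  "companion P Q = (SOME e. 0 \<le> e \<and> e < Q \<and> Q dvd P * e + 1)"

definition child_den :: "int \<Rightarrow> int \<Rightarrow> nat \<Rightarrow> int" where
  "child_den P Q a = int a * Q + companion P Q"

definition child_num :: "int \<Rightarrow> int \<Rightarrow> nat \<Rightarrow> int" where
  "child_num P Q a = int a * P + (P * companion P Q + 1) div Q"

lemma companion:
  assumes "coprime P Q" "Q > 0"
  shows "0 \<le> companion P Q" "companion P Q < Q" "Q dvd P * companion P Q + 1"
proof -
  obtain x y where xy: "x * P + y * Q = 1"
    using assms(1) bezout_int[of P Q] by (metis coprime_imp_gcd_eq_1)
  define e where "e = (- x) mod Q"
  have "P * e mod Q = (P * (- x)) mod Q" unfolding e_def by (simp add: mod_mult_right_eq)
  also have "P * (- x) = y * Q - 1" using xy by (simp add: algebra_simps)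
  finally have "(P * e + 1) mod Q = (y * Q - 1 + 1) mod Q" by (rule mod_add_cong) simp
  then have "Q dvd P * e + 1" by (simp add: dvd_eq_mod_eq_0)
  moreover have "0 \<le> e" "e < Q" using assms(2) by (auto simp: e_def)
  ultimately have "\<exists>e. 0 \<le> e \<and> e < Q \<and> Q dvd P * e + 1" by blast
  then have "0 \<le> companion P Q \<and> companion P Q < Q \<and> Q dvd P * companion P Q + 1"
    unfolding companion_def by (rule someI_ex)
  then show "0 \<le> companion P Q" "companion P Q < Q" "Q dvd P * companion P Q + 1" by auto
qed

lemma child_det:
  assumes "coprime P Q" "Q > 0"
  shows "child_num P Q a * Q - P * child_den P Q a = 1"
  using companion(3)[OF assms] by (auto simp: child_num_def child_den_def algebra_simps)

lemma det_one_gap: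
  fixes P Q R q :: int
  assumes "R * Q - P * q = 1" "Q > 0" "q > 0"
  shows "of_int R / (of_int q :: real) = of_int P / of_int Q + 1 / (of_int Q * of_int q)"
proof -
  have "(of_int R :: real) * of_int Q = of_int P * of_int q + 1"
    using assms(1) by (metis add.commute diff_add_cancel of_int_1 of_int_add of_int_mult)
  then show ?thesis using assms(2,3) by (simp add: field_simps)
qed

text \<open>The two neighbours form a basis of the integer lattice, so a vector is \<open>u (R, q) + v (P, Q)\<close>. If \<open>v = 0\<close>, its
  denominator is a multiple of \<open>q\<close>. If \<open>u\<close> and \<open>v\<close> have the same sign, its denominator is at least \<open>q + Q\<close> in
  absolute value. Otherwise the errors, which lie on opposite sides of \<open>x\<close>, add up and are together at least
  that of \<open>P/Q\<close>.\<close>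

lemma unsolvable_between_neighbours:
  fixes P Q R q p' q' :: int and x y :: real
  assumes det: "R * Q - P * q = 1" and Q: "Q > 0" "q > 0"
    and x: "x \<le> of_int R / of_int q" and y: "y \<le> of_int Q * x - of_int P" "y > 0"
    and sol: "\<bar>of_int q' * x - of_int p'\<bar> < y" "\<bar>of_int q'\<bar> < (of_int q :: real)"
  shows "(p', q') = (0, 0)"
proof (rule ccontr)
  assume ne: "(p', q') \<noteq> (0, 0)"
  define u where "u = Q * p' - P * q'"
  define v where "v = R * q' - q * p'"
  have "u * q + v * Q = (R * Q - P * q) * q'" by (simp add: u_def v_def algebra_simps)
  then have q': "q' = u * q + v * Q" using det by simp
  have "u * R + v * P = (R * Q - P * q) * p'" by (simp add: u_def v_def algebra_simps)
  then have p': "p' = u * R + v * P" using det by simp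
  have lt: "\<bar>q'\<bar> < q" using sol(2) by linarith
  define d where "d = of_int R - of_int q * x"
  define e where "e = of_int Q * x - of_int P"
  have d: "d \<ge> 0" using x Q(2) by (simp add: d_def field_simps)
  have e: "e > 0" "y \<le> e" using y by (auto simp: e_def)
  have err: "of_int q' * x - of_int p' = of_int v * e - of_int u * d"
    by (simp add: q' p' d_def e_def algebra_simps)
  consider "v = 0" | "v > 0" "u > 0" | "v < 0" "u < 0" | "v \<noteq> 0" "u * v \<le> 0"
    by (metis linorder_less_linear mult_nonneg_nonpos mult_nonpos_nonneg order_less_imp_le order_refl)
  then show False
  proof cases
    case 1
    then have "u \<noteq> 0" using ne p' q' by auto
    then have "1 \<le> \<bar>u\<bar>" by linarith
    then have "q \<le> \<bar>u\<bar> * q" using Q(2) by simp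
    then show False using lt 1 q' Q(2) by (simp add: abs_mult)
  next
    case 2
    then have "1 \<le> u" "1 \<le> v" by auto
    then have "q \<le> u * q" "0 < v * Q" using Q by auto
    then show False using lt q' by linarith
  next
    case 3
    then have "u \<le> -1" "v \<le> -1" by auto
    then have "u * q \<le> -1 * q" "v * Q < 0"
      using Q mult_right_mono[of u "-1" q] by (auto simp: mult_neg_pos)
    then show False using lt q' by linarith
  next
    case 4
    have "e \<le> \<bar>of_int v * e - of_int u * d\<bar>"
    proof (cases "v > 0")
      case True
      then have "u \<le> 0" "1 \<le> v" using 4 by (auto simp: mult_le_0_iff)
      then have "e \<le> of_int v * e" "of_int u * d \<le> 0" using e d by (auto simp: mult_nonpos_nonneg)
      then show ?thesis by linarith
    next
      case False
      then have "u \<ge> 0" "v \<le> -1" using 4 by (auto simp: mult_le_0_iff)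
      then have "of_int v \<le> (-1 :: real)" "(0 :: real) \<le> of_int u" by auto
      then have "of_int v * e \<le> (-1) * e" "of_int u * d \<ge> 0"
        using e d mult_right_mono[of "of_int v" "-1" e] by auto
      then show ?thesis by linarith
    qed
    then show False using sol(1) err e by linarith
  qed
qed

text \<open>A fraction strictly between the neighbours \<open>P/Q\<close> and \<open>R/q\<close> has denominator at least \<open>Q + q\<close>. So it is at
  least \<open>1/(q Q')\<close> away from \<open>R/q\<close>, while its own right neighbour, having denominator at least \<open>4 Q'\<close>, uses up
  at most a quarter of that distance.\<close>

lemma nested_neighbours:
  fixes P Q R q P' Q' R' q' :: int
  assumes det: "R * Q - P * q = 1" "R' * Q' - P' * q' = 1"
    and pos: "Q > 0" "Q' > 0" "q \<ge> 4 * Q" "q' \<ge> 4 * Q'"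
    and lt: "of_int P / of_int Q < (of_int P' / of_int Q' :: real)"
      "of_int P' / of_int Q' < (of_int R / of_int q :: real)"
  shows "q \<le> Q'" "3 / (4 * of_int q * of_int Q') \<le> (of_int R / of_int q :: real) - of_int R' / of_int q'"
proof -
  have q: "q > 0" "q' > 0" using pos by auto
  have "P * Q' \<noteq> P' * Q" "P' * q \<noteq> R * Q'"
    using fraction_less_cross[of P Q P' Q'] fraction_less_cross[of P' Q' R q] lt pos q by auto
  from fraction_gap[OF pos(1,2) this(1)] fraction_gap[OF pos(2) q(1) this(2)]
  have g: "1 / (of_int Q * of_int Q') \<le> of_int P' / of_int Q' - (of_int P / of_int Q :: real)"
    "1 / (of_int Q' * of_int q) \<le> of_int R / of_int q - (of_int P' / of_int Q' :: real)"
    using lt by auto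
  note G = det_one_gap[OF det(1) pos(1) q(1)] and G' = det_one_gap[OF det(2) pos(2) q(2)]
  have "1 / (of_int Q * of_int Q') + 1 / (of_int Q' * of_int q) \<le> (1 / (of_int Q * of_int q) :: real)"
    using g G by linarith
  then have "(1 / (of_int Q * of_int Q') + 1 / (of_int Q' * of_int q)) * (of_int Q * of_int Q' * of_int q)
      \<le> (1 / (of_int Q * of_int q)) * (of_int Q * of_int Q' * of_int q :: real)"
    using pos q by (intro mult_right_mono) auto
  moreover have "(1 / (of_int Q * of_int Q') + 1 / (of_int Q' * of_int q)) * (of_int Q * of_int Q' * of_int q)
      = (of_int q + of_int Q :: real)"
    "(1 / (of_int Q * of_int q)) * (of_int Q * of_int Q' * of_int q) = (of_int Q' :: real)"
    using pos q by (auto simp: field_simps)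
  ultimately have "of_int q + of_int Q \<le> (of_int Q' :: real)" by simp
  then show le: "q \<le> Q'" using pos by linarith
  have "4 * q \<le> q'" using le pos by linarith
  then have "4 * of_int q \<le> (of_int q' :: real)" by linarith
  then have "1 / (of_int Q' * of_int q') \<le> (1 / (of_int Q' * (4 * of_int q)) :: real)"
    using pos q by (intro divide_left_mono mult_left_mono mult_pos_pos) auto
  moreover have "3 / (4 * of_int q * of_int Q') = 1 / (of_int Q' * of_int q) - (1 / (of_int Q' * (4 * of_int q)) :: real)"
    using pos q by (simp add: field_simps)
  ultimately show "3 / (4 * of_int q * of_int Q') \<le> (of_int R / of_int q :: real) - of_int R' / of_int q'"
    using g G' by linarith
qed

text \<open>If \<open>P'/Q'\<close> lay to the right of \<open>R/q\<close> by no more than \<open>3 b\<close>, then \<open>q\<close> would have to be so large that \<open>R/q\<close> almost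
  coincides with \<open>P/Q\<close>; but \<open>P/Q\<close> and \<open>P'/Q'\<close> are \<open>1/(Q Q')\<close> apart, which is at least \<open>16 b\<close>.\<close>

lemma separated_neighbours:
  fixes P Q R q P' Q' R' q' :: int and b :: real
  assumes det: "R * Q - P * q = 1" "R' * Q' - P' * q' = 1"
    and pos: "Q > 0" "Q' > 0" "q > 0" "q' > 0"
    and b: "of_int Q * of_int Q' * b \<le> 1/16" "of_int Q' * of_int Q' * b \<le> 1/16"
    and lt: "of_int R / of_int q < (of_int P' / of_int Q' :: real)"
  shows "3 * b < of_int R' / of_int q' - of_int R / of_int q"
proof (rule ccontr)
  assume "\<not> ?thesis"
  then have n: "of_int R' / of_int q' - of_int R / of_int q \<le> 3 * b" by simp
  note G = det_one_gap[OF det(1) pos(1,3)] and G' = det_one_gap[OF det(2) pos(2,4)]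
  have Gp: "of_int P / of_int Q < (of_int R / of_int q :: real)" "of_int P' / of_int Q' < (of_int R' / of_int q' :: real)"
    using G G' pos by auto
  have "P * Q' \<noteq> P' * Q" "P' * q \<noteq> R * Q'"
    using fraction_less_cross[of P Q P' Q'] fraction_less_cross[of R q P' Q'] lt Gp pos by auto
  from fraction_gap[OF pos(1,2) this(1)] fraction_gap[OF pos(2,3) this(2)]
  have g: "1 / (of_int Q * of_int Q') \<le> of_int P' / of_int Q' - (of_int P / of_int Q :: real)"
    "1 / (of_int Q' * of_int q) \<le> of_int P' / of_int Q' - (of_int R / of_int q :: real)"
    using lt Gp by auto
  have "1 / (of_int Q' * of_int q) \<le> 3 * b" using g(2) n Gp by linarith
  then have "1 / of_int q \<le> 3 * b * of_int Q'" using pos by (simp add: field_simps)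
  then have "1 / of_int Q * (1 / of_int q) \<le> 1 / of_int Q * (3 * b * of_int Q')"
    using pos by (intro mult_left_mono) auto
  also have "\<dots> = 3 * (of_int Q' * of_int Q' * b) * (1 / (of_int Q * of_int Q'))"
    using pos by (simp add: field_simps)
  also have "\<dots> \<le> 3 * (1/16) * (1 / (of_int Q * of_int Q'))"
    using pos b(2) by (intro mult_right_mono mult_left_mono) auto
  finally have "1 / (of_int Q * of_int q) \<le> 3/16 * (1 / (of_int Q * of_int Q' :: real))" by simp
  then have "13/16 * (1 / (of_int Q * of_int Q' :: real)) \<le> 3 * b"
    using g(1) G n Gp by linarith
  then have "13/16 \<le> 3 * (of_int Q * of_int Q' * b)" using pos by (simp add: field_simps)
  then show False using b(1) by linarith
qed

section \<open>Counting fractions in an interval\<close>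

lemma card_separated:
  fixes X :: "real set"
  assumes X: "X \<subseteq> {u..v}" and uv: "u \<le> v" and d: "d > 0"
    and sep: "\<And>x y. x \<in> X \<Longrightarrow> y \<in> X \<Longrightarrow> x \<noteq> y \<Longrightarrow> d \<le> \<bar>x - y\<bar>"
  shows "finite X" "real (card X) \<le> (v - u) / d + 1"
proof -
  define h where "h x = \<lfloor>(x - u) / d\<rfloor>" for x
  have inj: "inj_on h X"
  proof (rule inj_onI, rule ccontr)
    fix x y assume xy: "x \<in> X" "y \<in> X" "h x = h y" "x \<noteq> y"
    then have "\<bar>(x - u) / d - (y - u) / d\<bar> < 1" unfolding h_def by linarith
    moreover have "(x - u) / d - (y - u) / d = (x - y) / d" by (simp add: diff_divide_distrib)
    ultimately have "\<bar>x - y\<bar> < d" using d by (simp add: abs_divide)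
    then show False using sep xy by fastforce
  qed
  have img: "h ` X \<subseteq> {0..\<lfloor>(v - u) / d\<rfloor>}"
  proof
    fix z assume "z \<in> h ` X"
    then obtain x where x: "x \<in> X" "z = h x" by auto
    then have "u \<le> x" "x \<le> v" using X by auto
    then show "z \<in> {0..\<lfloor>(v - u) / d\<rfloor>}"
      using d x by (auto simp: h_def intro!: floor_mono divide_right_mono)
  qed
  show "finite X" using inj img by (meson finite_atLeastAtMost_int finite_imageD finite_subset)
  have "card X = card (h ` X)" using inj by (simp add: card_image)
  also have "\<dots> \<le> card {0..\<lfloor>(v - u) / d\<rfloor>}" using img by (intro card_mono) auto
  also have "\<dots> = nat (\<lfloor>(v - u) / d\<rfloor> + 1)" by simp
  finally have "real (card X) \<le> real (nat (\<lfloor>(v - u) / d\<rfloor> + 1))" by linarith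
  also have "\<dots> = of_int (\<lfloor>(v - u) / d\<rfloor> + 1)" using uv d by simp
  also have "\<dots> \<le> (v - u) / d + 1" by simp
  finally show "real (card X) \<le> (v - u) / d + 1" .
qed

lemma card_ints_between:
  fixes a b :: real
  assumes "a \<le> b"
  shows "finite {P :: int. a \<le> of_int P \<and> of_int P \<le> b}"
    "real (card {P :: int. a \<le> of_int P \<and> of_int P \<le> b}) \<le> b - a + 1"
proof -
  have eq: "{P :: int. a \<le> of_int P \<and> of_int P \<le> b} = {\<lceil>a\<rceil>..\<lfloor>b\<rfloor>}"
    by (auto simp: ceiling_le_iff le_floor_iff)
  show "finite {P :: int. a \<le> of_int P \<and> of_int P \<le> b}" unfolding eq by simp
  have "real (card {\<lceil>a\<rceil>..\<lfloor>b\<rfloor>}) = real (nat (\<lfloor>b\<rfloor> - \<lceil>a\<rceil> + 1))" by simp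
  also have "\<dots> \<le> b - a + 1" using assms by linarith
  finally show "real (card {P :: int. a \<le> of_int P \<and> of_int P \<le> b}) \<le> b - a + 1" unfolding eq .
qed

lemma interval_length_le_cover:
  fixes c r :: "'i \<Rightarrow> real"
  assumes "finite I" "a \<le> b" "{a..b} \<subseteq> (\<Union>i\<in>I. ball (c i) (r i))" "\<And>i. i \<in> I \<Longrightarrow> 0 \<le> r i"
  shows "b - a \<le> (\<Sum>i\<in>I. 2 * r i)"
proof -
  have m: "measure lborel (ball (c i) (r i)) = 2 * r i" if "i \<in> I" for i
    using assms(4)[OF that] by (simp add: ball_eq_greaterThanLessThan)
  have "b - a = measure lborel {a..b}" using assms(2) by simp
  also have "\<dots> \<le> measure lborel (\<Union>i\<in>I. ball (c i) (r i))"
  proof (rule measure_mono_fmeasurable)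
    show "(\<Union>i\<in>I. ball (c i) (r i)) \<in> fmeasurable lborel"
      using assms(1) by (intro fmeasurable.finite_UN) (auto simp: fmeasurable_def emeasure_lborel_ball_finite simp flip: infinity_ennreal_def)
  qed (use assms(3) in auto)
  also have "\<dots> \<le> (\<Sum>i\<in>I. measure lborel (ball (c i) (r i)))"
    by (rule measure_UNION_le[OF assms(1)]) auto
  also have "\<dots> = (\<Sum>i\<in>I. 2 * r i)" using m by simp
  finally show ?thesis .
qed

text \<open>A crude substitute for the logarithmic bound on harmonic sums: only \<open>o(N)\<close> matters.\<close>

lemma sum_inverse_le:
  assumes "e > 0"
  shows "(\<Sum>Q=1..N. 1 / real Q) \<le> e * real N + 1 / e + 1"
proof -
  define M where "M = nat \<lfloor>1 / e\<rfloor>"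
  have M: "real M \<le> 1 / e" "1 / e < real M + 1" using assms by (auto simp: M_def)
  have "(\<Sum>Q=1..N. 1 / real Q) \<le> (\<Sum>Q=1..N. e + (if Q \<le> M then 1 else 0))"
  proof (rule sum_mono)
    fix Q assume Q: "Q \<in> {1..N}"
    show "1 / real Q \<le> e + (if Q \<le> M then 1 else 0)"
    proof (cases "Q \<le> M")
      case True
      have "1 / real Q \<le> 1" using Q by simp
      then show ?thesis using True assms by simp
    next
      case False
      then have "1 / e < real Q" using M by linarith
      then have "1 / real Q < e" using Q assms by (simp add: field_simps)
      then show ?thesis using False by simp
    qed
  qed
  also have "\<dots> = e * real N + (\<Sum>Q\<in>{1..N}. if Q \<le> M then 1 else 0)"
    by (simp add: sum.distrib)
  also have "(\<Sum>Q\<in>{1..N}. if Q \<le> M then 1 else (0::real)) = real (card ({1..N} \<inter> {Q. Q \<le> M}))"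
    by (simp add: sum.If_cases)
  also have "\<dots> \<le> real (card {1..M})" by (intro of_nat_mono card_mono) auto
  also have "\<dots> \<le> 1 / e + 1" using M by simp
  finally show ?thesis by simp
qed

text \<open>Fractions at level \<open>k\<close>. The upper bound \<open>2\<^sup>k / 16\<close> leaves room for the denominators of the children to stay
  below \<open>2\<^bsup>k+j\<^esup>\<close>. The lower bound \<open>2\<^sup>k / 128\<close> is within a factor 8 of it, as much as the counting argument
  needs, and makes the levels in one residue class modulo 3 disjoint.\<close>

definition seeds :: "nat \<Rightarrow> real \<Rightarrow> real \<Rightarrow> (int \<times> int) set" where
  "seeds k u v = {(P, Q). coprime P Q \<and> 0 < Q \<and> 2 ^ k < 128 * Q \<and> 16 * Q \<le> 2 ^ k
      \<and> u \<le> of_int P / of_int Q \<and> of_int P / of_int Q \<le> v}"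

lemma card_seeds_le:
  assumes "u \<le> v"
  shows "finite (seeds k u v)" "real (card (seeds k u v)) \<le> (v - u) * 2 ^ (2 * k) + 1"
proof -
  define h where "h = (\<lambda>(P, Q). of_int P / of_int Q :: real)"
  have inj: "inj_on h (seeds k u v)"
  proof (rule inj_onI)
    fix s t assume st: "s \<in> seeds k u v" "t \<in> seeds k u v" "h s = h t"
    obtain P Q P' Q' where e: "s = (P, Q)" "t = (P', Q')" by (cases s, cases t)
    have "of_int (P * Q') = (of_int (P' * Q) :: real)"
      using st e by (auto simp: h_def seeds_def field_simps)
    then have "P * Q' = P' * Q" by (simp only: of_int_eq_iff)
    then show "s = t" using st e coprime_fraction_unique by (auto simp: seeds_def)
  qed
  have sep: "1 / 2 ^ (2 * k) \<le> \<bar>x - y\<bar>"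
    if xy: "x \<in> h ` seeds k u v" "y \<in> h ` seeds k u v" "x \<noteq> y" for x y
  proof -
    obtain P Q P' Q' where e: "(P, Q) \<in> seeds k u v" "(P', Q') \<in> seeds k u v"
      "x = of_int P / of_int Q" "y = of_int P' / of_int Q'"
      using xy by (auto simp: h_def)
    have pos: "Q > 0" "Q' > 0" "16 * Q \<le> 2 ^ k" "16 * Q' \<le> 2 ^ k" using e by (auto simp: seeds_def)
    have "P * Q' \<noteq> P' * Q"
    proof
      assume "P * Q' = P' * Q"
      then have "of_int P * of_int Q' = (of_int P' * of_int Q :: real)" by (metis of_int_mult)
      then have "x = y" using pos unfolding e(3,4) by (simp add: frac_eq_eq)
      then show False using xy by simp
    qed
    from fraction_gap[OF pos(1,2) this]
    have g: "1 / (of_int Q * of_int Q') \<le> \<bar>x - y\<bar>" using e by simp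
    have "Q * Q' \<le> 2 ^ k * 2 ^ k" using pos by (intro mult_mono) auto
    then have "of_int (Q * Q') \<le> (of_int (2 ^ (2 * k)) :: real)"
      by (metis mult_2 of_int_le_iff power_add)
    then have "of_int Q * of_int Q' \<le> (2 ^ (2 * k) :: real)" by simp
    then have "1 / 2 ^ (2 * k) \<le> 1 / (of_int Q * of_int Q' :: real)"
      using pos by (intro divide_left_mono) auto
    then show ?thesis using g by linarith
  qed
  have sub: "h ` seeds k u v \<subseteq> {u..v}" by (auto simp: h_def seeds_def)
  note * = card_separated[OF sub assms _ sep, simplified]
  show "finite (seeds k u v)" using * inj by (meson finite_imageD)
  show "real (card (seeds k u v)) \<le> (v - u) * 2 ^ (2 * k) + 1"
    using * inj by (simp add: card_image)
qed

text \<open>By Dirichlet's theorem with \<open>n = 2\<^sup>k / 16\<close>, the intervals of radius \<open>1/(Q n)\<close> around fractions with denominator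
  at most \<open>n\<close> cover everything. Those with \<open>Q \<le> n / 8\<close> have total length about a quarter of the interval.
  What remains is covered by seeds, each contributing at most \<open>16 / n\<^sup>2\<close>, so there are many seeds.\<close>

lemma card_seeds_ge:
  fixes u v :: real
  assumes uv: "u < v"
  shows "\<exists>K. \<forall>k\<ge>K. (v - u) * 2 ^ (2 * k) / 2 ^ 14 \<le> real (card (seeds k u v))"
proof -
  define d where "d = (v - u) / 4"
  define L where "L = (v - u) / 2"
  have dL: "d > 0" "L > 0" "L = 2 * d" using uv by (auto simp: d_def L_def)
  \<comment> \<open>harmonic sum up to \<open>n / 8\<close> at most \<open>e n / 8 + O(1)\<close>, small against \<open>L n\<close>\<close>
  define e where "e = L / 4"
  have e: "e > 0" using dL by (simp add: e_def)
  define G where "G = 1 + 2 * (1 / e + 1)"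
  have "eventually (\<lambda>n. 1 / real n < min d (L / 16 / G)) sequentially"
    using dL e by (intro order_tendstoD[OF lim_1_over_n]) (auto simp: G_def intro!: divide_pos_pos add_pos_pos)
  then obtain N0 where N0: "\<And>n. n \<ge> N0 \<Longrightarrow> 1 / real n < min d (L / 16 / G)"
    unfolding eventually_sequentially by blast
  show ?thesis
  proof (intro exI[of _ "N0 + 7"] allI impI)
    fix k assume k: "N0 + 7 \<le> k"
    define N where "N = (2::nat) ^ (k - 7)"
    define n where "n = 8 * N"
    have nk: "2 ^ k = 16 * n"
    proof -
      have "k = 7 + (k - 7)" using k by simp
      then have "(2::nat) ^ k = 2 ^ 7 * 2 ^ (k - 7)" by (metis power_add)
      then show ?thesis by (simp add: n_def N_def)
    qed
    have "k - 7 < N" by (simp add: N_def)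
    then have n: "n \<ge> N0" "n > 0" "N > 0" using k by (auto simp: n_def)
    have nr: "real n > 0" using n by simp
    have small: "1 / real n < d" "G / real n < L / 16"
    proof -
      have Gp: "G > 0" using e by (auto simp: G_def intro!: add_pos_pos)
      show "1 / real n < d" using N0[OF n(1)] by simp
      have "1 / real n < L / 16 / G" using N0[OF n(1)] by simp
      then have "1 / real n * G < L / 16 / G * G" using Gp by (intro mult_strict_right_mono)
      then show "G / real n < L / 16" using Gp by simp
    qed
    define Ps where "Ps Q = {P :: int. (u + d - 1 / real n) * real Q \<le> of_int P \<and> of_int P \<le> (v - d + 1 / real n) * real Q}" for Q
    define I1 where "I1 = (SIGMA Q:{1..N}. Ps Q)"
    define S where "S = seeds k u v"
    have le: "(u + d - 1 / real n) * real Q \<le> (v - d + 1 / real n) * real Q" for Q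
    proof (intro mult_right_mono)
      have "0 < 1 / real n" using nr by simp
      moreover have "u + d \<le> v - d" using uv by (simp add: d_def field_simps)
      ultimately show "u + d - 1 / real n \<le> v - d + 1 / real n" by linarith
    qed simp
    have Lr: "v - d - (u + d) = L"
    proof -
      have "v - u = 4 * d" by (simp add: d_def)
      then show ?thesis using dL by linarith
    qed
    have finPs: "finite (Ps Q)" for Q unfolding Ps_def by (rule card_ints_between[OF le])
    have cPs: "real (card (Ps Q)) \<le> (L + 2 / real n) * real Q + 1" for Q
    proof -
      have "real (card (Ps Q)) \<le> (v - d + 1 / real n) * real Q - (u + d - 1 / real n) * real Q + 1"
        unfolding Ps_def by (rule card_ints_between[OF le])
      also have "\<dots> = ((v - d - (u + d)) + 2 / real n) * real Q + 1" by (simp add: algebra_simps)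
      finally show ?thesis unfolding Lr .
    qed
    have finI1: "finite I1" unfolding I1_def using finPs by auto
    have finS: "finite S" unfolding S_def using uv by (intro card_seeds_le) simp
    let ?U = "(\<Union>i\<in>I1 <+> S. ball
        (case i of Inl (Q, P) \<Rightarrow> of_int P / real Q | Inr (P, Q) \<Rightarrow> of_int P / of_int Q)
        (case i of Inl (Q, P) \<Rightarrow> 1 / (real Q * real n) | Inr (P, Q) \<Rightarrow> 8 / (real n * real n)))"
    have cover: "{u + d..v - d} \<subseteq> ?U"
    proof
      fix x assume x: "x \<in> {u + d..v - d}"
      obtain P Q where PQ: "coprime P Q" "0 < Q" "Q \<le> int n" "\<bar>of_int Q * x - of_int P\<bar> < 1 / real n"
        using Dirichlet_approx_coprime[of n x] n by metis
      have "\<bar>of_int P / of_int Q - x\<bar> = \<bar>of_int Q * x - of_int P\<bar> / of_int Q"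
        using PQ(2) by (simp add: abs_divide abs_minus_commute divide_simps flip: abs_of_pos)
          (simp add: abs_mult[symmetric] abs_minus_commute algebra_simps)
      also have "\<dots> < 1 / real n / of_int Q" using PQ by (intro divide_strict_right_mono) auto
      finally have near: "\<bar>of_int P / of_int Q - x\<bar> < 1 / (of_int Q * real n)" by (simp add: mult.commute)
      have "1 / (of_int Q * real n) \<le> 1 / (1 * real n)"
        using PQ(2) nr by (intro divide_left_mono mult_right_mono) auto
      then have near1: "\<bar>of_int P / of_int Q - x\<bar> < 1 / real n" using near by simp
      show "x \<in> ?U"
      proof (cases "Q \<le> int N")
        case True
        have rQ: "real (nat Q) = of_int Q" using PQ by simp
        have "u + d - 1 / real n \<le> of_int P / of_int Q" "of_int P / of_int Q \<le> v - d + 1 / real n"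
          using near1 x by (auto simp: abs_less_iff)
        then have "P \<in> Ps (nat Q)" using PQ(2) rQ by (simp add: Ps_def field_simps)
        moreover have "nat Q \<in> {1..N}" using True PQ by auto
        ultimately have "Inl (nat Q, P) \<in> I1 <+> S" by (auto simp: I1_def)
        moreover have "x \<in> ball (of_int P / real (nat Q)) (1 / (real (nat Q) * real n))"
          using near rQ by (simp add: dist_real_def)
        ultimately show ?thesis by (intro UN_I[of "Inl (nat Q, P)"]) auto
      next
        case False
        have k2: "(2::int) ^ k = 16 * int n" using nk by (metis of_nat_mult of_nat_numeral of_nat_power)
        have "u \<le> of_int P / of_int Q" "of_int P / of_int Q \<le> v"
          using near1 x small by (auto simp: abs_less_iff)
        then have "(P, Q) \<in> S" using PQ False k2 by (auto simp: S_def seeds_def n_def)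
        then have "Inr (P, Q) \<in> I1 <+> S" by auto
        moreover have "1 / (of_int Q * real n) \<le> 8 / (real n * real n)"
        proof -
          have "real N \<le> of_int Q" using False by linarith
          then have "real n \<le> 8 * of_int Q" by (simp add: n_def)
          then show ?thesis using nr PQ by (simp add: field_simps)
        qed
        then have "x \<in> ball (of_int P / of_int Q) (8 / (real n * real n))"
          using near by (simp add: dist_real_def)
        ultimately show ?thesis by (intro UN_I[of "Inr (P, Q)"]) auto
      qed
    qed
    have fin: "finite (I1 <+> S)" using finI1 finS by simp
    have "(v - d) - (u + d) \<le> (\<Sum>i\<in>I1 <+> S. 2 * (case i of Inl (Q, P) \<Rightarrow> 1 / (real Q * real n) | Inr (P, Q) \<Rightarrow> 8 / (real n * real n)))"
      by (rule interval_length_le_cover[OF fin _ cover]) (auto simp: d_def split: sum.splits, insert uv, argo)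
    also have "\<dots> = (\<Sum>(Q, P)\<in>I1. 2 * (1 / (real Q * real n))) + (\<Sum>s\<in>S. 2 * (8 / (real n * real n)))"
      by (subst sum.Plus[OF finI1 finS]) (simp add: case_prod_beta comp_def)
    also have "(\<Sum>(Q, P)\<in>I1. 2 * (1 / (real Q * real n))) = (\<Sum>Q=1..N. \<Sum>P\<in>Ps Q. 2 * (1 / (real Q * real n)))"
      unfolding I1_def using finPs by (subst sum.Sigma) auto
    also have "\<dots> = (\<Sum>Q=1..N. real (card (Ps Q)) * (2 / (real Q * real n)))" by simp
    also have "\<dots> \<le> (\<Sum>Q=1..N. ((L + 2 / real n) * real Q + 1) * (2 / (real Q * real n)))"
      using cPs by (intro sum_mono mult_right_mono) auto
    also have "\<dots> = (\<Sum>Q=1..N. (L + 2 / real n) * (2 / real n) + 2 / real n * (1 / real Q))"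
      using nr by (intro sum.cong) (auto simp: field_simps)
    also have "\<dots> = real N * ((L + 2 / real n) * (2 / real n)) + 2 / real n * (\<Sum>Q=1..N. 1 / real Q)"
      by (simp add: sum.distrib sum_distrib_left)
    also have "\<dots> \<le> real N * ((L + 2 / real n) * (2 / real n)) + 2 / real n * (e * real N + 1 / e + 1)"
      using sum_inverse_le[OF e, of N] nr by (intro add_left_mono mult_left_mono) auto
    also have "\<dots> = L / 4 + 1 / (2 * real n) + e / 4 + 2 * (1 / e + 1) / real n"
      using n e by (simp add: n_def field_simps)
    also have "\<dots> \<le> L / 4 + e / 4 + G / real n" using nr by (simp add: G_def field_simps)
    also have "\<dots> \<le> L / 4 + L / 16 + L / 16"
    proof -
      have "e / 4 = L / 16" by (simp add: e_def)
      then show ?thesis using small(2) by linarith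
    qed
    finally have "L \<le> 3 * L / 8 + (\<Sum>s\<in>S. 2 * (8 / (real n * real n)))"
      unfolding Lr by simp
    also have "(\<Sum>s\<in>S. 2 * (8 / (real n * real n))) = 16 * real (card S) / (real n * real n)" by simp
    finally have "5 * L / 8 \<le> 16 * real (card S) / (real n * real n)" by simp
    then have "5 * L / 8 * (real n * real n) \<le> 16 * real (card S)"
      using nr by (simp add: pos_le_divide_eq)
    moreover have "L / 32 * (real n * real n) \<le> 5 * L / 8 / 16 * (real n * real n)"
      using dL by (intro mult_right_mono) auto
    ultimately have "L / 32 * (real n * real n) \<le> real (card S)" by simp
    moreover have "(2::real) ^ k = 16 * real n"
      using arg_cong[OF nk, of real] by simp
    then have "(2::real) ^ (2 * k) = (16 * real n) * (16 * real n)"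
      by (simp only: mult_2 power_add)
    then have "(v - u) * 2 ^ (2 * k) / 2 ^ 14 = L / 32 * (real n * real n)"
      by (simp add: L_def)
    ultimately show "(v - u) * 2 ^ (2 * k) / 2 ^ 14 \<le> real (card (seeds k u v))"
      by (simp add: S_def)
  qed
qed

section \<open>Spokes: the intervals next to a Farey neighbour\<close>

text \<open>The last assumption says that \<open>f x / x\<close> is decreasing near zero up to the factor \<open>C\<close>; it is written without
  division because it is used to compare weights.\<close>

locale gauge =
  fixes f :: "real \<Rightarrow> real" and C x0 :: real
  assumes f_pos: "0 < x \<Longrightarrow> 0 < f x"
    and f_mono: "0 < x \<Longrightarrow> x \<le> y \<Longrightarrow> f x \<le> f y"
    and C_ge_1: "1 \<le> C"
    and x0_pos: "0 < x0"
    and quasi: "0 < x \<Longrightarrow> x \<le> y \<Longrightarrow> y < x0 \<Longrightarrow> f y * x \<le> C * f x * y"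

text \<open>A spoke \<open>((k, j), (P, Q), a)\<close> stands for the short interval to the left of the \<open>a\<close>-th child of the seed \<open>P/Q\<close> of
  level \<open>k\<close>; the offset \<open>j\<close> records the size \<open>2\<^sup>j\<close> of \<open>a\<close>, so that the child has denominator about \<open>2\<^bsup>k+j\<^esup>\<close>. Its
  centre is \<open>P/Q\<close> and its tip is the child.\<close>

type_synonym spoke = "(nat \<times> nat) \<times> (int \<times> int) \<times> nat"

definition lvl :: "spoke \<Rightarrow> nat" where "lvl s = fst (fst s)"

definition cen :: "spoke \<Rightarrow> real" where
  "cen s = (case s of ((k, j), (P, Q), a) \<Rightarrow> of_int P / of_int Q)"

definition tip :: "spoke \<Rightarrow> real" where
  "tip s = (case s of ((k, j), (P, Q), a) \<Rightarrow> of_int (child_num P Q a) / of_int (child_den P Q a))"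

text \<open>In the application, \<open>\<Phi> n\<close> is \<open>max 1 (\<Psi>(2\<^sup>n))\<close>.\<close>

locale fans = gauge +
  fixes \<Phi> :: "nat \<Rightarrow> real"
  assumes Phi_ge_1: "1 \<le> \<Phi> n" and Phi_mono: "m \<le> n \<Longrightarrow> \<Phi> m \<le> \<Phi> n"
begin

definition spoke_length :: "nat \<Rightarrow> nat \<Rightarrow> real" where "spoke_length k j = 1 / (2 ^ (2 * k + j) * \<Phi> (k + j))"

text \<open>For these offsets the \<open>2\<^sup>j\<close> spokes that accumulate at distance \<open>2\<^bsup>-2k-j\<^esup>\<close> from a seed have joint weight
  \<open>2\<^sup>j f(spoke_length k j) \<le> 6 C 2\<^bsup>-j\<^esup> f(2\<^bsup>-2k-j\<^esup>)\<close>. The factor \<open>2\<^bsup>-j\<^esup>\<close> makes this summable over \<open>j\<close>, so that a single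
  set may hit the clusters of all offsets at one seed.\<close>

definition good :: "nat \<Rightarrow> nat set" where
  "good k = {j. (j = 0 \<or> 2 ^ j < \<Phi> k) \<and> 2 ^ (2 * j) * f (spoke_length k j) \<le> 6 * C * f (1 / 2 ^ (2 * k + j))}"

definition rad :: "spoke \<Rightarrow> real" where "rad s = spoke_length (fst (fst s)) (snd (fst s))"

definition seg :: "spoke \<Rightarrow> real set" where "seg s = {tip s - rad s..tip s}"

text \<open>The range of \<open>a\<close> starts at \<open>4 * 2\<^sup>j\<close>, so that children have at least four times the denominator of their seed,
  and is shorter than the distance to the next range, so that the clusters of different offsets at one seed
  are well separated.\<close>

definition spokes :: "nat \<Rightarrow> nat \<Rightarrow> real \<Rightarrow> real \<Rightarrow> spoke set" where
  "spokes k j u v = {(k, j)} \<times> seeds k u v \<times> {4 * 2 ^ j..5 * 2 ^ j}"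

definition is_spoke :: "spoke \<Rightarrow> bool" where
  "is_spoke s \<longleftrightarrow> (\<exists>k u v. \<exists>j\<in>good k. s \<in> spokes k j u v)"

lemma spoke_length_pos: "0 < spoke_length k j"
  using Phi_ge_1[of "k + j"] by (simp add: spoke_length_def)

lemma rad_pos: "0 < rad s" by (simp add: rad_def spoke_length_pos)

lemma good_pow_le: "j \<in> good k \<Longrightarrow> 2 ^ j \<le> \<Phi> (k + j)"
  using Phi_ge_1[of "k + j"] Phi_mono[of k "k + j"] by (auto simp: good_def)

lemma spoke_length_le: "j \<in> good k \<Longrightarrow> spoke_length k j \<le> 1 / 2 ^ (2 * k + 2 * j)"
proof -
  assume "j \<in> good k"
  then have "(2::real) ^ (2 * k + j) * 2 ^ j \<le> 2 ^ (2 * k + j) * \<Phi> (k + j)"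
    by (intro mult_left_mono good_pow_le) auto
  then have "1 / (2 ^ (2 * k + j) * \<Phi> (k + j)) \<le> 1 / ((2::real) ^ (2 * k + j) * 2 ^ j)"
    by (intro divide_left_mono) (auto intro!: mult_pos_pos order.strict_trans2[OF _ Phi_ge_1])
  moreover have "(2::real) ^ (2 * k + j) * 2 ^ j = 2 ^ (2 * k + 2 * j)" by (simp add: mult_2 power_add)
  ultimately show ?thesis by (simp add: spoke_length_def)
qed

lemma finite_good: "finite (good k)"
  by (rule finite_subset[OF _ finite_pow2_less[of "\<Phi> k"]]) (auto simp: good_def)

lemma spokeE:
  assumes "is_spoke s"
  obtains k j P Q a q R where
    "s = ((k, j), (P, Q), a)" "j \<in> good k" "q = child_den P Q a" "R = child_num P Q a"
    "lvl s = k" "cen s = of_int P / of_int Q" "tip s = of_int R / of_int q" "rad s = spoke_length k j"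
    "coprime P Q" "0 < Q" "4 * Q \<le> q" "R * Q - P * q = 1"
    "2 ^ k < (128 * of_int Q :: real)" "16 * of_int Q \<le> (2 ^ k :: real)"
    "4 * 2 ^ j \<le> a" "a \<le> 5 * 2 ^ j" "4 * 2 ^ j * of_int Q \<le> (of_int q :: real)"
    "of_int q \<le> (6 * 2 ^ j * of_int Q :: real)"
    "q = int a * Q + companion P Q"
proof -
  obtain k j P Q a where s: "s = ((k, j), (P, Q), a)" by (metis prod.collapse)
  have m: "j \<in> good k" "coprime P Q" "0 < Q" "2 ^ k < 128 * Q" "16 * Q \<le> 2 ^ k" "4 * 2 ^ j \<le> a" "a \<le> 5 * 2 ^ j"
    using assms by (auto simp: is_spoke_def spokes_def seeds_def s)
  note e = companion[OF m(2,3)]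
  define q where "q = child_den P Q a"
  have q: "q = int a * Q + companion P Q" by (simp add: q_def child_den_def)
  have "(2::int) ^ j \<ge> 1" by simp
  have "4 * 2 ^ j \<le> int a" "int a \<le> 5 * 2 ^ j"
    using m(6,7) by (metis of_nat_le_iff of_nat_mult of_nat_numeral of_nat_power)+
  then have "4 * 2 ^ j * Q \<le> int a * Q" "(int a + 1) * Q \<le> 6 * 2 ^ j * Q" "4 * 1 * Q \<le> 4 * 2 ^ j * Q"
    using m(3) \<open>(2::int) ^ j \<ge> 1\<close> by (intro mult_right_mono; linarith)+
  moreover have "(int a + 1) * Q = int a * Q + Q" by (simp add: algebra_simps)
  ultimately have qq: "4 * 2 ^ j * Q \<le> q" "q \<le> 6 * 2 ^ j * Q" "4 * Q \<le> q"
    using e(1,2) q by linarith+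
  have rr: "real_of_int (2 ^ k) < of_int (128 * Q)" "real_of_int (16 * Q) \<le> of_int (2 ^ k)"
    "real_of_int (4 * 2 ^ j * Q) \<le> of_int q" "real_of_int q \<le> of_int (6 * 2 ^ j * Q)"
    using m qq by (simp_all only: of_int_less_iff of_int_le_iff)
  show ?thesis
    by (rule that[OF s m(1) q_def refl _ _ _ _ m(2,3) qq(3) _ _ _ m(6,7) _ _ q])
      (use rr child_det[OF m(2,3)] in \<open>auto simp: s lvl_def cen_def tip_def rad_def q_def\<close>)
qed

lemma spoke_sizes:
  assumes "is_spoke ((k, j), (P, Q), a)" "q = child_den P Q a"
  shows "of_int q \<le> (6/16 * 2 ^ (k + j) :: real)" "spoke_length k j * (of_int q * of_int q) \<le> 1 / 4"
    "spoke_length k j * (of_int Q * of_int q) \<le> 1 / 16" "0 < q"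
    "1 / (of_int Q * of_int q) \<le> (2 ^ 12 / 2 ^ (2 * k) :: real)"
proof -
  from assms obtain q' where *: "j \<in> good k" "q' = child_den P Q a" "0 < Q" "4 * Q \<le> q'"
    "2 ^ k < (128 * of_int Q :: real)" "16 * of_int Q \<le> (2 ^ k :: real)"
    "4 * 2 ^ j * of_int Q \<le> (of_int q' :: real)"  "of_int q' \<le> (6 * 2 ^ j * of_int Q :: real)"
    by (elim spokeE) auto
  have qq: "q' = q" using * assms by simp
  note * = *[unfolded qq]
  show q0: "0 < q" using * by linarith
  have "6 * 2 ^ j * of_int Q \<le> 6 * 2 ^ j * (2 ^ k / 16 :: real)"
    using * by (intro mult_left_mono) auto
  also have "6 * 2 ^ j * (2 ^ k / 16 :: real) = 6/16 * 2 ^ (k + j)" by (simp add: power_add)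
  finally show q1: "of_int q \<le> (6/16 * 2 ^ (k + j) :: real)" using *(8) by linarith
  have "spoke_length k j * (of_int q * of_int q) \<le> 1 / 2 ^ (2 * k + 2 * j) * (6/16 * 2 ^ (k + j) * (6/16 * 2 ^ (k + j)))"
    using spoke_length_le[OF *(1)] q1 q0 spoke_length_pos by (intro mult_mono) (auto simp: less_imp_le)
  also have "\<dots> = 36/256" by (simp add: divide_simps power_add mult_2)
  finally show "spoke_length k j * (of_int q * of_int q) \<le> 1 / 4" by simp
  have "spoke_length k j \<le> 1 / 2 ^ (2 * k + j)"
    using Phi_ge_1[of "k + j"] unfolding spoke_length_def by (intro divide_left_mono) auto
  then have "spoke_length k j * (of_int Q * of_int q) \<le> 1 / 2 ^ (2 * k + j) * (2 ^ k / 16 * (6/16 * 2 ^ (k + j)))"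
    using q1 q0 * spoke_length_pos by (intro mult_mono) (auto simp: less_imp_le)
  also have "\<dots> = 6/256" by (simp add: divide_simps power_add mult_2)
  finally show "spoke_length k j * (of_int Q * of_int q) \<le> 1 / 16" by simp
  have "2 ^ k / 128 * (4 * 1 * (2 ^ k / 128)) \<le> of_int Q * (4 * 2 ^ j * of_int Q :: real)"
    using * by (intro mult_mono) auto
  also have "\<dots> \<le> of_int Q * of_int q" using * by (intro mult_left_mono) auto
  finally have "2 ^ (2 * k) / 2 ^ 12 \<le> (of_int Q * of_int q :: real)" by (simp add: mult_2 power_add)
  then have "1 / (of_int Q * of_int q) \<le> 1 / (2 ^ (2 * k) / 2 ^ 12 :: real)"
    using * q0 by (intro divide_left_mono) auto
  then show "1 / (of_int Q * of_int q) \<le> (2 ^ 12 / 2 ^ (2 * k) :: real)" by simp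
qed

lemma rad_le:
  assumes "is_spoke s"
  shows "rad s \<le> 1 / 2 ^ (2 * lvl s)"
proof -
  from assms obtain k j where kj: "j \<in> good k" "lvl s = k" "rad s = spoke_length k j" by (elim spokeE) auto
  have "rad s \<le> 1 / 2 ^ (2 * k + 2 * j)" using spoke_length_le kj by simp
  also have "\<dots> \<le> 1 / 2 ^ (2 * k)" by (intro divide_left_mono power_increasing) auto
  finally show ?thesis using kj by simp
qed

lemma seg_between:
  assumes "is_spoke s"
  shows "cen s < tip s - rad s" "tip s - cen s \<le> 2 ^ 12 / 2 ^ (2 * lvl s)"
proof -
  from assms obtain k j P Q a q R where s: "s = ((k, j), (P, Q), a)" "q = child_den P Q a"
    "lvl s = k" "cen s = of_int P / of_int Q" "tip s = of_int R / of_int q" "rad s = spoke_length k j"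
    "0 < Q" "R * Q - P * q = 1" by (elim spokeE) auto
  note sz = spoke_sizes[OF assms[unfolded s(1)] s(2)]
  note g = det_one_gap[OF s(8,7) sz(4)]
  have p: "0 < (of_int Q * of_int q :: real)" using s sz by simp
  have "spoke_length k j \<le> 1 / 16 / (of_int Q * of_int q)"
    using sz(3) p by (subst pos_le_divide_eq) auto
  also have "\<dots> < 1 / (of_int Q * of_int q)" using p by (intro divide_strict_right_mono) auto
  finally show "cen s < tip s - rad s" using g s by simp
  show "tip s - cen s \<le> 2 ^ 12 / 2 ^ (2 * lvl s)" using g s sz(5) by simp
qed

text \<open>Supplies the hypotheses of \<open>separated_neighbours\<close> for a length \<open>b\<close> below the spacing at both levels.\<close>

lemma mult_pow_le:
  fixes b x y :: real
  assumes "0 \<le> b" "2 ^ (2 * k) * b \<le> 1" "2 ^ (2 * k') * b \<le> 1" "0 \<le> x" "x \<le> 2 ^ k / 16" "0 \<le> y" "y \<le> 2 ^ k' / 16"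
  shows "x * y * b \<le> 1 / 16"
proof -
  have "x * y \<le> (2 ^ k / 16) * (2 ^ k' / 16)" using assms by (intro mult_mono) auto
  also have "\<dots> \<le> 1/256 * 2 ^ (2 * max k k')"
    by (simp flip: power_add)
  finally have "x * y * b \<le> 1/256 * 2 ^ (2 * max k k') * b" using assms(1) by (intro mult_right_mono)
  also have "\<dots> \<le> 1/256 * 1" using assms by (simp add: max_def)
  finally show ?thesis by simp
qed

text \<open>Of the three possible positions of the second centre relative to the first tip, \<open>nested_neighbours\<close>
  excludes the left side and \<open>separated_neighbours\<close> the right side; only coincidence is left.\<close>

lemma adjacent_of_close:
  assumes s: "is_spoke s" and t: "is_spoke t" and lt: "cen s < cen t"
    and b: "0 \<le> b" "2 ^ (2 * lvl s) * b \<le> 1" "2 ^ (2 * lvl t) * b \<le> 1"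
    and close: "\<bar>tip s - tip t\<bar> \<le> 3 * b"
  shows "tip s = cen t"
proof (rule ccontr)
  assume ne: "tip s \<noteq> cen t"
  from s obtain k j P Q a q R where s': "s = ((k, j), (P, Q), a)" "q = child_den P Q a"
    "lvl s = k" "cen s = of_int P / of_int Q" "tip s = of_int R / of_int q" 
    "0 < Q" "4 * Q \<le> q" "R * Q - P * q = 1" "16 * of_int Q \<le> (2 ^ k :: real)" by (elim spokeE) auto
  from t obtain k' j' P' Q' a' q' R' where t': "t = ((k', j'), (P', Q'), a')" "q' = child_den P' Q' a'"
    "lvl t = k'" "cen t = of_int P' / of_int Q'" "tip t = of_int R' / of_int q'" 
    "0 < Q'" "4 * Q' \<le> q'" "R' * Q' - P' * q' = 1" "16 * of_int Q' \<le> (2 ^ k' :: real)" by (elim spokeE) auto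
  have QQ: "of_int Q * of_int Q' * b \<le> 1/16" "of_int Q' * of_int Q' * b \<le> 1/16"
    using b s' t' by (intro mult_pow_le[of b k k'] mult_pow_le[of b k' k']; simp)+
  show False
  proof (cases "cen t < tip s")
    case True
    note n = nested_neighbours[OF s'(8) t'(8) s'(6) t'(6) s'(7) t'(7)]
    have n1: "q \<le> Q'" and n2: "3 / (4 * of_int q * of_int Q') \<le> tip s - tip t"
      using n lt True s' t' by auto
    have q0: "0 < q" using s' by linarith
    have "3 / (4 * of_int q * of_int Q') \<le> 3 * b" using n2 close by linarith
    then have "1 \<le> 4 * (of_int q * of_int Q' * b)" using q0 t' by (simp add: field_simps)
    also have "of_int q * of_int Q' * b \<le> of_int Q' * of_int Q' * b"
      using n1 t' b by (intro mult_right_mono) auto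
    finally show False using QQ(2) by simp
  next
    case False
    then have "of_int R / of_int q < (of_int P' / of_int Q' :: real)" using ne s' t' by auto
    from separated_neighbours[OF s'(8) t'(8) s'(6) t'(6) _ _ QQ this]
    have "3 * b < tip t - tip s" using s' t' by simp
    then show False using close by linarith
  qed
qed

text \<open>Spokes reach less than half way back to their centres, so a common point forces the second centre
  between the first centre and the first tip. Then \<open>nested_neighbours\<close> makes its denominator at least of
  order \<open>1 / (q rad s)\<close>, which is much larger than \<open>2\<^bsup>lvl s\<^esup>\<close>: overlapping spokes of different centres belong to
  very different levels.\<close>

lemma overlap_nested:
  assumes s: "is_spoke s" and t: "is_spoke t" and lt: "cen s < cen t"
    and x: "x \<in> seg s" "x \<in> seg t"
  shows "lvl s < lvl t" "tip s - 2 * rad s \<le> cen t" "cen t \<le> tip s" "1 \<le> rad s * 2 ^ (2 * lvl t)"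
proof -
  from s obtain k j P Q a q R where s': "s = ((k, j), (P, Q), a)" "q = child_den P Q a"
    "lvl s = k" "cen s = of_int P / of_int Q" "tip s = of_int R / of_int q" "rad s = spoke_length k j"
    "0 < Q" "4 * Q \<le> q" "R * Q - P * q = 1" "j \<in> good k" by (elim spokeE) auto
  from t obtain k' j' P' Q' a' q' R' where t': "t = ((k', j'), (P', Q'), a')" "q' = child_den P' Q' a'"
    "lvl t = k'" "cen t = of_int P' / of_int Q'" "tip t = of_int R' / of_int q'" 
    "0 < Q'" "4 * Q' \<le> q'" "R' * Q' - P' * q' = 1" "16 * of_int Q' \<le> (2 ^ k' :: real)" by (elim spokeE) auto
  note sz = spoke_sizes[OF s[unfolded s'(1)] s'(2)] and sz' = spoke_sizes[OF t[unfolded t'(1)] t'(2)]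
  have A: "cen t < tip s" using seg_between(1)[OF t] x by (auto simp: seg_def)
  then show "cen t \<le> tip s" by simp
  note n = nested_neighbours[OF s'(9) t'(8) s'(7) t'(6) s'(8) t'(7)]
  have n1: "q \<le> Q'" and n2: "3 / (4 * of_int q * of_int Q') \<le> tip s - tip t"
    using n lt A s' t' by auto
  have "tip s - rad s \<le> tip t" using x by (auto simp: seg_def)
  then have r1: "3 / (4 * of_int q * of_int Q') \<le> spoke_length k j" using n2 s' by simp
  then have r2: "3/4 \<le> spoke_length k j * of_int q * of_int Q'" using sz(4) t' by (simp add: field_simps)
  have "tip t - cen t = 1 / (of_int Q' * of_int q')"
    using det_one_gap[OF t'(8,6) sz'(4)] t' by simp
  also have "\<dots> \<le> 1 / (of_int Q' * (4 * of_int q))"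
  proof (intro divide_left_mono mult_left_mono)
    show "4 * of_int q \<le> (of_int q' :: real)" using n1 t' by linarith
  qed (use t' sz(4) sz'(4) in auto)
  also have "\<dots> \<le> spoke_length k j" using r1 sz(4) t' by (simp add: field_simps)
  finally show "tip s - 2 * rad s \<le> cen t" using \<open>tip s - rad s \<le> tip t\<close> s' by simp
  have "spoke_length k j * of_int q \<le> 1 / 2 ^ (2 * k + 2 * j) * (6/16 * 2 ^ (k + j))"
    using spoke_length_le[OF s'(10)] sz spoke_length_pos by (intro mult_mono) (auto simp: less_imp_le)
  also have "\<dots> = 6/16 / 2 ^ (k + j)" by (simp add: divide_simps power_add mult_2)
  also have "\<dots> \<le> 6/16 / 2 ^ k" by (intro divide_left_mono power_increasing) auto
  finally have "spoke_length k j * of_int q * of_int Q' \<le> 6/16 / 2 ^ k * (2 ^ k' / 16)"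
    using t' spoke_length_pos[of k j] sz(4) by (intro mult_mono) (auto simp: less_imp_le)
  then have "3/4 \<le> 6/16 / 2 ^ k * (2 ^ k' / 16 :: real)" using r2 by linarith
  then have "2 ^ k * 32 \<le> (2 ^ k' :: real)" by (simp add: field_simps)
  moreover have "(0::real) < 2 ^ k" by simp
  ultimately have "2 ^ k < (2 ^ k' :: real)" by linarith
  then show "lvl s < lvl t" using s' t' by (simp add: power_less_imp_less_exp)
  have "(3/4) * (3/4) \<le> (spoke_length k j * of_int q * of_int Q') * (spoke_length k j * of_int q * of_int Q')"
    using r2 by (intro mult_mono) auto
  also have "\<dots> = spoke_length k j * (spoke_length k j * (of_int q * of_int q)) * (of_int Q' * of_int Q')" by (simp add: algebra_simps)
  also have "\<dots> \<le> spoke_length k j * (1/4) * (2 ^ k' / 16 * (2 ^ k' / 16))"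
    using sz(2,4) t' spoke_length_pos[of k j] by (intro mult_mono mult_nonneg_nonneg) (auto simp: less_imp_le)
  also have "\<dots> = spoke_length k j * 2 ^ (2 * k') / 1024" by (simp add: mult_2 power_add)
  finally show "1 \<le> rad s * 2 ^ (2 * lvl t)" using s' t' by simp
qed

lemma tips_of_seed:
  assumes "is_spoke ((k, j), (P, Q), a)" "is_spoke ((k', j'), (P, Q), a')" "a < a'"
  shows "tip ((k, j), (P, Q), a) - tip ((k', j'), (P, Q), a')
    = 1 / of_int Q * (1 / of_int (child_den P Q a) - 1 / of_int (child_den P Q a'))"
    "child_den P Q a + Q \<le> child_den P Q a'"
proof -
  have 1: "coprime P Q" "0 < Q" using assms(1) by (auto elim: spokeE)
  note q = spoke_sizes(4)[OF assms(1) refl] spoke_sizes(4)[OF assms(2) refl]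
  have "(int a + 1) * Q \<le> int a' * Q" using assms(3) 1 by (intro mult_right_mono) auto
  then show "child_den P Q a + Q \<le> child_den P Q a'" by (simp add: child_den_def algebra_simps)
  show "tip ((k, j), (P, Q), a) - tip ((k', j'), (P, Q), a')
    = 1 / of_int Q * (1 / of_int (child_den P Q a) - 1 / of_int (child_den P Q a'))"
    using det_one_gap[OF child_det[OF 1] 1(2) q(1)] det_one_gap[OF child_det[OF 1] 1(2) q(2)] 
    by (simp add: tip_def algebra_simps)
qed

text \<open>Consecutive children of denominator about \<open>q\<close> are about \<open>1 / q\<^sup>2\<close> apart, and a spoke is less than half as long because \<open>2\<^sup>j \<le> \<Phi> (k + j)\<close>.\<close>

lemma same_seed_disjoint:
  assumes s: "is_spoke ((k, j), (P, Q), a)" and t: "is_spoke ((k', j'), (P, Q), a')" "a < a'"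
  shows "seg ((k, j), (P, Q), a) \<inter> seg ((k', j'), (P, Q), a') = {}"
proof -
  define q where "q = child_den P Q a"
  define q' where "q' = child_den P Q a'"
  note sz = spoke_sizes[OF s q_def] and sz' = spoke_sizes[OF t(1) q'_def]
  note T = tips_of_seed[OF s t, folded q_def q'_def]
  have Q: "0 < Q" "4 * Q \<le> q" using s by (auto simp: q_def elim: spokeE)
  have "1 / of_int q' \<le> 1 / (of_int q + of_int Q :: real)"
    using T(2) Q sz(4) sz'(4) by (intro divide_left_mono) (auto simp flip: of_int_add)
  then have "1 / of_int Q * (1 / of_int q - 1 / (of_int q + of_int Q)) \<le> 1 / of_int Q * (1 / of_int q - 1 / of_int q' :: real)"
    using Q by (intro mult_left_mono) auto
  moreover have "1 / of_int Q * (1 / of_int q - 1 / (of_int q + of_int Q)) = (1 / (of_int q * (of_int q + of_int Q)) :: real)"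
    using Q sz(4) by (simp add: divide_simps add_pos_pos less_imp_neq[symmetric] flip: of_int_add)
  moreover have "spoke_length k j < 1 / (of_int q * (of_int q + of_int Q))"
  proof -
    have "spoke_length k j * (of_int q * (of_int q + of_int Q)) \<le> spoke_length k j * (of_int q * (of_int q + of_int q))"
      using Q sz(4) spoke_length_pos[of k j] by (intro mult_left_mono add_left_mono) auto
    also have "\<dots> < 1" using sz(2) by (simp add: algebra_simps)
    finally show ?thesis using Q sz(4) by (subst pos_less_divide_eq) auto
  qed
  ultimately have "spoke_length k j < tip ((k, j), (P, Q), a) - tip ((k', j'), (P, Q), a')" using T(1) by linarith
  then show ?thesis by (auto simp: seg_def rad_def)
qed

lemma level_of_index:
  assumes "is_spoke ((k, j), (P, Q), a)" "is_spoke ((k, j'), (P', Q'), a)"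
  shows "j = j'"
proof -
  have "4 * 2 ^ j \<le> a" "a \<le> 5 * 2 ^ j" "4 * 2 ^ j' \<le> a" "a \<le> 5 * 2 ^ j'"
    using assms by (auto elim!: spokeE)
  moreover have False if "i < i'" "4 * 2 ^ i' \<le> a" "a \<le> 5 * 2 ^ i" for i i'
  proof -
    have "(2::nat) ^ Suc i \<le> 2 ^ i'" using that(1) by (intro power_increasing) auto
    moreover have "(2::nat) ^ i > 0" by simp
    ultimately show False using that(2,3) unfolding power_Suc by linarith
  qed
  ultimately show ?thesis by (metis linorder_neqE_nat)
qed

lemma equal_level_disjoint:
  assumes s: "is_spoke s" and t: "is_spoke t" and "s \<noteq> t" "lvl s = lvl t"
  shows "seg s \<inter> seg t = {}"
proof (cases "cen s = cen t")
  case False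
  then show ?thesis
    using overlap_nested(1)[OF s t] overlap_nested(1)[OF t s] assms(4)
    by (metis disjoint_iff linorder_neqE_linordered_idom nat_neq_iff)
next
  case True
  obtain k j P Q a where s': "s = ((k, j), (P, Q), a)" by (metis prod.collapse)
  obtain k' j' P' Q' a' where t': "t = ((k', j'), (P', Q'), a')" by (metis prod.collapse)
  have k: "k = k'" using assms(4) s' t' by (simp add: lvl_def)
  have c: "coprime P Q" "coprime P' Q'" "0 < Q" "0 < Q'"
    using s t by (auto simp: s' t' elim!: spokeE)
  have "of_int (P * Q') = (of_int (P' * Q) :: real)"
    using True c by (simp add: cen_def s' t' frac_eq_eq)
  then have "P * Q' = P' * Q" by (simp only: of_int_eq_iff)
  then have PQ: "P = P'" "Q = Q'" using coprime_fraction_unique[OF c] by auto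
  have "a \<noteq> a'" using level_of_index[of k j P Q a j' P' Q'] s t assms(3) k PQ by (auto simp: s' t')
  then consider "a < a'" | "a' < a" by linarith
  then show ?thesis
  proof cases
    case 1
    then show ?thesis using same_seed_disjoint[of k j P Q a k' j' a'] s t by (simp add: s' t' PQ)
  next
    case 2
    then show ?thesis using same_seed_disjoint[of k' j' P Q a' k j a] s t by (auto simp: s' t' PQ)
  qed
qed

end

section \<open>How much weight a single set can hit\<close>

context fans
begin

definition hits :: "real set \<Rightarrow> spoke \<Rightarrow> bool" where
  "hits B s \<longleftrightarrow> B \<inter> seg s \<noteq> {}"

lemma spokes_card:
  "finite (seeds k u v) \<Longrightarrow> finite (spokes k j u v)"
  "card (spokes k j u v) = card (seeds k u v) * (2 ^ j + 1)"
  by (simp_all add: spokes_def card_cartesian_product mult.commute)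

lemma cen_in: "s \<in> spokes k j u v \<Longrightarrow> u \<le> cen s \<and> cen s \<le> v"
  by (auto simp: spokes_def seeds_def cen_def)

lemma spokes_restrict: "s \<in> spokes k j u v \<Longrightarrow> u' \<le> cen s \<Longrightarrow> cen s \<le> v' \<Longrightarrow> s \<in> spokes k j u' v'"
  by (auto simp: spokes_def seeds_def cen_def)

lemma spokes_lvl: "s \<in> spokes k j u v \<Longrightarrow> lvl s = k \<and> rad s = spoke_length k j"
  by (auto simp: spokes_def lvl_def rad_def)

lemma spokes_is_spoke: "s \<in> spokes k j u v \<Longrightarrow> j \<in> good k \<Longrightarrow> is_spoke s"
  by (auto simp: is_spoke_def)

lemma hits_close:
  assumes "is_spoke s" "hits B s" "\<And>x y. x \<in> B \<Longrightarrow> y \<in> B \<Longrightarrow> \<bar>x - y\<bar> \<le> b" "x \<in> B"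
  shows "tip s - rad s \<le> x + b" "x - b \<le> tip s"
proof -
  obtain y where "y \<in> B" "y \<in> seg s" using assms(2) by (auto simp: hits_def)
  then have "\<bar>y - x\<bar> \<le> b" "tip s - rad s \<le> y" "y \<le> tip s" using assms(3,4) by (auto simp: seg_def)
  then show "tip s - rad s \<le> x + b" "x - b \<le> tip s" by linarith+
qed

text \<open>The seeds of the spokes that are hit lie within \<open>b + O(2\<^bsup>-2k\<^esup>)\<close> of the set and have mutual distance at least
  \<open>2\<^bsup>-2k\<^esup>\<close>; each accounts for at most \<open>2\<^sup>j + 1\<close> spokes.\<close>

lemma card_hit_large:
  assumes j: "j \<in> good k" and B: "\<And>x y. x \<in> B \<Longrightarrow> y \<in> B \<Longrightarrow> \<bar>x - y\<bar> \<le> b"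
    and b: "1 \<le> b * 2 ^ (2 * k)"
  shows "real (card {s \<in> spokes k j u v. hits B s}) \<le> 2 ^ 15 * b * 2 ^ (2 * k + j)"
proof (cases "{s \<in> spokes k j u v. hits B s} = {}")
  case True
  have "0 \<le> b" using b by (smt (verit) mult_nonneg_nonneg mult_nonpos_nonneg zero_less_power)
  then show ?thesis unfolding True by simp
next
  case False
  then obtain x where x: "x \<in> B" by (auto simp: hits_def)
  have b0: "0 \<le> b" using b by (smt (verit) mult_nonneg_nonneg mult_nonpos_nonneg zero_less_power)
  define u' where "u' = x - b - 2 ^ 12 / 2 ^ (2 * k)"
  have le: "u' \<le> x + b" using b0 by (simp add: u'_def) (smt (verit) divide_nonneg_nonneg zero_le_power)
  have "{s \<in> spokes k j u v. hits B s} \<subseteq> spokes k j u' (x + b)"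
  proof
    fix s assume "s \<in> {s \<in> spokes k j u v. hits B s}"
    then have s: "s \<in> spokes k j u v" "hits B s" by auto
    note sp = spokes_is_spoke[OF s(1) j]
    show "s \<in> spokes k j u' (x + b)"
      using hits_close[OF sp s(2) B x] seg_between[OF sp] spokes_lvl[OF s(1)]
      by (intro spokes_restrict[OF s(1)]) (auto simp: u'_def)
  qed
  then have "card {s \<in> spokes k j u v. hits B s} \<le> card (spokes k j u' (x + b))"
    using card_seeds_le(1)[OF le] by (intro card_mono spokes_card(1)) auto
  then have "real (card {s \<in> spokes k j u v. hits B s}) \<le> real (card (seeds k u' (x + b))) * (2 ^ j + 1)"
    unfolding spokes_card(2) by (metis (mono_tags) of_nat_1 of_nat_add of_nat_le_iff of_nat_mult of_nat_numeral of_nat_power)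
  also have "\<dots> \<le> ((x + b - u') * 2 ^ (2 * k) + 1) * (2 * 2 ^ j)"
    using card_seeds_le(2)[OF le, of k] by (intro mult_mono) (auto intro: order_trans[OF of_nat_0_le_iff])
  also have "(x + b - u') * 2 ^ (2 * k) + 1 = 2 * (b * 2 ^ (2 * k)) + (2 ^ 12 + 1)"
    by (simp add: u'_def algebra_simps)
  also have "\<dots> \<le> 2 * (b * 2 ^ (2 * k)) + (2 ^ 12 + 1) * (b * 2 ^ (2 * k))"
    using b by simp
  also have "\<dots> \<le> 2 ^ 14 * (b * 2 ^ (2 * k))" using b by simp
  finally show ?thesis by (simp add: power_add algebra_simps)
qed

text \<open>A spoke longer than the set, and hit by it, contains one of three fixed points.\<close>

lemma card_hit_small:
  assumes G: "\<And>s t. s \<in> G \<Longrightarrow> t \<in> G \<Longrightarrow> s \<noteq> t \<Longrightarrow> seg s \<inter> seg t = {}"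
    and B: "\<And>x y. x \<in> B \<Longrightarrow> y \<in> B \<Longrightarrow> \<bar>x - y\<bar> \<le> b"
    and hit: "\<And>s. s \<in> G \<Longrightarrow> hits B s \<and> b < rad s"
  shows "finite G \<and> card G \<le> 3"
proof (cases "G = {}")
  case False
  then obtain s0 where "s0 \<in> G" by blast
  then obtain x where x: "x \<in> B" using hit[of s0] unfolding hits_def by blast
  have "\<exists>p\<in>{x - b, x, x + b}. p \<in> seg s" if s: "s \<in> G" for s
  proof -
    obtain y where y: "y \<in> B" "y \<in> seg s" using hit[OF s] by (auto simp: hits_def)
    have "\<bar>y - x\<bar> \<le> b" using B y x by auto
    then show ?thesis using y(2) hit[OF s] by (auto simp: seg_def)
  qed
  then obtain p where p: "\<And>s. s \<in> G \<Longrightarrow> p s \<in> {x - b, x, x + b} \<and> p s \<in> seg s" by metis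
  have inj: "inj_on p G"
    using G p by (intro inj_onI) (metis disjoint_iff)
  have "p ` G \<subseteq> {x - b, x, x + b}" using p by blast
  then have f: "finite (p ` G)" "card (p ` G) \<le> card {x - b, x, x + b}"
    by (auto intro: finite_subset card_mono)
  have "card {x - b, x, x + b} \<le> 3" by (simp add: card_insert_if)
  then show ?thesis using f inj by (simp add: card_image finite_image_iff)
qed simp

lemma sum_geometric_le:
  assumes "finite J"
  shows "(\<Sum>j\<in>J. 1 / 2 ^ j) \<le> (2::real)"
proof -
  have "(\<Sum>j\<in>J. (1/2) ^ j) \<le> (\<Sum>j. (1/2::real) ^ j)"
    by (intro sum_le_suminf assms summable_geometric) auto
  also have "\<dots> = 2" by (subst suminf_geometric) auto
  finally show ?thesis by (simp add: power_divide)
qed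

text \<open>The clusters of spokes at a seed sit at distances \<open>2\<^bsup>-2k-j\<^esup>\<close> from it. Those with \<open>2\<^bsup>-2k-j\<^esup> \<le> b\<close> may be hit
  completely; goodness bounds their weights by a geometric series. Of the others at most one is hit,
  because they are further apart than \<open>3 b\<close>; in that one, the number of spokes hit beyond the first is at most
  proportional to \<open>b\<close>.\<close>

lemma hit_weight_one_seed:
  assumes H: "finite H" "\<And>s. s \<in> H \<Longrightarrow> is_spoke s \<and> (\<exists>j a. s = ((k, j), (P, Q), a)) \<and> hits B s \<and> rad s \<le> b"
    and B: "\<And>x y. x \<in> B \<Longrightarrow> y \<in> B \<Longrightarrow> \<bar>x - y\<bar> \<le> b"
    and b: "0 < b" "b * 2 ^ (2 * k) < 1" and x0: "1 / 2 ^ (2 * k) < x0"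
  shows "(\<Sum>s\<in>H. f (rad s)) \<le> 61 * C\<^sup>2 * f b"
proof -
  define lev where "lev s = snd (fst s)" for s :: spoke
  have fb: "0 < f b" using f_pos b by simp
  have elem: "s = ((k, lev s), (P, Q), snd (snd s))" if "s \<in> H" for s
    using H(2)[OF that] by (auto simp: lev_def)
  define H1 where "H1 = {s \<in> H. 1 \<le> b * 2 ^ (2 * k + lev s)}"
  define H2 where "H2 = {s \<in> H. b * 2 ^ (2 * k + lev s) < 1}"
  have split: "(\<Sum>s\<in>H. f (rad s)) = (\<Sum>s\<in>H1. f (rad s)) + (\<Sum>s\<in>H2. f (rad s))"
    using H(1) by (subst sum.union_disjoint[symmetric]) (auto simp: H1_def H2_def intro: sum.cong)
  have good: "lev s \<in> good k" if "s \<in> H" for s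
    using H(2)[OF that] by (auto simp: lev_def elim: spokeE)
  have wt: "2 ^ (2 * j) * f (spoke_length k j) \<le> 6 * C * f (1 / 2 ^ (2 * k + j))" if "j \<in> good k" for j
    using that by (simp add: good_def)
  \<comment> \<open>clusters at distance at most \<open>b\<close> from the seed\<close>
  define J where "J = lev ` H1"
  have J: "finite J" using H(1) by (simp add: J_def H1_def)
  have "(\<Sum>s\<in>H1. f (rad s)) \<le> (\<Sum>s\<in>(\<lambda>(j, a). ((k, j), (P, Q), a)) ` (SIGMA j:J. {4 * 2 ^ j..5 * 2 ^ j}). f (rad s))"
  proof (rule sum_mono2)
    show "H1 \<subseteq> (\<lambda>(j, a). ((k, j), (P, Q), a)) ` (SIGMA j:J. {4 * 2 ^ j..5 * 2 ^ j})"
    proof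
      fix s assume s: "s \<in> H1"
      then have sH: "s \<in> H" by (simp add: H1_def)
      have "is_spoke ((k, lev s), (P, Q), snd (snd s))" using H(2)[OF sH] elem[OF sH] by simp
      then have "4 * 2 ^ lev s \<le> snd (snd s)" "snd (snd s) \<le> 5 * 2 ^ lev s" by (auto elim: spokeE)
      then have "(lev s, snd (snd s)) \<in> (SIGMA j:J. {4 * 2 ^ j..5 * 2 ^ j})" using s by (auto simp: J_def)
      then show "s \<in> (\<lambda>(j, a). ((k, j), (P, Q), a)) ` (SIGMA j:J. {4 * 2 ^ j..5 * 2 ^ j})"
        using elem[OF sH] by (metis (no_types, lifting) case_prod_conv image_eqI)
    qed
  qed (use J f_pos rad_pos in \<open>auto intro: less_imp_le\<close>)
  also have "\<dots> = (\<Sum>(j, a)\<in>(SIGMA j:J. {4 * 2 ^ j..5 * 2 ^ j::nat}). f (spoke_length k j))"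
    by (subst sum.reindex) (auto simp: inj_on_def rad_def intro!: sum.cong)
  also have "\<dots> = (\<Sum>j\<in>J. \<Sum>a\<in>{4 * 2 ^ j..5 * 2 ^ j::nat}. f (spoke_length k j))"
    using J by (subst sum.Sigma) auto
  also have "\<dots> \<le> (\<Sum>j\<in>J. 12 * C * f b * (1 / 2 ^ j))"
  proof (rule sum_mono)
    fix j assume "j \<in> J"
    then have j: "j \<in> good k" "1 \<le> b * 2 ^ (2 * k + j)" using good by (auto simp: J_def H1_def)
    have "f (1 / 2 ^ (2 * k + j)) \<le> f b" using j(2) by (intro f_mono) (auto simp: field_simps)
    then have "2 ^ (2 * j) * f (spoke_length k j) \<le> 6 * C * f b"
      using wt[OF j(1)] C_ge_1 by (meson mult_left_mono order_trans zero_le_mult_iff zero_le_numeral order.trans zero_le_one)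
    moreover have "(2::real) ^ (2 * j) = 2 ^ j * 2 ^ j" by (simp add: mult_2 power_add)
    ultimately have "2 ^ j * f (spoke_length k j) \<le> 6 * C * f b / 2 ^ j"
      by (subst pos_le_divide_eq) (auto simp: algebra_simps)
    moreover have "(\<Sum>a\<in>{4 * 2 ^ j..5 * 2 ^ j::nat}. f (spoke_length k j)) = (2 ^ j + 1) * f (spoke_length k j)" by simp
    moreover have "(2 ^ j + 1) * f (spoke_length k j) \<le> 2 * 2 ^ j * f (spoke_length k j)"
      using f_pos[OF spoke_length_pos] by (intro mult_right_mono) (auto intro: less_imp_le)
    ultimately have "(\<Sum>a\<in>{4 * 2 ^ j..5 * 2 ^ j::nat}. f (spoke_length k j)) \<le> 2 * (6 * C * f b / 2 ^ j)" by linarith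
    then show "(\<Sum>a\<in>{4 * 2 ^ j..5 * 2 ^ j::nat}. f (spoke_length k j)) \<le> 12 * C * f b * (1 / 2 ^ j)" by simp
  qed
  also have "\<dots> = 12 * C * f b * (\<Sum>j\<in>J. 1 / 2 ^ j)" by (simp add: sum_distrib_left)
  also have "\<dots> \<le> 12 * C * f b * 2"
    using sum_geometric_le[OF J] C_ge_1 fb by (intro mult_left_mono) auto
  finally have big: "(\<Sum>s\<in>H1. f (rad s)) \<le> 24 * C * f b" by simp
  \<comment> \<open>clusters further away than \<open>b\<close>: all hit spokes belong to one of them\<close>
  have close: "\<bar>tip s - tip t\<bar> \<le> 3 * b" if "s \<in> H" "t \<in> H" for s t
  proof -
    have s: "is_spoke s" "hits B s" "rad s \<le> b" and t: "is_spoke t" "hits B t" "rad t \<le> b"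
      using H(2) that by auto
    obtain x where x: "x \<in> B" "x \<in> seg s" using s(2) by (auto simp: hits_def)
    then show ?thesis using hits_close[OF t(1,2) B x(1)] s t by (auto simp: seg_def)
  qed
  have same: "lev s = lev t" if st: "s \<in> H2" "t \<in> H2" for s t
  proof -
    have False if st: "s \<in> H2" "t \<in> H2" and lt: "lev s < lev t" for s t
    proof -
      define i where "i = lev s"
      define j where "j = lev t"
      define a where "a = snd (snd s)"
      define a' where "a' = snd (snd t)"
      have sH: "s \<in> H" "t \<in> H" and bs: "b * 2 ^ (2 * k + i) < 1" using st by (auto simp: H2_def i_def)
      have e: "s = ((k, i), (P, Q), a)" "t = ((k, j), (P, Q), a')"
        using elem[OF sH(1)] elem[OF sH(2)] by (auto simp: i_def j_def a_def a'_def)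
      have sp: "is_spoke ((k, i), (P, Q), a)" "is_spoke ((k, j), (P, Q), a')"
        using H(2)[OF sH(1)] H(2)[OF sH(2)] e by auto
      have qs: "0 < Q" "of_int (child_den P Q a) \<le> (6 * 2 ^ i * of_int Q :: real)" "16 * of_int Q \<le> (2 ^ k :: real)"
        "a \<le> 5 * 2 ^ i"
        using sp(1) by (auto elim: spokeE)
      have qt: "4 * 2 ^ j * of_int Q \<le> (of_int (child_den P Q a') :: real)" "4 * 2 ^ j \<le> a'"
        using sp(2) by (auto elim: spokeE)
      have "Suc i \<le> j" using lt by (simp add: i_def j_def)
      then have p1: "2 * 2 ^ i \<le> (2 ^ j :: nat)" "2 * 2 ^ i \<le> (2 ^ j :: real)"
        using power_increasing[of "Suc i" j "2::nat"] power_increasing[of "Suc i" j "2::real"] by auto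
      moreover have "(0::nat) < 2 ^ i" by simp
      ultimately have aa: "a < a'" using qs(4) qt(2) by linarith
      have "8 * 2 ^ i * of_int Q \<le> (4 * 2 ^ j * of_int Q :: real)" using p1 qs by (intro mult_right_mono) auto
      then have "8 * 2 ^ i * of_int Q \<le> (of_int (child_den P Q a') :: real)" using qt by linarith
      then have "1 / of_int (child_den P Q a') \<le> (1 / (8 * 2 ^ i * of_int Q) :: real)"
        using qs spoke_sizes(4)[OF sp(2) refl] by (intro divide_left_mono) auto
      moreover have "1 / (6 * 2 ^ i * of_int Q) \<le> (1 / of_int (child_den P Q a) :: real)"
        using qs spoke_sizes(4)[OF sp(1) refl] by (intro divide_left_mono) auto
      moreover have "1 / (6 * 2 ^ i * of_int Q) - 1 / (8 * 2 ^ i * of_int Q) = (1 / (24 * 2 ^ i * of_int Q) :: real)"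
        using qs by (simp add: field_simps)
      ultimately have "1 / (24 * 2 ^ i * of_int Q) \<le> (1 / of_int (child_den P Q a) - 1 / of_int (child_den P Q a') :: real)"
        by linarith
      then have "1 / of_int Q * (1 / (24 * 2 ^ i * of_int Q)) \<le> 3 * b"
        using tips_of_seed(1)[OF sp aa] close[OF sH] e qs
        by (smt (verit) divide_nonneg_nonneg mult_left_mono of_int_0_le_iff zero_le_one)
      then have "1 \<le> 72 * (b * 2 ^ i * (of_int Q * of_int Q))" using qs(1) by (simp add: field_simps)
      also have "of_int Q * of_int Q \<le> (2 ^ k / 16 * (2 ^ k / 16) :: real)"
        using qs by (intro mult_mono) auto
      then have "72 * (b * 2 ^ i * (of_int Q * of_int Q)) \<le> 72 * (b * 2 ^ i * (2 ^ k / 16 * (2 ^ k / 16)))"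
        using b by (intro mult_left_mono) auto
      also have "\<dots> = 72/256 * (b * 2 ^ (2 * k + i))" by (simp add: mult_2 power_add)
      also have "\<dots> < 1" using bs by simp
      finally show False by simp
    qed
    then show ?thesis using st by (metis linorder_neqE_nat)
  qed
  have small: "(\<Sum>s\<in>H2. f (rad s)) \<le> 37 * C\<^sup>2 * f b"
  proof (cases "H2 = {}")
    case True
    then show ?thesis using fb by simp
  next
    case False
    then obtain s where s: "s \<in> H2" by auto
    define j where "j = lev s"
    have sH: "s \<in> H" "b * 2 ^ (2 * k + j) < 1" "j \<in> good k" using s good by (auto simp: H2_def j_def)
    have rad: "rad t = spoke_length k j" if "t \<in> H2" for t
      using same[OF that s] elem[of t] that by (auto simp: rad_def j_def H2_def) (metis fst_conv snd_conv)
    have el: "t = ((k, j), (P, Q), snd (snd t))" if "t \<in> H2" for t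
      using same[OF that s] elem[of t] that by (auto simp: j_def H2_def)
    have inj: "inj_on tip H2"
    proof (rule inj_onI, rule ccontr)
      fix t t' assume t: "t \<in> H2" "t' \<in> H2" "tip t = tip t'" "t \<noteq> t'"
      have sp: "is_spoke t" "is_spoke t'" using H(2) t by (auto simp: H2_def)
      have "lvl t = lvl t'" using el[OF t(1)] el[OF t(2)] unfolding lvl_def by (metis fst_conv)
      from equal_level_disjoint[OF sp t(4) this] show False
        using t(3) rad[OF t(1)] rad[OF t(2)] spoke_length_pos[of k j] by (auto simp: seg_def)
    qed
    have sep: "1 / 2 ^ (2 * k + 2 * j) \<le> \<bar>x - y\<bar>"
      if xy: "x \<in> tip ` H2" "y \<in> tip ` H2" "x \<noteq> y" for x y
    proof -
      obtain t t' where t: "t \<in> H2" "t' \<in> H2" "x = tip t" "y = tip t'" using xy by auto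
      define a where "a = snd (snd t)"
      define a' where "a' = snd (snd t')"
      have e: "t = ((k, j), (P, Q), a)" "t' = ((k, j), (P, Q), a')"
        using el[OF t(1)] el[OF t(2)] by (auto simp: a_def a'_def)
      have sp: "is_spoke ((k, j), (P, Q), a)" "is_spoke ((k, j), (P, Q), a')"
        using H(2) t e by (auto simp: H2_def)
      note z = spoke_sizes[OF sp(1) refl] and z' = spoke_sizes[OF sp(2) refl]
      define q where "q = child_den P Q a"
      define q' where "q' = child_den P Q a'"
      have x: "x = of_int (child_num P Q a) / of_int q" and y: "y = of_int (child_num P Q a') / of_int q'"
        using t e by (auto simp: tip_def q_def q'_def)
      have q0: "0 < q" "0 < q'" using z z' by (auto simp: q_def q'_def)
      have "child_num P Q a * q' \<noteq> child_num P Q a' * q"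
      proof
        assume "child_num P Q a * q' = child_num P Q a' * q"
        then have "of_int (child_num P Q a) * of_int q' = (of_int (child_num P Q a') * of_int q :: real)"
          by (metis of_int_mult)
        then have "x = y" using q0 unfolding x y by (simp add: frac_eq_eq)
        then show False using xy by simp
      qed
      from fraction_gap[OF q0 this] have "1 / (of_int q * of_int q') \<le> \<bar>x - y\<bar>" unfolding x y .
      moreover have "of_int q * of_int q' \<le> (2 ^ (2 * k + 2 * j) :: real)"
      proof -
        have "of_int q * of_int q' \<le> (2 ^ (k + j) * 2 ^ (k + j) :: real)"
        proof (intro mult_mono)
          have "(6/16 * 2 ^ (k + j) :: real) \<le> 1 * 2 ^ (k + j)" by (intro mult_right_mono) auto
          then show "of_int q \<le> (2 ^ (k + j) :: real)" "of_int q' \<le> (2 ^ (k + j) :: real)"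
            using z(1) z'(1) unfolding q_def q'_def by linarith+
        qed (use q0 in auto)
        also have "(2 ^ (k + j) * 2 ^ (k + j) :: real) = 2 ^ (2 * k + 2 * j)" by (simp add: power_add mult_2)
        finally show ?thesis .
      qed
      then have "1 / 2 ^ (2 * k + 2 * j) \<le> 1 / (of_int q * of_int q' :: real)"
        using q0 by (intro divide_left_mono) auto
      ultimately show ?thesis by linarith
    qed
    have sub: "tip ` H2 \<subseteq> {tip s - 3 * b..tip s + 3 * b}"
      using close[OF sH(1)] by (fastforce simp: H2_def abs_le_iff)
    have "real (card (tip ` H2)) \<le> (tip s + 3 * b - (tip s - 3 * b)) / (1 / 2 ^ (2 * k + 2 * j)) + 1"
      by (rule card_separated(2)[OF sub _ _ sep]) (use b in auto)
    then have card: "real (card H2) \<le> 6 * b * 2 ^ (2 * k + 2 * j) + 1"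
      using inj by (simp add: card_image)
    have rb: "spoke_length k j \<le> b" using H(2)[OF sH(1)] rad[OF s] by auto
    define y where "y = 1 / (2::real) ^ (2 * k + j)"
    have y: "0 < y" "b \<le> y" "y < x0"
    proof -
      show "0 < y" by (simp add: y_def)
      show "b \<le> y" using sH(2) by (simp add: y_def field_simps)
      have "y \<le> 1 / 2 ^ (2 * k)" unfolding y_def by (intro divide_left_mono power_increasing) auto
      then show "y < x0" using x0 by linarith
    qed
    have "f (spoke_length k j) * (6 * b * 2 ^ (2 * k + 2 * j)) = 6 * b * 2 ^ (2 * k) * (2 ^ (2 * j) * f (spoke_length k j))"
      by (simp add: power_add)
    also have "\<dots> \<le> 6 * b * 2 ^ (2 * k) * (6 * C * f y)"
      using wt[OF sH(3)] b by (intro mult_left_mono) (auto simp: y_def)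
    also have "\<dots> = 36 * C * 2 ^ (2 * k) * (f y * b)" by simp
    also have "\<dots> \<le> 36 * C * 2 ^ (2 * k) * (C * f b * y)"
      using quasi[OF b(1) y(2,3)] C_ge_1 by (intro mult_left_mono) auto
    also have "\<dots> \<le> 36 * C * 2 ^ (2 * k) * (C * f b * (1 / 2 ^ (2 * k)))"
    proof -
      have "y \<le> 1 / 2 ^ (2 * k)" unfolding y_def by (intro divide_left_mono power_increasing) auto
      then show ?thesis using C_ge_1 fb by (intro mult_left_mono) auto
    qed
    also have "\<dots> = 36 * C\<^sup>2 * f b" by (simp add: power2_eq_square)
    finally have m: "f (spoke_length k j) * (6 * b * 2 ^ (2 * k + 2 * j)) \<le> 36 * C\<^sup>2 * f b" .
    have "(\<Sum>s\<in>H2. f (rad s)) = real (card H2) * f (spoke_length k j)" using rad by simp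
    also have "\<dots> \<le> (6 * b * 2 ^ (2 * k + 2 * j) + 1) * f (spoke_length k j)"
      using card f_pos[OF spoke_length_pos] by (intro mult_right_mono) (auto intro: less_imp_le)
    also have "\<dots> = f (spoke_length k j) * (6 * b * 2 ^ (2 * k + 2 * j)) + f (spoke_length k j)" by (simp add: algebra_simps)
    also have "\<dots> \<le> 36 * C\<^sup>2 * f b + 1 * f b" unfolding mult_1 by (rule add_mono[OF m f_mono[OF spoke_length_pos rb]])
    also have "\<dots> \<le> 36 * C\<^sup>2 * f b + C\<^sup>2 * f b"
      using C_ge_1 fb by (intro add_left_mono mult_right_mono) (auto simp: one_le_power)
    finally show ?thesis by (simp add: algebra_simps)
  qed
  have "24 * C * f b \<le> 24 * C\<^sup>2 * f b"
    using C_ge_1 fb by (intro mult_right_mono mult_left_mono) (auto simp: power2_eq_square)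
  then show ?thesis using split big small by (simp add: algebra_simps)
qed

lemma cen_eq_imp_seed_eq:
  assumes "is_spoke s" "is_spoke t" "cen s = cen t"
  shows "fst (snd s) = fst (snd t)"
proof -
  obtain k j P Q a where s': "s = ((k, j), (P, Q), a)" by (metis prod.collapse)
  obtain k' j' P' Q' a' where t': "t = ((k', j'), (P', Q'), a')" by (metis prod.collapse)
  have c: "coprime P Q" "coprime P' Q'" "0 < Q" "0 < Q'"
    using assms(1,2) by (auto simp: s' t' elim!: spokeE)
  have "of_int (P * Q') = (of_int (P' * Q) :: real)"
    using assms(3) c by (simp add: cen_def s' t' frac_eq_eq)
  then have "P * Q' = P' * Q" by (simp only: of_int_eq_iff)
  then show ?thesis using coprime_fraction_unique[OF c] by (simp add: s' t')
qed

text \<open>Let \<open>s\<close> be a spoke with leftmost centre among those hit. By \<open>adjacent_of_close\<close> every other centre equals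
  the tip of \<open>s\<close>, so only two seeds are involved.\<close>

lemma hit_weight:
  assumes H: "finite H"
      "\<And>s. s \<in> H \<Longrightarrow> is_spoke s \<and> hits B s \<and> rad s \<le> b \<and> b * 2 ^ (2 * lvl s) < 1 \<and> 1 / 2 ^ (2 * lvl s) < x0"
    and uniq: "\<And>s t. s \<in> H \<Longrightarrow> t \<in> H \<Longrightarrow> cen s = cen t \<Longrightarrow> lvl s = lvl t"
    and B: "\<And>x y. x \<in> B \<Longrightarrow> y \<in> B \<Longrightarrow> \<bar>x - y\<bar> \<le> b" and b: "0 < b"
  shows "(\<Sum>s\<in>H. f (rad s)) \<le> 122 * C\<^sup>2 * f b"
proof (cases "H = {}")
  case True
  then show ?thesis using f_pos[OF b] by simp
next
  case False
  define G where "G c = {s \<in> H. cen s = c}" for c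
  have G: "(\<Sum>s\<in>G c. f (rad s)) \<le> 61 * C\<^sup>2 * f b" for c
  proof (cases "G c = {}")
    case True
    then show ?thesis using f_pos[OF b] by simp
  next
    case False
    then obtain s where s: "s \<in> G c" by auto
    obtain k j P Q a where s': "s = ((k, j), (P, Q), a)" by (metis prod.collapse)
    have sH: "s \<in> H" "cen s = c" using s by (auto simp: G_def)
    have k: "lvl s = k" by (simp add: lvl_def s')
    show ?thesis
    proof (rule hit_weight_one_seed[of "G c" k P Q B])
      fix t assume "t \<in> G c"
      then have t: "t \<in> H" "cen t = cen s" using sH by (auto simp: G_def)
      have "fst (snd t) = (P, Q)" using cen_eq_imp_seed_eq[of t s] H(2) t sH by (simp add: s')
      moreover have "fst (fst t) = k" using uniq[OF t(1) sH(1) t(2)] k by (simp add: lvl_def)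
      ultimately have "\<exists>j a. t = ((k, j), (P, Q), a)" by (metis prod.collapse)
      then show "is_spoke t \<and> (\<exists>j a. t = ((k, j), (P, Q), a)) \<and> hits B t \<and> rad t \<le> b"
        using H(2)[OF t(1)] by simp
    qed (use H(1) H(2)[OF sH(1)] k B b in \<open>auto simp: G_def\<close>)
  qed
  obtain s where s: "s \<in> H" "\<And>t. t \<in> H \<Longrightarrow> cen s \<le> cen t"
  proof -
    have "Min (cen ` H) \<in> cen ` H" using H(1) False by (intro Min_in) auto
    then obtain s where s: "s \<in> H" "cen s = Min (cen ` H)" by (metis imageE)
    have "cen s \<le> cen t" if "t \<in> H" for t using H(1) that unfolding s(2) by (intro Min_le) auto
    then show ?thesis using that s(1) by blast
  qed
  have "H \<subseteq> G (cen s) \<union> G (tip s)"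
  proof
    fix t assume t: "t \<in> H"
    show "t \<in> G (cen s) \<union> G (tip s)"
    proof (cases "cen t = cen s")
      case True
      then show ?thesis using t by (simp add: G_def)
    next
      case False
      then have lt: "cen s < cen t" using s(2)[OF t] by simp
      note hs = H(2)[OF s(1)] and ht = H(2)[OF t]
      obtain x where x: "x \<in> B" "x \<in> seg s" using hs by (auto simp: hits_def)
      have "\<bar>tip s - tip t\<bar> \<le> 3 * b"
        using hits_close[of t B b x] ht hs B x by (auto simp: seg_def)
      then have "tip s = cen t"
        using hs ht b by (intro adjacent_of_close[OF _ _ lt, of b]) (auto simp: mult.commute)
      then show ?thesis using t by (simp add: G_def)
    qed
  qed
  then have "(\<Sum>s\<in>H. f (rad s)) \<le> (\<Sum>s\<in>G (cen s) \<union> G (tip s). f (rad s))"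
    using H(1) f_pos[OF rad_pos] by (intro sum_mono2) (auto simp: G_def less_imp_le)
  also have "\<dots> \<le> (\<Sum>s\<in>G (cen s). f (rad s)) + (\<Sum>s\<in>G (tip s). f (rad s))"
  proof -
    have "(\<Sum>s\<in>G (cen s). f (rad s)) + (\<Sum>s\<in>G (tip s). f (rad s))
      = (\<Sum>s\<in>G (cen s) \<union> G (tip s). f (rad s)) + (\<Sum>s\<in>G (cen s) \<inter> G (tip s). f (rad s))"
      using H(1) by (intro sum.union_inter[symmetric]) (auto simp: G_def)
    moreover have "0 \<le> (\<Sum>s\<in>G (cen s) \<inter> G (tip s). f (rad s))"
      using f_pos[OF rad_pos] by (intro sum_nonneg) (auto simp: less_imp_le)
    ultimately show ?thesis by linarith
  qed
  also have "\<dots> \<le> 122 * C\<^sup>2 * f b" using G[of "cen s"] G[of "tip s"] by simp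
  finally show ?thesis .
qed

end

section \<open>A spoke that escapes a cheap cover\<close>

context fans
begin

text \<open>The part of the series at level \<open>k\<close> that comes from good offsets.\<close>

definition mass :: "nat \<Rightarrow> real" where "mass k = (\<Sum>j\<in>good k. 2 ^ (2 * k + j) * f (spoke_length k j))"

definition family :: "nat set \<Rightarrow> real \<Rightarrow> real \<Rightarrow> spoke set" where
  "family Ks u w = (\<Union>k\<in>Ks. \<Union>j\<in>good k. spokes k j u w)"

lemma f_rad_pos: "0 < f (rad s)" by (rule f_pos[OF rad_pos])

lemma mass_nonneg: "0 \<le> mass k"
  unfolding mass_def using f_pos[OF spoke_length_pos] by (intro sum_nonneg) (auto simp: less_imp_le)

lemma familyE:
  assumes "s \<in> family Ks u w"
  obtains j where "lvl s \<in> Ks" "j \<in> good (lvl s)" "s \<in> spokes (lvl s) j u w" "is_spoke s" "rad s = spoke_length (lvl s) j"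
proof -
  from assms obtain k j where kj: "k \<in> Ks" "j \<in> good k" "s \<in> spokes k j u w" by (auto simp: family_def)
  then show ?thesis using that[of j] spokes_lvl[OF kj(3)] spokes_is_spoke[OF kj(3,2)] by auto
qed

lemma finite_family: "finite Ks \<Longrightarrow> u \<le> w \<Longrightarrow> finite (family Ks u w)"
  unfolding family_def by (intro finite_UN_I finite_good spokes_card(1) card_seeds_le(1))

lemma sum_family:
  assumes "finite Ks" "u \<le> w"
  shows "(\<Sum>s\<in>{s \<in> family Ks u w. Pr s}. f (rad s))
    = (\<Sum>k\<in>Ks. \<Sum>j\<in>good k. real (card {s \<in> spokes k j u w. Pr s}) * f (spoke_length k j))"
proof -
  have fin: "finite (spokes k j u w)" for k j
    using assms by (intro spokes_card(1) card_seeds_le(1))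
  have "(\<Sum>s\<in>{s \<in> family Ks u w. Pr s}. f (rad s))
      = (\<Sum>s\<in>(\<Union>(k, j)\<in>Sigma Ks good. {s \<in> spokes k j u w. Pr s}). f (rad s))"
    by (rule sum.cong) (auto simp: family_def)
  also have "\<dots> = (\<Sum>(k, j)\<in>Sigma Ks good. \<Sum>s\<in>{s \<in> spokes k j u w. Pr s}. f (rad s))"
    by (subst sum.UNION_disjoint)
      (use assms finite_good fin in \<open>auto simp: spokes_def case_prod_beta\<close>)
  also have "\<dots> = (\<Sum>(k, j)\<in>Sigma Ks good. real (card {s \<in> spokes k j u w. Pr s}) * f (spoke_length k j))"
  proof (rule sum.cong[OF refl], clarify)
    fix k j
    have "(\<Sum>s\<in>{s \<in> spokes k j u w. Pr s}. f (rad s)) = (\<Sum>s\<in>{s \<in> spokes k j u w. Pr s}. f (spoke_length k j))"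
      by (rule sum.cong) (auto dest: spokes_lvl)
    then show "(\<Sum>s\<in>{s \<in> spokes k j u w. Pr s}. f (rad s)) = real (card {s \<in> spokes k j u w. Pr s}) * f (spoke_length k j)"
      by simp
  qed
  also have "\<dots> = (\<Sum>k\<in>Ks. \<Sum>j\<in>good k. real (card {s \<in> spokes k j u w. Pr s}) * f (spoke_length k j))"
    using assms finite_good by (subst sum.Sigma) auto
  finally show ?thesis .
qed

text \<open>Denominators of seeds at level \<open>k\<close> lie within a factor 8 of each other. This is the reason why only levels
  in one residue class modulo 3 are combined: there a centre determines its level.\<close>

lemma level_of_centre:
  assumes "is_spoke s" "is_spoke t" "cen s = cen t" "lvl s mod 3 = lvl t mod 3"
  shows "lvl s = lvl t"
proof -
  have *: "lvl s < lvl t + 3" if st: "is_spoke s" "is_spoke t" "cen s = cen t" for s t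
  proof -
    from st(1) obtain k j P Q a where s: "s = ((k, j), (P, Q), a)" "lvl s = k" "2 ^ k < (128 * of_int Q :: real)"
      by (elim spokeE) auto
    from st(2) obtain k' j' P' Q' a' where t: "t = ((k', j'), (P', Q'), a')" "lvl t = k'" "16 * of_int Q' \<le> (2 ^ k' :: real)"
      by (elim spokeE) auto
    have "Q = Q'" using cen_eq_imp_seed_eq[OF st] by (simp add: s t)
    then have "(2::real) ^ k < 2 ^ (k' + 3)" using s t by (simp add: power_add)
    then show ?thesis using s t by (simp add: power_less_imp_less_exp)
  qed
  from *[OF assms(1-3)] *[OF assms(2,1) assms(3)[symmetric]] assms(4) show ?thesis by presburger
qed

text \<open>A spoke that overlaps a spoke \<open>s\<close> of a smaller level has its centre within \<open>2 rad s\<close> of the tip of \<open>s\<close>, and by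
  \<open>overlap_nested\<close> the level is then so high that this interval contains about its share of seeds.\<close>

lemma card_overlapped:
  assumes "finite Ks" "u \<le> w" "\<And>k. k \<in> Ks \<Longrightarrow> k mod 3 = c" "k \<in> Ks" "j \<in> good k"
  shows "real (card {t \<in> spokes k j u w. \<exists>s\<in>family Ks u w. lvl s < k \<and> seg s \<inter> seg t \<noteq> {}})
    \<le> 6 * 2 ^ (2 * k + j) * (\<Sum>s\<in>{s \<in> family Ks u w. lvl s < k}. rad s)"
proof -
  let ?O = "{t \<in> spokes k j u w. \<exists>s\<in>family Ks u w. lvl s < k \<and> seg s \<inter> seg t \<noteq> {}}"
  define S where "S = {s \<in> family Ks u w. lvl s < k}"
  define S' where "S' = {s \<in> S. 1 \<le> rad s * 2 ^ (2 * k)}"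
  have fin: "finite S" "finite S'" using finite_family[OF assms(1,2)] by (auto simp: S_def S'_def)
  have le: "tip s - 2 * rad s \<le> tip s" for s using rad_pos[of s] by simp
  have "?O
      \<subseteq> (\<Union>s\<in>S'. spokes k j (tip s - 2 * rad s) (tip s))"
  proof
    fix t assume "t \<in> ?O"
    then obtain s where t: "t \<in> spokes k j u w" and s: "s \<in> family Ks u w" "lvl s < k" "seg s \<inter> seg t \<noteq> {}"
      by blast
    then obtain x where x: "x \<in> seg s" "x \<in> seg t" by auto
    from s(1) have ss: "is_spoke s" "lvl s \<in> Ks" by (auto elim: familyE)
    have tt: "is_spoke t" "lvl t = k" using t spokes_is_spoke[OF t assms(5)] spokes_lvl[OF t] by auto
    have "cen s \<noteq> cen t"
      using level_of_centre[OF ss(1) tt(1)] assms(3)[OF ss(2)] assms(3)[OF assms(4)] tt s(2) by auto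
    moreover have "\<not> cen t < cen s" using overlap_nested(1)[OF tt(1) ss(1) _ x(2,1)] s(2) tt by auto
    ultimately have lt: "cen s < cen t" by simp
    note o = overlap_nested[OF ss(1) tt(1) lt x]
    have "s \<in> S'" using s o tt by (auto simp: S'_def S_def)
    moreover have "t \<in> spokes k j (tip s - 2 * rad s) (tip s)" using spokes_restrict[OF t] o by auto
    ultimately show "t \<in> (\<Union>s\<in>S'. spokes k j (tip s - 2 * rad s) (tip s))" by auto
  qed
  then have "card ?O
      \<le> card (\<Union>s\<in>S'. spokes k j (tip s - 2 * rad s) (tip s))"
    using fin le by (intro card_mono finite_UN_I spokes_card(1) card_seeds_le(1)) auto
  also have "\<dots> \<le> (\<Sum>s\<in>S'. card (spokes k j (tip s - 2 * rad s) (tip s)))" by (rule card_UN_le[OF fin(2)])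
  finally have "real (card ?O)
      \<le> (\<Sum>s\<in>S'. real (card (spokes k j (tip s - 2 * rad s) (tip s))))"
    unfolding of_nat_sum[symmetric] by (rule of_nat_mono)
  also have "\<dots> \<le> (\<Sum>s\<in>S'. 6 * 2 ^ (2 * k + j) * rad s)"
  proof (rule sum_mono)
    fix s assume "s \<in> S'"
    then have 1: "1 \<le> rad s * 2 ^ (2 * k)" by (simp add: S'_def)
    have "real (card (spokes k j (tip s - 2 * rad s) (tip s)))
        = real (card (seeds k (tip s - 2 * rad s) (tip s))) * (2 ^ j + 1)"
      unfolding spokes_card(2) by (simp add: algebra_simps)
    also have "\<dots> \<le> ((tip s - (tip s - 2 * rad s)) * 2 ^ (2 * k) + 1) * (2 * 2 ^ j)"
      using card_seeds_le(2)[OF le, of k s] rad_pos[of s] by (intro mult_mono) auto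
    also have "\<dots> \<le> (3 * (rad s * 2 ^ (2 * k))) * (2 * 2 ^ j)" using 1 by (intro mult_right_mono) auto
    finally show "real (card (spokes k j (tip s - 2 * rad s) (tip s))) \<le> 6 * 2 ^ (2 * k + j) * rad s"
      by (simp add: power_add algebra_simps)
  qed
  also have "\<dots> = 6 * 2 ^ (2 * k + j) * (\<Sum>s\<in>S'. rad s)" by (simp add: sum_distrib_left)
  also have "\<dots> \<le> 6 * 2 ^ (2 * k + j) * (\<Sum>s\<in>S. rad s)"
    using fin rad_pos by (intro mult_left_mono sum_mono2) (auto simp: S'_def less_imp_le)
  finally show ?thesis unfolding S_def .
qed

text \<open>Divergence of the masses in a residue class of levels modulo 3, in the form needed by \<open>fresh_family\<close>: finite
  sets of arbitrarily high levels whose mass passes \<open>K\<close> with the last level only.\<close>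

definition divergent_class :: "nat \<Rightarrow> bool" where
  "divergent_class c \<longleftrightarrow> (\<forall>K0 K. \<exists>Ks. finite Ks \<and> (\<forall>k\<in>Ks. K0 \<le> k \<and> k mod 3 = c) \<and> K \<le> (\<Sum>k\<in>Ks. mass k)
      \<and> (\<forall>k\<in>Ks. (\<Sum>k'\<in>{k'\<in>Ks. k' < k}. mass k') \<le> K))"

end

text \<open>Steepness is kept apart from the geometry of spokes. It enters where weights are compared with lengths.\<close>

locale steep_fans = fans +
  assumes steep: "\<exists>\<delta>>0. \<forall>x. 0 < x \<and> x < \<delta> \<longrightarrow> M * x \<le> f x"
begin

text \<open>The admissible ratio of the total length of the cover to the length of the interval. It only has to be
  small against the constants of \<open>card_hit_large\<close> and \<open>fresh_family\<close>.\<close>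

definition eps :: real where "eps = 1 / 2 ^ 32"

text \<open>Discard every spoke that overlaps one of smaller level. The spokes of smaller levels have total weight
  \<open>O(K \<bar>I\<bar>)\<close>, since their partial sum of the series has not yet passed \<open>K\<close>; at high levels \<open>f x / x\<close> is huge, so
  their total length is a small fraction of \<open>\<bar>I\<bar>\<close>. By \<open>card_overlapped\<close> at each level at most half of the
  spokes are discarded. Only the last level may contribute a mass far above \<open>K\<close>, and nothing is discarded
  because of it.\<close>

lemma fresh_family:
  assumes uw: "u < w" and K: "0 \<le> K"
    and div: "divergent_class c"
  shows "\<exists>Ks S. finite Ks \<and> (\<forall>k\<in>Ks. K0 \<le> k \<and> k mod 3 = c) \<and> K \<le> (\<Sum>k\<in>Ks. mass k) \<and> S \<subseteq> family Ks u w
    \<and> (\<forall>s\<in>S. \<forall>t\<in>S. s \<noteq> t \<longrightarrow> seg s \<inter> seg t = {})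
    \<and> (w - u) / 2 ^ 15 * (\<Sum>k\<in>Ks. mass k) \<le> (\<Sum>s\<in>S. f (rad s))"
proof -
  define L where "L = w - u"
  have L: "0 < L" using uw by (simp add: L_def)
  \<comment> \<open>large enough to make the total length of the earlier spokes at most \<open>4 L K / M \<le> L / (12 * 2\<^bsup>14\<^esup>)\<close>\<close>
  define M where "M = 48 * 2 ^ 14 * K + 1"
  have M: "0 < M" using K by (simp add: M_def)
  obtain \<delta> where \<delta>: "\<delta> > 0" "\<And>x. 0 < x \<Longrightarrow> x < \<delta> \<Longrightarrow> M * x \<le> f x" using steep by blast
  obtain K1 where K1: "\<And>k. k \<ge> K1 \<Longrightarrow> (w - u) * 2 ^ (2 * k) / 2 ^ 14 \<le> real (card (seeds k u w))"
    using card_seeds_ge[OF uw] by blast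
  obtain K2 :: nat where small: "\<And>k. k \<ge> K2 \<Longrightarrow> 1 / 2 ^ (2 * k) < min L \<delta>"
    using inverse_pow4_small[of "min L \<delta>"] L \<delta> by auto
  obtain Ks where Ks: "finite Ks" "\<forall>k\<in>Ks. max K0 (max K1 K2) \<le> k \<and> k mod 3 = c" "K \<le> (\<Sum>k\<in>Ks. mass k)"
      "\<forall>k\<in>Ks. (\<Sum>k'\<in>{k'\<in>Ks. k' < k}. mass k') \<le> K"
    using div unfolding divergent_class_def by meson
  have uw': "u \<le> w" using uw by simp
  define clash where "clash t \<longleftrightarrow> (\<exists>s\<in>family Ks u w. lvl s < lvl t \<and> seg s \<inter> seg t \<noteq> {})" for t
  define S where "S = {s \<in> family Ks u w. \<not> clash s}"
  have LL: "1 \<le> L * 2 ^ (2 * k)" if "k \<in> Ks" for k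
    using small[of k] Ks(2) that by (simp add: field_simps)
  have rad_small: "M * rad s \<le> f (rad s)" if s: "s \<in> family Ks u w" for s
  proof (rule \<delta>(2)[OF rad_pos])
    from s have "is_spoke s" "lvl s \<in> Ks" by (auto elim: familyE)
    then show "rad s < \<delta>" using rad_le[of s] small[of "lvl s"] Ks(2) by fastforce
  qed
  have earlier: "(\<Sum>s\<in>{s \<in> family Ks u w. lvl s < k}. rad s) \<le> L / (12 * 2 ^ 14)" if k: "k \<in> Ks" for k
  proof -
    have "M * (\<Sum>s\<in>{s \<in> family Ks u w. lvl s < k}. rad s) \<le> (\<Sum>s\<in>{s \<in> family Ks u w. lvl s < k}. f (rad s))"
      unfolding sum_distrib_left using rad_small by (intro sum_mono) auto
    also have "\<dots> = (\<Sum>k'\<in>Ks. \<Sum>j\<in>good k'. real (card {s \<in> spokes k' j u w. lvl s < k}) * f (spoke_length k' j))"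
      by (rule sum_family[OF Ks(1) uw'])
    also have "\<dots> \<le> (\<Sum>k'\<in>Ks. if k' < k then 4 * L * mass k' else 0)"
    proof (rule sum_mono)
      fix k' assume k': "k' \<in> Ks"
      show "(\<Sum>j\<in>good k'. real (card {s \<in> spokes k' j u w. lvl s < k}) * f (spoke_length k' j)) \<le> (if k' < k then 4 * L * mass k' else 0)"
      proof (cases "k' < k")
        case False
        have e: "{s \<in> spokes k' j u w. lvl s < k} = {}" for j using False by (auto dest: spokes_lvl)
        show ?thesis using False unfolding e by simp
      next
        case True
        have "real (card {s \<in> spokes k' j u w. lvl s < k}) * f (spoke_length k' j) \<le> 4 * L * (2 ^ (2 * k' + j) * f (spoke_length k' j))" for j
        proof -
          have "{s \<in> spokes k' j u w. lvl s < k} = spokes k' j u w" using True by (auto dest: spokes_lvl)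
          then have "real (card {s \<in> spokes k' j u w. lvl s < k}) = real (card (seeds k' u w)) * (2 ^ j + 1)"
            by (simp add: spokes_card(2) algebra_simps)
          also have "\<dots> \<le> (L * 2 ^ (2 * k') + 1) * (2 * 2 ^ j)"
            using card_seeds_le(2)[OF uw', of k'] L by (intro mult_mono) (auto simp: L_def)
          also have "\<dots> \<le> (2 * (L * 2 ^ (2 * k'))) * (2 * 2 ^ j)"
            using LL[OF k'] by (intro mult_right_mono) auto
          also have "\<dots> = 4 * L * 2 ^ (2 * k' + j)" by (simp add: power_add)
          finally have "real (card {s \<in> spokes k' j u w. lvl s < k}) * f (spoke_length k' j) \<le> 4 * L * 2 ^ (2 * k' + j) * f (spoke_length k' j)"
            using f_pos[OF spoke_length_pos] by (intro mult_right_mono) (auto simp: less_imp_le)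
          then show ?thesis by (simp add: mult.assoc)
        qed
        then have "(\<Sum>j\<in>good k'. real (card {s \<in> spokes k' j u w. lvl s < k}) * f (spoke_length k' j)) \<le> 4 * L * mass k'"
          unfolding mass_def sum_distrib_left by (intro sum_mono)
        then show ?thesis using True by simp
      qed
    qed
    also have "\<dots> = (\<Sum>k'\<in>{k'\<in>Ks. k' < k}. 4 * L * mass k')" using Ks(1) by (simp add: sum.inter_filter)
    also have "\<dots> = 4 * L * (\<Sum>k'\<in>{k'\<in>Ks. k' < k}. mass k')" by (simp add: sum_distrib_left)
    also have "\<dots> \<le> 4 * L * K" using Ks(4) k L by (intro mult_left_mono) auto
    also have "\<dots> \<le> M * (L / (12 * 2 ^ 14))" using L by (simp add: M_def field_simps)
    finally show ?thesis using M by simp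
  qed
  have T: "(\<Sum>s\<in>S. f (rad s)) \<ge> L / 2 ^ 15 * (\<Sum>k\<in>Ks. mass k)"
  proof -
    have "L / 2 ^ 15 * (\<Sum>k\<in>Ks. mass k) = (\<Sum>k\<in>Ks. \<Sum>j\<in>good k. L / 2 ^ 15 * 2 ^ (2 * k + j) * f (spoke_length k j))"
      by (simp add: mass_def sum_distrib_left mult.assoc)
    also have "\<dots> \<le> (\<Sum>k\<in>Ks. \<Sum>j\<in>good k. real (card {s \<in> spokes k j u w. \<not> clash s}) * f (spoke_length k j))"
    proof (intro sum_mono mult_right_mono)
      fix k j assume k: "k \<in> Ks" and j: "j \<in> good k"
      have eq: "{s \<in> spokes k j u w. clash s} = {t \<in> spokes k j u w. \<exists>s\<in>family Ks u w. lvl s < k \<and> seg s \<inter> seg t \<noteq> {}}"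
        by (auto simp: clash_def dest: spokes_lvl)
      have "real (card {s \<in> spokes k j u w. clash s}) \<le> 6 * 2 ^ (2 * k + j) * (\<Sum>s\<in>{s \<in> family Ks u w. lvl s < k}. rad s)"
        unfolding eq using Ks by (intro card_overlapped[OF Ks(1) uw' _ k j, of c]) auto
      also have "\<dots> \<le> 6 * 2 ^ (2 * k + j) * (L / (12 * 2 ^ 14))"
        using earlier[OF k] by (intro mult_left_mono) auto
      finally have c1: "real (card {s \<in> spokes k j u w. clash s}) \<le> L / 2 ^ 15 * 2 ^ (2 * k + j)" by simp
      have "L * 2 ^ (2 * k) / 2 ^ 14 * 2 ^ j \<le> real (card (seeds k u w)) * (2 ^ j + 1)"
        using K1[of k] Ks(2) k L by (intro mult_mono) (auto simp: L_def)
      also have "\<dots> = real (card (spokes k j u w))" by (simp add: spokes_card(2) algebra_simps)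
      also have "card (spokes k j u w) = card {s \<in> spokes k j u w. clash s} + card {s \<in> spokes k j u w. \<not> clash s}"
        using spokes_card(1)[OF card_seeds_le(1)[OF uw'], of k j]
        by (subst card_Un_disjoint[symmetric]) (auto intro: arg_cong[where f = card])
      finally have "L * 2 ^ (2 * k) / 2 ^ 14 * 2 ^ j \<le> real (card {s \<in> spokes k j u w. clash s}) + real (card {s \<in> spokes k j u w. \<not> clash s})"
        by simp
      moreover have "L * 2 ^ (2 * k) / 2 ^ 14 * 2 ^ j = 2 * (L / 2 ^ 15 * 2 ^ (2 * k + j))" by (simp add: power_add)
      ultimately show "L / 2 ^ 15 * 2 ^ (2 * k + j) \<le> real (card {s \<in> spokes k j u w. \<not> clash s})" using c1 by linarith
    qed (use f_pos[OF spoke_length_pos] in \<open>auto simp: less_imp_le\<close>)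
    also have "\<dots> = (\<Sum>s\<in>S. f (rad s))" unfolding S_def by (rule sum_family[OF Ks(1) uw', symmetric])
    finally show ?thesis .
  qed
  have disj: "seg s \<inter> seg t = {}" if st: "s \<in> S" "t \<in> S" "s \<noteq> t" for s t
  proof -
    have sp: "is_spoke s" "is_spoke t" using st by (auto simp: S_def elim: familyE)
    consider "lvl s < lvl t" | "lvl t < lvl s" | "lvl s = lvl t" by linarith
    then show ?thesis
    proof cases
      case 3
      then show ?thesis using equal_level_disjoint[OF sp st(3)] by simp
    qed (use st in \<open>auto simp: S_def clash_def\<close>)
  qed
  show ?thesis
    by (rule exI[of _ Ks], rule exI[of _ S]) (use Ks T disj in \<open>auto simp: S_def L_def\<close>)
qed

text \<open>The family is chosen before the cover, depending on the bound \<open>\<eta>\<close> only; this allows finite covers to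
  be considered here and infinite ones to be reduced to them afterwards. The weights of the spokes that are hit
  by a long set (\<open>S1\<close>), hit by a set of intermediate size (\<open>S2\<close>), or overloaded by short sets (\<open>S3\<close>) are
  bounded by half of the total, \<open>O(\<eta>)\<close> and \<open>O(\<eta>)\<close> respectively, and their sum is less than the total weight.\<close>

lemma spoke_avoiding_cover:
  assumes uv: "u < v" and \<eta>: "0 \<le> \<eta>"
    and div: "divergent_class c"
  shows "\<exists>S. finite S \<and> (\<forall>s\<in>S. is_spoke s \<and> N \<le> lvl s \<and> seg s \<subseteq> {u..v}) \<and>
    (\<forall>BB. finite BB \<longrightarrow> (\<forall>B\<in>BB. bounded B \<and> 0 < diameter B) \<longrightarrow> (\<Sum>B\<in>BB. f (diameter B)) \<le> \<eta> \<longrightarrow>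
      (\<Sum>B\<in>BB. diameter B) \<le> eps * (v - u) \<longrightarrow>
      (\<exists>s\<in>S. (\<forall>B\<in>BB. hits B s \<longrightarrow> diameter B < rad s) \<and> (\<Sum>B\<in>{B\<in>BB. hits B s}. diameter B) \<le> eps * rad s))"
proof -
  \<comment> \<open>centres are taken from the left half only, so that the spokes stay inside \<open>{u..v}\<close>\<close>
  define w where "w = (u + v) / 2"
  define L where "L = w - u"
  have L: "0 < L" "v - u = 2 * L" "v = w + L" "u < w" using uv by (auto simp: L_def w_def field_simps)
  define A where "A = 122 * C\<^sup>2 * \<eta> + 3 * C / eps * \<eta>"
  have A: "0 \<le> A" using \<eta> C_ge_1 by (simp add: A_def eps_def)
  \<comment> \<open>\<open>A\<close> bounds the weight that sets shorter than the spacing account for\<close>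
  define K where "K = (A + 1) * 2 ^ 16 / L"
  have K: "0 \<le> K" using A L by (simp add: K_def)
  have "0 < min (L / 2 ^ 12) x0" using L x0_pos by simp
  then obtain K1 :: nat where "\<And>k. k \<ge> K1 \<Longrightarrow> 1 / 2 ^ (2 * k) < min (L / 2 ^ 12) x0"
    using inverse_pow4_small by blast
  then have small: "1 / 2 ^ (2 * k) < L / 2 ^ 12" "1 / 2 ^ (2 * k) < x0" if "k \<ge> K1" for k
    using that unfolding min_less_iff_conj by blast+
  obtain Ks S where Ks: "finite Ks" "\<forall>k\<in>Ks. max N K1 \<le> k \<and> k mod 3 = c" "K \<le> (\<Sum>k\<in>Ks. mass k)"
    and S: "S \<subseteq> family Ks u w" "\<And>s t. s \<in> S \<Longrightarrow> t \<in> S \<Longrightarrow> s \<noteq> t \<Longrightarrow> seg s \<inter> seg t = {}"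
      "(w - u) / 2 ^ 15 * (\<Sum>k\<in>Ks. mass k) \<le> (\<Sum>s\<in>S. f (rad s))"
  proof -
    from fresh_family[OF L(4) K div, of "max N K1"] obtain Ks S where
      *: "finite Ks \<and> (\<forall>k\<in>Ks. max N K1 \<le> k \<and> k mod 3 = c) \<and> K \<le> (\<Sum>k\<in>Ks. mass k) \<and> S \<subseteq> family Ks u w
        \<and> (\<forall>s\<in>S. \<forall>t\<in>S. s \<noteq> t \<longrightarrow> seg s \<inter> seg t = {})
        \<and> (w - u) / 2 ^ 15 * (\<Sum>k\<in>Ks. mass k) \<le> (\<Sum>s\<in>S. f (rad s))"
      by (elim exE)
    show ?thesis
    proof (rule that[of Ks S])
      show "seg s \<inter> seg t = {}" if "s \<in> S" "t \<in> S" "s \<noteq> t" for s t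
        using *[THEN conjunct2, THEN conjunct2, THEN conjunct2, THEN conjunct2, THEN conjunct1] that by blast
    qed (rule *[THEN conjunct1] *[THEN conjunct2, THEN conjunct1] *[THEN conjunct2, THEN conjunct2, THEN conjunct1]
        *[THEN conjunct2, THEN conjunct2, THEN conjunct2, THEN conjunct1]
        *[THEN conjunct2, THEN conjunct2, THEN conjunct2, THEN conjunct2, THEN conjunct2])+
  qed
  have finS: "finite S" using finite_family[OF Ks(1), of u w] S(1) L finite_subset by auto
  have sp: "is_spoke s" "lvl s \<in> Ks" if "s \<in> S" for s using S(1) that by (auto elim!: familyE)
  have sm: "N \<le> lvl s" "1 / 2 ^ (2 * lvl s) < L / 2 ^ 12" "1 / 2 ^ (2 * lvl s) < x0" if "s \<in> S" for s
    using Ks(2) sp[OF that] small[of "lvl s"] by auto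
  have sub: "seg s \<subseteq> {u..v}" if s: "s \<in> S" for s
  proof -
    have c: "u \<le> cen s" "cen s \<le> w" using S(1) s by (auto elim!: familyE dest: cen_in)
    have "tip s - cen s \<le> 2 ^ 12 * (1 / 2 ^ (2 * lvl s))" using seg_between(2)[OF sp(1)[OF s]] by simp
    also have "\<dots> \<le> 2 ^ 12 * (L / 2 ^ 12)" using sm[OF s] by (intro mult_left_mono) auto
    finally show ?thesis using c L seg_between(1)[OF sp(1)[OF s]] by (auto simp: seg_def)
  qed
  have rad_x0: "rad s < x0" if s: "s \<in> S" for s
    using rad_le[OF sp(1)[OF s]] sm(3)[OF s] by linarith
  have main: "\<exists>s\<in>S. (\<forall>B\<in>BB. hits B s \<longrightarrow> diameter B < rad s) \<and> (\<Sum>B\<in>{B\<in>BB. hits B s}. diameter B) \<le> eps * rad s"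
    if BB: "finite BB" "\<And>B. B \<in> BB \<Longrightarrow> bounded B \<and> 0 < diameter B" and cost: "(\<Sum>B\<in>BB. f (diameter B)) \<le> \<eta>"
      and len: "(\<Sum>B\<in>BB. diameter B) \<le> eps * (v - u)" for BB
  proof (rule ccontr)
    assume neg: "\<not> ?thesis"
    have dist: "\<bar>x - y\<bar> \<le> diameter B" if "B \<in> BB" "x \<in> B" "y \<in> B" for B x y
      using diameter_bounded_bound[of B x y] BB(2)[OF that(1)] that by (simp add: dist_real_def)
    have fB: "0 < f (diameter B)" if "B \<in> BB" for B using f_pos BB(2)[OF that] by simp
    define S1 where "S1 B = {s \<in> S. hits B s \<and> 1 \<le> diameter B * 2 ^ (2 * lvl s)}" for B
    define S2 where "S2 B = {s \<in> S. hits B s \<and> rad s \<le> diameter B \<and> diameter B * 2 ^ (2 * lvl s) < 1}" for B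
    define S3 where "S3 = {s \<in> S. (\<forall>B\<in>BB. hits B s \<longrightarrow> diameter B < rad s) \<and> eps * rad s < (\<Sum>B\<in>{B\<in>BB. hits B s}. diameter B)}"
    have cover: "S \<subseteq> (\<Union>B\<in>BB. S1 B) \<union> (\<Union>B\<in>BB. S2 B) \<union> S3"
    proof
      fix s assume s: "s \<in> S"
      show "s \<in> (\<Union>B\<in>BB. S1 B) \<union> (\<Union>B\<in>BB. S2 B) \<union> S3"
      proof (cases "\<forall>B\<in>BB. hits B s \<longrightarrow> diameter B < rad s")
        case True
        then have "eps * rad s < (\<Sum>B\<in>{B\<in>BB. hits B s}. diameter B)" using neg s by force
        then show ?thesis using True s by (simp add: S3_def)
      next
        case False
        then obtain B where B: "B \<in> BB" "hits B s" "rad s \<le> diameter B" by (auto simp: not_less)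
        show ?thesis
        proof (cases "diameter B * 2 ^ (2 * lvl s) < 1")
          case True
          then show ?thesis using B s by (auto simp: S2_def)
        next
          case False
          then show ?thesis using B s by (auto simp: S1_def)
        qed
      qed
    qed
    have b1: "(\<Sum>s\<in>S1 B. f (rad s)) \<le> 2 ^ 15 * diameter B * (\<Sum>k\<in>Ks. mass k)" if B: "B \<in> BB" for B
    proof -
      define Pr where "Pr s \<longleftrightarrow> hits B s \<and> 1 \<le> diameter B * 2 ^ (2 * lvl s)" for s
      have "(\<Sum>s\<in>S1 B. f (rad s)) \<le> (\<Sum>s\<in>{s \<in> family Ks u w. Pr s}. f (rad s))"
        using S(1) finite_family[OF Ks(1), of u w] L f_rad_pos
        by (intro sum_mono2) (auto simp: S1_def Pr_def less_imp_le)
      also have "\<dots> = (\<Sum>k\<in>Ks. \<Sum>j\<in>good k. real (card {s \<in> spokes k j u w. Pr s}) * f (spoke_length k j))"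
        using L by (intro sum_family Ks) auto
      also have "\<dots> \<le> (\<Sum>k\<in>Ks. \<Sum>j\<in>good k. 2 ^ 15 * diameter B * 2 ^ (2 * k + j) * f (spoke_length k j))"
      proof (intro sum_mono mult_right_mono)
        fix k j assume k: "k \<in> Ks" and j: "j \<in> good k"
        show "real (card {s \<in> spokes k j u w. Pr s}) \<le> 2 ^ 15 * diameter B * 2 ^ (2 * k + j)"
        proof (cases "1 \<le> diameter B * 2 ^ (2 * k)")
          case True
          then have "{s \<in> spokes k j u w. Pr s} = {s \<in> spokes k j u w. hits B s}"
            by (auto simp: Pr_def dest: spokes_lvl)
          then show ?thesis using card_hit_large[OF j dist[OF B] True] by simp
        next
          case False
          then have e: "{s \<in> spokes k j u w. Pr s} = {}" by (auto simp: Pr_def dest: spokes_lvl)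
          show ?thesis using BB(2)[OF B] unfolding e by simp
        qed
      qed (use f_pos[OF spoke_length_pos] in \<open>auto simp: less_imp_le\<close>)
      also have "\<dots> = 2 ^ 15 * diameter B * (\<Sum>k\<in>Ks. mass k)"
        by (simp add: mass_def sum_distrib_left mult.assoc)
      finally show ?thesis .
    qed
    have b2: "(\<Sum>s\<in>S2 B. f (rad s)) \<le> 122 * C\<^sup>2 * f (diameter B)" if B: "B \<in> BB" for B
    proof (rule hit_weight)
      show "finite (S2 B)" using finS by (simp add: S2_def)
      show "lvl s = lvl t" if "s \<in> S2 B" "t \<in> S2 B" "cen s = cen t" for s t
        using that sp Ks(2) by (intro level_of_centre) (auto simp: S2_def)
    qed (use dist[OF B] BB(2)[OF B] sp sm in \<open>auto simp: S2_def\<close>)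
    have b3: "(\<Sum>s\<in>S3. f (rad s)) \<le> 3 * C / eps * \<eta>"
    proof -
      define Z where "Z s = {B \<in> BB. hits B s}" for s
      have one: "f (rad s) \<le> C / eps * (\<Sum>B\<in>Z s. f (diameter B))" if s: "s \<in> S3" for s
      proof -
        have sS: "s \<in> S" and lt: "\<And>B. B \<in> Z s \<Longrightarrow> diameter B < rad s"
          and ov: "eps * rad s < (\<Sum>B\<in>Z s. diameter B)"
          using s by (auto simp: S3_def Z_def)
        have "eps * rad s * f (rad s) \<le> (\<Sum>B\<in>Z s. diameter B) * f (rad s)"
          using ov f_rad_pos[of s] by (intro mult_right_mono) auto
        also have "\<dots> = (\<Sum>B\<in>Z s. f (rad s) * diameter B)" by (simp add: sum_distrib_right mult.commute)
        also have "\<dots> \<le> (\<Sum>B\<in>Z s. C * f (diameter B) * rad s)"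
          using lt rad_x0[OF sS] BB(2) by (intro sum_mono quasi) (auto simp: Z_def less_imp_le)
        also have "\<dots> = C * (\<Sum>B\<in>Z s. f (diameter B)) * rad s"
          by (simp add: sum_distrib_left sum_distrib_right)
        finally have "(eps * f (rad s)) * rad s \<le> (C * (\<Sum>B\<in>Z s. f (diameter B))) * rad s" by (simp add: mult_ac)
        then have "eps * f (rad s) \<le> C * (\<Sum>B\<in>Z s. f (diameter B))" using rad_pos[of s] by simp
        then show ?thesis by (simp add: eps_def field_simps)
      qed
      have "(\<Sum>s\<in>S3. f (rad s)) \<le> (\<Sum>s\<in>S3. C / eps * (\<Sum>B\<in>Z s. f (diameter B)))"
        using one by (intro sum_mono)
      also have "\<dots> = C / eps * (\<Sum>s\<in>S3. \<Sum>B\<in>Z s. f (diameter B))" by (simp add: sum_distrib_left)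
      also have "(\<Sum>s\<in>S3. \<Sum>B\<in>Z s. f (diameter B)) = (\<Sum>B\<in>BB. \<Sum>s\<in>{s\<in>S3. hits B s}. f (diameter B))"
        unfolding Z_def using BB(1) finS by (intro sum.swap_restrict) (auto simp: S3_def)
      also have "\<dots> \<le> (\<Sum>B\<in>BB. 3 * f (diameter B))"
      proof (rule sum_mono)
        fix B assume B: "B \<in> BB"
        have "finite {s\<in>S3. hits B s} \<and> card {s\<in>S3. hits B s} \<le> 3"
        proof (rule card_hit_small)
          show "seg s \<inter> seg t = {}" if "s \<in> {s\<in>S3. hits B s}" "t \<in> {s\<in>S3. hits B s}" "s \<noteq> t" for s t
            using that S(2)[of s t] by (simp add: S3_def)
          show "\<bar>x - y\<bar> \<le> diameter B" if "x \<in> B" "y \<in> B" for x y using dist[OF B that] .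
          show "hits B s \<and> diameter B < rad s" if "s \<in> {s\<in>S3. hits B s}" for s
            using that B unfolding S3_def by blast
        qed
        then have "real (card {s\<in>S3. hits B s}) \<le> 3" by simp
        then show "(\<Sum>s\<in>{s\<in>S3. hits B s}. f (diameter B)) \<le> 3 * f (diameter B)"
          using fB[OF B] by (simp add: mult_right_mono)
      qed
      also have "\<dots> = 3 * (\<Sum>B\<in>BB. f (diameter B))" by (simp add: sum_distrib_left)
      finally have "(\<Sum>s\<in>S3. f (rad s)) \<le> C / eps * (3 * (\<Sum>B\<in>BB. f (diameter B)))"
        using C_ge_1 by (simp add: eps_def mult_left_mono)
      also have "\<dots> \<le> C / eps * (3 * \<eta>)" using cost C_ge_1 by (intro mult_left_mono) (auto simp: eps_def)
      also have "\<dots> = 3 * C / eps * \<eta>" by simp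
      finally show ?thesis .
    qed
    have f0: "0 \<le> f (rad s)" for s using f_rad_pos[of s] by simp
    have fin1: "finite (S1 B)" "finite (S2 B)" "finite S3" for B using finS by (auto simp: S1_def S2_def S3_def)
    define TT where "TT = (\<Sum>k\<in>Ks. mass k)"
    have TT: "0 \<le> TT" unfolding TT_def by (intro sum_nonneg mass_nonneg)
    have "L / 2 ^ 15 * TT \<le> (\<Sum>s\<in>S. f (rad s))" using S(3) by (simp add: L_def TT_def)
    also have "\<dots> \<le> (\<Sum>s\<in>(\<Union>B\<in>BB. S1 B) \<union> (\<Union>B\<in>BB. S2 B) \<union> S3. f (rad s))"
      using cover fin1 BB(1) f0 by (intro sum_mono2) auto
    also have "\<dots> \<le> (\<Sum>s\<in>(\<Union>B\<in>BB. S1 B). f (rad s)) + (\<Sum>s\<in>(\<Union>B\<in>BB. S2 B). f (rad s)) + (\<Sum>s\<in>S3. f (rad s))"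
      using fin1 BB(1) f0 by (intro order_trans[OF sum_Un_le] add_right_mono sum_Un_le) auto
    also have "\<dots> \<le> (\<Sum>B\<in>BB. 2 ^ 15 * diameter B * TT) + (\<Sum>B\<in>BB. 122 * C\<^sup>2 * f (diameter B)) + 3 * C / eps * \<eta>"
      using BB(1) fin1 f0 b1 b2 b3 unfolding TT_def
      by (intro add_mono order_trans[OF sum_UN_le sum_mono]) simp_all
    also have "\<dots> = 2 ^ 15 * TT * (\<Sum>B\<in>BB. diameter B) + 122 * C\<^sup>2 * (\<Sum>B\<in>BB. f (diameter B)) + 3 * C / eps * \<eta>"
      by (simp add: sum_distrib_left sum_distrib_right mult_ac)
    also have "\<dots> \<le> 2 ^ 15 * TT * (eps * (v - u)) + 122 * C\<^sup>2 * \<eta> + 3 * C / eps * \<eta>"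
      using len cost TT by (intro add_mono mult_left_mono order_refl) auto
    also have "\<dots> = L / 2 ^ 16 * TT + A" by (simp add: A_def eps_def L(2))
    finally have "L / 2 ^ 15 * TT \<le> L / 2 ^ 16 * TT + A" .
    moreover have "L / 2 ^ 15 * TT = 2 * (L / 2 ^ 16 * TT)" by simp
    ultimately have "L / 2 ^ 16 * TT \<le> A" by linarith
    moreover have "L / 2 ^ 16 * K \<le> L / 2 ^ 16 * TT" using Ks(3) L by (intro mult_left_mono) (auto simp: TT_def)
    moreover have "L / 2 ^ 16 * K = A + 1" using L by (simp add: K_def)
    ultimately show False by linarith
  qed
  show ?thesis
    by (rule exI[of _ S]) (use finS sp sm sub main in auto)
qed

end

section \<open>Nested spokes and infinite Hausdorff measure\<close>

context steep_fans
begin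

text \<open>The invariant of the nested construction. Lengths are summed over finite subfamilies because the cover
  may be infinite.\<close>

definition light :: "real set set \<Rightarrow> spoke \<Rightarrow> bool" where
  "light BB s \<longleftrightarrow> (\<forall>B\<in>BB. hits B s \<longrightarrow> diameter B < rad s) \<and>
     (\<forall>F. finite F \<longrightarrow> F \<subseteq> {B\<in>BB. hits B s} \<longrightarrow> (\<Sum>B\<in>F. diameter B) \<le> eps * rad s)"

text \<open>If every spoke of the finite family given by \<open>spoke_avoiding_cover\<close> failed to be light, finitely many
  sets of the cover would already show this, contradicting that lemma for finite covers.\<close>

lemma light_spoke_in_interval:
  assumes c: "divergent_class c" and uv: "u < v"
    and BB: "\<And>B. B \<in> BB \<Longrightarrow> bounded B \<and> 0 < diameter B"
    and cost: "\<And>F. finite F \<Longrightarrow> F \<subseteq> BB \<Longrightarrow> (\<Sum>B\<in>F. f (diameter B)) \<le> \<eta>"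
    and len: "\<And>F. finite F \<Longrightarrow> F \<subseteq> BB \<Longrightarrow> (\<Sum>B\<in>F. diameter B) \<le> eps * (v - u)"
  shows "\<exists>s. is_spoke s \<and> N \<le> lvl s \<and> seg s \<subseteq> {u..v} \<and> light BB s"
proof -
  have \<eta>: "0 \<le> \<eta>" using cost[of "{}"] by simp
  obtain S where S: "finite S" "\<forall>s\<in>S. is_spoke s \<and> N \<le> lvl s \<and> seg s \<subseteq> {u..v}"
    "\<forall>BB. finite BB \<longrightarrow> (\<forall>B\<in>BB. bounded B \<and> 0 < diameter B) \<longrightarrow> (\<Sum>B\<in>BB. f (diameter B)) \<le> \<eta> \<longrightarrow>
      (\<Sum>B\<in>BB. diameter B) \<le> eps * (v - u) \<longrightarrow>
      (\<exists>s\<in>S. (\<forall>B\<in>BB. hits B s \<longrightarrow> diameter B < rad s) \<and> (\<Sum>B\<in>{B\<in>BB. hits B s}. diameter B) \<le> eps * rad s)"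
    using spoke_avoiding_cover[OF uv \<eta> c, of N] by (elim exE conjE)
  have "\<exists>s\<in>S. light BB s"
  proof (rule ccontr)
    assume neg: "\<not> (\<exists>s\<in>S. light BB s)"
    have "\<exists>F. finite F \<and> F \<subseteq> {B\<in>BB. hits B s} \<and> ((\<exists>B\<in>F. rad s \<le> diameter B) \<or> eps * rad s < (\<Sum>B\<in>F. diameter B))"
      if "s \<in> S" for s
    proof -
      have nl: "\<not> light BB s" using neg that by auto
      show ?thesis
      proof (cases "\<exists>B\<in>BB. hits B s \<and> rad s \<le> diameter B")
        case True
        then obtain B where "B \<in> BB" "hits B s" "rad s \<le> diameter B" by auto
        then show ?thesis by (intro exI[of _ "{B}"]) auto
      next
        case False
        then show ?thesis using nl by (auto simp: light_def not_less not_le)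
      qed
    qed
    then obtain F where F: "\<And>s. s \<in> S \<Longrightarrow> finite (F s) \<and> F s \<subseteq> {B\<in>BB. hits B s} \<and>
        ((\<exists>B\<in>F s. rad s \<le> diameter B) \<or> eps * rad s < (\<Sum>B\<in>F s. diameter B))"
      by metis
    \<comment> \<open>a finite subfamily containing, for each spoke, a witness against its lightness\<close>
    define G where "G = (\<Union>s\<in>S. F s)"
    have G: "finite G" "G \<subseteq> BB" using F S(1) unfolding G_def by blast+
    obtain s where s: "s \<in> S" "\<forall>B\<in>G. hits B s \<longrightarrow> diameter B < rad s"
      "(\<Sum>B\<in>{B\<in>G. hits B s}. diameter B) \<le> eps * rad s"
      using S(3)[rule_format, OF G(1) _ cost[OF G] len[OF G]] BB G(2) by blast
    have sub: "F s \<subseteq> {B\<in>G. hits B s}" using F[OF s(1)] s(1) by (auto simp: G_def)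
    then have "(\<Sum>B\<in>F s. diameter B) \<le> (\<Sum>B\<in>{B\<in>G. hits B s}. diameter B)"
      using G BB by (intro sum_mono2) (auto simp: less_imp_le)
    then show False using F[OF s(1)] s sub by force
  qed
  then show ?thesis using S(2) by blast
qed

text \<open>Iterating \<open>light_spoke_in_interval\<close> gives nested spokes that shrink to a point. A set of the cover that
  contained the point would meet all of these spokes, and would have to be shorter than each of them.\<close>

lemma uncovered_limit_point:
  assumes c: "divergent_class c" and uv: "u < v"
    and BB: "\<And>B. B \<in> BB \<Longrightarrow> bounded B \<and> 0 < diameter B"
    and cost: "\<And>F. finite F \<Longrightarrow> F \<subseteq> BB \<Longrightarrow> (\<Sum>B\<in>F. f (diameter B)) \<le> \<eta>"
    and len: "\<And>F. finite F \<Longrightarrow> F \<subseteq> BB \<Longrightarrow> (\<Sum>B\<in>F. diameter B) \<le> eps * (v - u)"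
  shows "\<exists>x\<in>{u..v}. x \<notin> \<Union>BB \<and> (\<forall>N. \<exists>s. is_spoke s \<and> N \<le> lvl s \<and> x \<in> seg s)"
proof -
  have start: "\<exists>s. is_spoke s \<and> seg s \<subseteq> {u..v} \<and> light BB s"
  proof -
    have "\<exists>s. is_spoke s \<and> 0 \<le> lvl s \<and> seg s \<subseteq> {u..v} \<and> light BB s"
      by (rule light_spoke_in_interval[OF c uv]) (fact BB cost len)+
    then show ?thesis by blast
  qed
  have nxt: "\<exists>t. (is_spoke t \<and> seg t \<subseteq> {u..v} \<and> light BB t) \<and> n \<le> lvl t \<and> seg t \<subseteq> seg s"
    if s: "is_spoke s \<and> seg s \<subseteq> {u..v} \<and> light BB s" for s n
  proof -
    define BB' where "BB' = {B\<in>BB. hits B s}"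
    have "\<exists>t. is_spoke t \<and> n \<le> lvl t \<and> seg t \<subseteq> {tip s - rad s..tip s} \<and> light BB' t"
    proof (rule light_spoke_in_interval[OF c])
      show "tip s - rad s < tip s" using rad_pos[of s] by simp
      show "bounded B \<and> 0 < diameter B" if "B \<in> BB'" for B using that BB by (auto simp: BB'_def)
      show "(\<Sum>B\<in>F. f (diameter B)) \<le> \<eta>" if "finite F" "F \<subseteq> BB'" for F
        using that cost[of F] by (auto simp: BB'_def)
      show "(\<Sum>B\<in>F. diameter B) \<le> eps * (tip s - (tip s - rad s))" if "finite F" "F \<subseteq> BB'" for F
        using that s by (auto simp: light_def BB'_def)
    qed
    then obtain t where t: "is_spoke t" "n \<le> lvl t" "seg t \<subseteq> seg s" "light BB' t" by (auto simp: seg_def)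
    have h: "{B\<in>BB. hits B t} = {B\<in>BB'. hits B t}" using t(3) by (auto simp: BB'_def hits_def)
    then have "light BB t" using t(4) unfolding light_def by blast
    then show ?thesis using t s by blast
  qed
  obtain \<sigma> where \<sigma>: "\<And>n. is_spoke (\<sigma> n) \<and> seg (\<sigma> n) \<subseteq> {u..v} \<and> light BB (\<sigma> n)"
      "\<And>n. n \<le> lvl (\<sigma> (Suc n)) \<and> seg (\<sigma> (Suc n)) \<subseteq> seg (\<sigma> n)"
    using dependent_nat_choice[of "\<lambda>_ s. is_spoke s \<and> seg s \<subseteq> {u..v} \<and> light BB s"
        "\<lambda>n s t. n \<le> lvl t \<and> seg t \<subseteq> seg s", OF start nxt] by blast
  have dec: "decseq (\<lambda>n. seg (\<sigma> n))" using \<sigma>(2) by (intro decseq_SucI) auto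
  have "\<Inter> (range (\<lambda>n. seg (\<sigma> n))) \<noteq> {}"
  proof (rule compact_nest)
    show "compact (seg (\<sigma> n))" for n by (simp add: seg_def)
    show "seg (\<sigma> n) \<noteq> {}" for n using rad_pos[of "\<sigma> n"] by (simp add: seg_def)
    show "seg (\<sigma> n) \<subseteq> seg (\<sigma> m)" if "m \<le> n" for m n using dec that by (auto simp: decseq_def)
  qed
  then obtain x where x: "\<And>n. x \<in> seg (\<sigma> n)" by auto
  have "x \<notin> B" if B: "B \<in> BB" for B
  proof
    assume xB: "x \<in> B"
    have "diameter B > 0" using BB[OF B] by simp
    then obtain n :: nat where n: "\<And>k. k \<ge> n \<Longrightarrow> 1 / 2 ^ (2 * k) < diameter B"
      using inverse_pow4_small by blast
    have "rad (\<sigma> (Suc n)) < diameter B"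
      using rad_le[of "\<sigma> (Suc n)"] n[of "lvl (\<sigma> (Suc n))"] \<sigma>(1)[of "Suc n"] \<sigma>(2)[of n] by simp
    moreover have "hits B (\<sigma> (Suc n))" using x[of "Suc n"] xB by (auto simp: hits_def)
    ultimately show False using \<sigma>(1)[of "Suc n"] B by (force simp: light_def)
  qed
  moreover have "\<exists>s. is_spoke s \<and> N \<le> lvl s \<and> x \<in> seg s" for N
    using \<sigma>(1)[of "Suc N"] \<sigma>(2)[of N] x[of "Suc N"] by blast
  moreover have "x \<in> {u..v}" using \<sigma>(1)[of 0] x[of 0] by blast
  ultimately show ?thesis by blast
qed

text \<open>A cover of cost at most \<open>\<eta>\<close> by balls of small diameter has total length at most \<open>\<eta>\<close> divided by a large slope of
  \<open>f\<close>, which is the length condition for the start of the construction.\<close>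

lemma hausdorff_measure_infinite:
  assumes c: "divergent_class c" and uv: "u < v"
    and W: "\<And>x. x \<in> {u..v} \<Longrightarrow> (\<forall>N. \<exists>s. is_spoke s \<and> N \<le> lvl s \<and> x \<in> seg s) \<Longrightarrow> x \<in> W"
  shows "hausdorff_measure f W = \<infinity>"
proof -
  have "ennreal \<eta> \<le> hausdorff_measure f W" if \<eta>: "0 < \<eta>" for \<eta>
  proof -
    define M where "M = \<eta> / (eps * (v - u))"
    have e: "0 < eps * (v - u)" using uv by (simp add: eps_def)
    have M: "0 < M" using \<eta> e by (simp add: M_def)
    obtain \<delta> where \<delta>: "\<delta> > 0" "\<And>x. 0 < x \<Longrightarrow> x < \<delta> \<Longrightarrow> M * x \<le> f x" using steep by blast
    have "ennreal \<eta> \<le> hausdorff_pre f (\<delta> / 2) W"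
      unfolding hausdorff_pre_def
    proof (rule INF_greatest, rule ccontr)
      fix BB assume BB: "BB \<in> ball_covers (\<delta> / 2) W"
        and "\<not> ennreal \<eta> \<le> (\<Sum>\<^sub>\<infinity>B\<in>BB. ennreal (f (diameter B)))"
      then have lt: "(\<Sum>\<^sub>\<infinity>B\<in>BB. ennreal (f (diameter B))) < ennreal \<eta>" by simp
      have B: "bounded B \<and> 0 < diameter B \<and> diameter B < \<delta>" if "B \<in> BB" for B
      proof -
        obtain c' r' where "r' > 0" "B = ball c' r'" "diameter B \<le> \<delta> / 2"
          using BB \<open>B \<in> BB\<close> by (auto simp: ball_covers_def)
        then show ?thesis using \<delta>(1) by auto
      qed
      have cost: "(\<Sum>B\<in>F. f (diameter B)) \<le> \<eta>" if F: "finite F" "F \<subseteq> BB" for F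
      proof -
        have "(\<Sum>B\<in>F. ennreal (f (diameter B))) \<le> (\<Sum>\<^sub>\<infinity>B\<in>BB. ennreal (f (diameter B)))"
          using F by (subst nonneg_infsum_complete) (auto intro: SUP_upper)
        also have "\<dots> \<le> ennreal \<eta>" using lt by simp
        finally have "ennreal (\<Sum>B\<in>F. f (diameter B)) \<le> ennreal \<eta>"
          using F B f_pos by (subst sum_ennreal[symmetric]) (auto simp: less_imp_le subset_iff)
        then show ?thesis using \<eta> by (simp add: ennreal_le_iff)
      qed
      have len: "(\<Sum>B\<in>F. diameter B) \<le> eps * (v - u)" if F: "finite F" "F \<subseteq> BB" for F
      proof -
        have "M * (\<Sum>B\<in>F. diameter B) \<le> (\<Sum>B\<in>F. f (diameter B))"
          unfolding sum_distrib_left using F B \<delta>(2) by (intro sum_mono) auto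
        also have "\<dots> \<le> \<eta>" by (rule cost[OF F])
        also have "\<eta> = M * (eps * (v - u))" unfolding M_def using e by (metis less_irrefl nonzero_divide_eq_eq)
        finally show ?thesis using M by simp
      qed
      obtain x where "x \<in> {u..v}" "x \<notin> \<Union>BB" "\<forall>N. \<exists>s. is_spoke s \<and> N \<le> lvl s \<and> x \<in> seg s"
      proof -
        have "\<exists>x\<in>{u..v}. x \<notin> \<Union>BB \<and> (\<forall>N. \<exists>s. is_spoke s \<and> N \<le> lvl s \<and> x \<in> seg s)"
          by (rule uncovered_limit_point[OF c uv]) (use B in blast, fact cost, fact len)
        then show ?thesis using that by blast
      qed
      then have "x \<in> W" "x \<notin> \<Union>BB" using W by auto
      then show False using BB by (auto simp: ball_covers_def)
    qed
    also have "\<dots> \<le> hausdorff_measure f W"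
      unfolding hausdorff_measure_eq_SUP using \<delta>(1) by (intro SUP_upper) auto
    finally show ?thesis .
  qed
  note big = this
  have "of_nat n \<le> hausdorff_measure f W" for n
  proof -
    have "of_nat n \<le> ennreal (real n + 1)" by (simp add: ennreal_of_nat_eq_real_of_nat)
    also have "\<dots> \<le> hausdorff_measure f W" by (rule big) simp
    finally show ?thesis .
  qed
  then have "(SUP n. of_nat n) \<le> hausdorff_measure f W" by (intro SUP_least)
  then show ?thesis by (simp add: ennreal_SUP_of_nat_eq_top top_unique)
qed

end

section \<open>A fixed proportion of the series comes from good offsets\<close>

context fans
begin

text \<open>Wherever \<open>\<Phi> k\<close> is \<open>\<Psi>(2\<^sup>k)\<close>, this is the range of the inner sum of the series.\<close>

definition admissible :: "nat \<Rightarrow> nat set" where "admissible k = {j. j = 0 \<or> 2 ^ j < \<Phi> k}"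

definition weight :: "nat \<Rightarrow> nat \<Rightarrow> real" where "weight k j = 2 ^ (2 * k + j) * f (spoke_length k j)"

lemma weight_pos: "0 < weight k j" by (simp add: weight_def f_pos spoke_length_pos)

lemma mass_eq: "mass k = (\<Sum>j\<in>good k. weight k j)" by (simp add: mass_def weight_def)

lemma finite_admissible: "finite (admissible k)"
  unfolding admissible_def by (rule finite_pow2_less)

lemma sum_thirds:
  fixes h :: "nat \<Rightarrow> real"
  assumes "finite J" "\<And>i. 0 \<le> h i"
  shows "(\<Sum>j\<in>J. h (j div 3)) \<le> 3 * (\<Sum>i\<in>(\<lambda>j. j div 3) ` J. h i)"
proof -
  have "(\<Sum>j\<in>J. h (j div 3)) = (\<Sum>i\<in>(\<lambda>j. j div 3) ` J. \<Sum>j\<in>{j\<in>J. j div 3 = i}. h (j div 3))"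
    by (rule sum.image_gen[OF assms(1)])
  also have "\<dots> \<le> (\<Sum>i\<in>(\<lambda>j. j div 3) ` J. 3 * h i)"
  proof (rule sum_mono)
    fix i
    have "{j\<in>J. j div 3 = i} \<subseteq> {3 * i, 3 * i + 1, 3 * i + 2}" by auto
    then have "card {j\<in>J. j div 3 = i} \<le> card {3 * i, 3 * i + 1, 3 * i + 2}" by (intro card_mono) auto
    then have "real (card {j\<in>J. j div 3 = i}) \<le> 3" by simp
    then have "real (card {j\<in>J. j div 3 = i}) * h i \<le> 3 * h i" using assms(2) by (intro mult_right_mono)
    moreover have "(\<Sum>j\<in>{j\<in>J. j div 3 = i}. h (j div 3)) = (\<Sum>j\<in>{j\<in>J. j div 3 = i}. h i)"
      by (rule sum.cong) auto
    ultimately show "(\<Sum>j\<in>{j\<in>J. j div 3 = i}. h (j div 3)) \<le> 3 * h i" by simp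
  qed
  finally show ?thesis by (simp add: sum_distrib_left)
qed

text \<open>On the diagonal \<open>k + j = m\<close> the summand is \<open>f \<rho> / (\<rho> \<Phi> m)\<close> with \<open>\<rho> = 2\<^bsup>j-2m\<^esup> / \<Phi> m\<close>, hence almost decreasing in \<open>j\<close>. If
  \<open>i\<close> is not good, then \<open>f(2\<^bsup>i-2m\<^esup>) < 2\<^bsup>2i\<^esup> f(\<rho>\<^sub>i) / (6 C)\<close>. As \<open>\<rho>\<close> at \<open>3 i\<close> does not exceed \<open>2\<^bsup>i-2m\<^esup>\<close>, the summand at \<open>3 i\<close> is at
  most \<open>1 / (6 C)\<close> times the one at \<open>i\<close>. The whole sum is at most \<open>3 C\<close> times the sum over the multiples of 3,
  so the bad \<open>i\<close> account for at most half of it.\<close>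

lemma diagonal_sum_le:
  fixes m k0 :: nat
  defines "J \<equiv> {j. j + k0 \<le> m \<and> j \<in> admissible (m - j)}"
  assumes k0: "1 / 2 ^ (2 * k0) < x0"
  shows "(\<Sum>j\<in>J. weight (m - j) j) \<le> 6 * C\<^sup>2 * (\<Sum>j\<in>{j\<in>J. j \<in> good (m - j)}. weight (m - j) j)"
proof -
  define \<phi> where "\<phi> j = weight (m - j) j" for j
  define \<rho> where "\<rho> j = spoke_length (m - j) j" for j
  have finJ: "finite J" by (rule finite_subset[of _ "{..m}"]) (auto simp: J_def)
  have down: "i \<in> J" if "j \<in> J" "i \<le> j" for i j
  proof -
    have 1: "i + k0 \<le> m" using that by (auto simp: J_def)
    have "2 ^ i < \<Phi> (m - i)" if "i \<noteq> 0"
    proof -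
      have "(2::real) ^ i \<le> 2 ^ j" using \<open>i \<le> j\<close> by (intro power_increasing) auto
      also have "\<dots> < \<Phi> (m - j)" using \<open>j \<in> J\<close> \<open>i \<le> j\<close> that by (auto simp: J_def admissible_def)
      also have "\<dots> \<le> \<Phi> (m - i)" using \<open>i \<le> j\<close> by (intro Phi_mono) auto
      finally show ?thesis .
    qed
    then show ?thesis using 1 by (auto simp: J_def admissible_def)
  qed
  have \<rho>: "\<rho> j = 1 / (2 ^ (2 * m - j) * \<Phi> m)" "0 < \<rho> j" "\<phi> j = 2 ^ (2 * m - j) * f (\<rho> j)" "\<rho> j < x0" "j \<le> m"
    if "j \<in> J" for j
  proof -
    show jm: "j \<le> m" using that by (simp add: J_def)
    then have e: "2 * (m - j) + j = 2 * m - j" "m - j + j = m" by auto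
    show "\<rho> j = 1 / (2 ^ (2 * m - j) * \<Phi> m)" unfolding \<rho>_def spoke_length_def e ..
    show "0 < \<rho> j" by (simp add: \<rho>_def spoke_length_pos)
    show "\<phi> j = 2 ^ (2 * m - j) * f (\<rho> j)" unfolding \<phi>_def weight_def e \<rho>_def ..
    have "\<rho> j \<le> 1 / 2 ^ (2 * k0)"
      unfolding \<rho>_def spoke_length_def
    proof (intro divide_left_mono)
      have "(2::real) ^ (2 * k0) * 1 \<le> 2 ^ (2 * (m - j) + j) * \<Phi> (m - j + j)"
        using that Phi_ge_1 by (intro mult_mono power_increasing) (auto simp: J_def)
      then show "(2::real) ^ (2 * k0) \<le> 2 ^ (2 * (m - j) + j) * \<Phi> (m - j + j)" by simp
    qed (auto intro!: mult_pos_pos order.strict_trans2[OF _ Phi_ge_1])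
    then show "\<rho> j < x0" using k0 by linarith
  qed
  have \<Phi>: "0 < \<Phi> m" using Phi_ge_1[of m] by linarith
  have qd: "\<phi> j \<le> C * \<phi> i" if ij: "j \<in> J" "i \<le> j" for i j
  proof -
    have i: "i \<in> J" using down ij by blast
    have le: "\<rho> i \<le> \<rho> j"
      unfolding \<rho>(1)[OF i] \<rho>(1)[OF ij(1)] using \<Phi> ij
      by (intro divide_left_mono mult_right_mono power_increasing) auto
    have "f (\<rho> j) * \<rho> i \<le> C * f (\<rho> i) * \<rho> j" using \<rho>[OF i] \<rho>[OF ij(1)] le by (intro quasi) auto
    then have "f (\<rho> j) * (1 / (2 ^ (2 * m - i) * \<Phi> m)) \<le> C * f (\<rho> i) * (1 / (2 ^ (2 * m - j) * \<Phi> m))"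
      using \<rho>(1)[OF i] \<rho>(1)[OF ij(1)] by metis
    then show ?thesis unfolding \<rho>(3)[OF i] \<rho>(3)[OF ij(1)] using \<Phi> by (simp add: field_simps)
  qed
  have third: "\<phi> (3 * i) \<le> \<phi> i / (6 * C) + (if i \<in> good (m - i) then C * \<phi> i else 0)" if i3: "3 * i \<in> J" for i
  proof (cases "i \<in> good (m - i)")
    case True
    have "0 \<le> \<phi> i / (6 * C)" using weight_pos[of "m - i" i] C_ge_1 by (simp add: \<phi>_def)
    then show ?thesis using qd[OF i3, of i] True by simp
  next
    case False
    have i: "i \<in> J" using down[OF i3, of i] by simp
    note im = \<rho>(5)[OF i] \<rho>(5)[OF i3]
    have e: "2 * (m - i) + i = 2 * m - i" using im by auto
    have "i \<in> admissible (m - i)" using i by (simp add: J_def)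
    then have viol: "6 * C * f (1 / 2 ^ (2 * m - i)) < 2 ^ (2 * i) * f (\<rho> i)"
      using False by (simp add: good_def admissible_def \<rho>_def e not_le)
    have "2 ^ (2 * i) \<le> \<Phi> m"
    proof (cases "i = 0")
      case True then show ?thesis using Phi_ge_1 by simp
    next
      case False
      have "(2::real) ^ (2 * i) \<le> 2 ^ (3 * i)" by (intro power_increasing) auto
      also have "\<dots> < \<Phi> (m - 3 * i)" using i3 False by (auto simp: J_def admissible_def)
      also have "\<dots> \<le> \<Phi> m" by (intro Phi_mono) auto
      finally show ?thesis by simp
    qed
    then have "2 ^ (2 * m - 3 * i) * 2 ^ (2 * i) \<le> 2 ^ (2 * m - 3 * i) * \<Phi> m" by (intro mult_left_mono) auto
    moreover have ei: "2 * m - 3 * i + 2 * i = 2 * m - i" using im by auto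
    ultimately have "2 ^ (2 * m - i) \<le> 2 ^ (2 * m - 3 * i) * \<Phi> m" unfolding power_add[symmetric] by simp
    then have "\<rho> (3 * i) \<le> 1 / 2 ^ (2 * m - i)"
      unfolding \<rho>(1)[OF i3] using \<Phi> by (intro divide_left_mono) auto
    then have "f (\<rho> (3 * i)) \<le> f (1 / 2 ^ (2 * m - i))" using \<rho>(2)[OF i3] by (intro f_mono)
    then have "6 * C * f (\<rho> (3 * i)) \<le> 6 * C * f (1 / 2 ^ (2 * m - i))" using C_ge_1 by (intro mult_left_mono) auto
    then have "6 * C * f (\<rho> (3 * i)) \<le> 2 ^ (2 * i) * f (\<rho> i)" using viol by linarith
    then have "2 ^ (2 * m - 3 * i) * (6 * C * f (\<rho> (3 * i))) \<le> 2 ^ (2 * m - 3 * i) * (2 ^ (2 * i) * f (\<rho> i))"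
      by (intro mult_left_mono) auto
    also have "\<dots> = 2 ^ (2 * m - 3 * i + 2 * i) * f (\<rho> i)" by (simp add: power_add)
    finally have "6 * C * \<phi> (3 * i) \<le> \<phi> i" unfolding ei \<rho>(3)[OF i] \<rho>(3)[OF i3] by (simp add: mult_ac)
    then show ?thesis using False C_ge_1 by (simp add: field_simps)
  qed
  define X where "X = (\<Sum>j\<in>J. \<phi> j)"
  define Y where "Y = (\<Sum>j\<in>{j\<in>J. j \<in> good (m - j)}. \<phi> j)"
  \<comment> \<open>since \<open>J\<close> is an initial segment, all multiples \<open>3 i\<close> with \<open>i \<in> I\<close> lie in \<open>J\<close>\<close>
  define I where "I = (\<lambda>j. j div 3) ` J"
  have I: "finite I" "I \<subseteq> J" "\<And>i. i \<in> I \<Longrightarrow> 3 * i \<in> J"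
    using finJ down by (auto simp: I_def)
  have pos: "0 \<le> \<phi> j" for j using weight_pos[of "m - j" j] by (simp add: \<phi>_def)
  have "X \<le> (\<Sum>j\<in>J. C * \<phi> (3 * (j div 3)))"
    unfolding X_def by (intro sum_mono qd) auto
  also have "\<dots> \<le> 3 * (\<Sum>i\<in>I. C * \<phi> (3 * i))"
    unfolding I_def using pos C_ge_1 by (intro sum_thirds[OF finJ, of "\<lambda>i. C * \<phi> (3 * i)"]) auto
  also have "\<dots> \<le> 3 * (\<Sum>i\<in>I. C * (\<phi> i / (6 * C) + (if i \<in> good (m - i) then C * \<phi> i else 0)))"
    using third I C_ge_1 by (intro mult_left_mono sum_mono) auto
  also have "\<dots> = (\<Sum>i\<in>I. \<phi> i / 2 + 3 * C\<^sup>2 * (if i \<in> good (m - i) then \<phi> i else 0))"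
    unfolding sum_distrib_left using C_ge_1 by (intro sum.cong) (auto simp: field_simps power2_eq_square)
  also have "\<dots> \<le> (\<Sum>i\<in>J. \<phi> i / 2 + 3 * C\<^sup>2 * (if i \<in> good (m - i) then \<phi> i else 0))"
    using I finJ pos by (intro sum_mono2) auto
  also have "\<dots> = X / 2 + 3 * C\<^sup>2 * Y"
    unfolding X_def Y_def using finJ
    by (simp add: sum.distrib sum_divide_distrib sum_distrib_left[symmetric] sum.inter_filter)
  finally have "X \<le> 6 * C\<^sup>2 * Y" by simp
  then show ?thesis unfolding X_def Y_def \<phi>_def .
qed

text \<open>A finite piece of the series lies in a triangle \<open>k0 \<le> k\<close>, \<open>k + j \<le> M\<close>, which is a union of diagonals.\<close>

lemma good_sums_unbounded:
  assumes div: "\<And>K0 K. \<exists>Ks. finite Ks \<and> (\<forall>k\<in>Ks. K0 \<le> k) \<and> K \<le> (\<Sum>k\<in>Ks. \<Sum>j\<in>admissible k. weight k j)"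
  shows "\<exists>n. K \<le> (\<Sum>k\<in>{K0..n}. mass k)"
proof -
  obtain K1 :: nat where K1: "\<And>k. k \<ge> K1 \<Longrightarrow> 1 / 2 ^ (2 * k) < x0" using inverse_pow4_small[OF x0_pos] by blast
  define k0 where "k0 = max K0 K1"
  have k0: "1 / 2 ^ (2 * k0) < x0" by (rule K1) (simp add: k0_def)
  obtain Ks where Ks: "finite Ks" "\<forall>k\<in>Ks. k0 \<le> k" "6 * C\<^sup>2 * K \<le> (\<Sum>k\<in>Ks. \<Sum>j\<in>admissible k. weight k j)"
    using div[of k0 "6 * C\<^sup>2 * K"] by blast
  have fin: "finite (Sigma Ks admissible)" using Ks finite_admissible by auto
  define M where "M = (\<Sum>(k, j)\<in>Sigma Ks admissible. k + j)"
  have M: "k + j \<le> M" if "k \<in> Ks" "j \<in> admissible k" for k j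
    unfolding M_def using member_le_sum[of "(k, j)" "Sigma Ks admissible" "\<lambda>(k, j). k + j"] fin that by auto
  define J where "J m = {j. j + k0 \<le> m \<and> j \<in> admissible (m - j)}" for m
  have finJ: "finite (J m)" for m by (rule finite_subset[of _ "{..m}"]) (auto simp: J_def)
  have "6 * C\<^sup>2 * K \<le> (\<Sum>(k, j)\<in>Sigma Ks admissible. weight k j)"
    using Ks finite_admissible by (simp add: sum.Sigma)
  also have "\<dots> \<le> (\<Sum>(k, j)\<in>(\<lambda>(m, j). (m - j, j)) ` Sigma {..M} J. weight k j)"
  proof (rule sum_mono2)
    show "Sigma Ks admissible \<subseteq> (\<lambda>(m, j). (m - j, j)) ` Sigma {..M} J"
    proof clarify
      fix k j assume kj: "k \<in> Ks" "j \<in> admissible k"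
      then have "(k + j, j) \<in> Sigma {..M} J" using M Ks by (auto simp: J_def)
      then show "(k, j) \<in> (\<lambda>(m, j). (m - j, j)) ` Sigma {..M} J" by (rule rev_image_eqI) simp
    qed
  qed (use finJ weight_pos in \<open>auto simp: less_imp_le\<close>)
  also have "\<dots> = (\<Sum>(m, j)\<in>Sigma {..M} J. weight (m - j) j)"
  proof (subst sum.reindex)
    show "inj_on (\<lambda>(m, j). (m - j, j)) (Sigma {..M} J)"
      by (rule inj_onI) (auto simp: J_def)
  qed (simp add: case_prod_beta comp_def)
  also have "\<dots> = (\<Sum>m\<le>M. \<Sum>j\<in>J m. weight (m - j) j)" using finJ by (simp add: sum.Sigma)
  also have "\<dots> \<le> (\<Sum>m\<le>M. 6 * C\<^sup>2 * (\<Sum>j\<in>{j\<in>J m. j \<in> good (m - j)}. weight (m - j) j))"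
    unfolding J_def by (intro sum_mono diagonal_sum_le k0)
  also have "\<dots> = 6 * C\<^sup>2 * (\<Sum>m\<le>M. \<Sum>j\<in>{j\<in>J m. j \<in> good (m - j)}. weight (m - j) j)"
    by (simp add: sum_distrib_left)
  also have "(\<Sum>m\<le>M. \<Sum>j\<in>{j\<in>J m. j \<in> good (m - j)}. weight (m - j) j)
      = (\<Sum>(m, j)\<in>Sigma {..M} (\<lambda>m. {j\<in>J m. j \<in> good (m - j)}). weight (m - j) j)"
    using finJ by (simp add: sum.Sigma)
  also have "\<dots> = (\<Sum>(k, j)\<in>(\<lambda>(m, j). (m - j, j)) ` Sigma {..M} (\<lambda>m. {j\<in>J m. j \<in> good (m - j)}). weight k j)"
  proof (subst sum.reindex)
    show "inj_on (\<lambda>(m, j). (m - j, j)) (Sigma {..M} (\<lambda>m. {j\<in>J m. j \<in> good (m - j)}))"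
      by (rule inj_onI) (auto simp: J_def)
  qed (simp add: case_prod_beta comp_def)
  also have "\<dots> \<le> (\<Sum>(k, j)\<in>Sigma {K0..M} good. weight k j)"
    using finite_good weight_pos by (intro sum_mono2) (auto simp: J_def k0_def less_imp_le)
  also have "\<dots> = (\<Sum>k\<in>{K0..M}. mass k)" unfolding mass_eq using finite_good by (simp add: sum.Sigma)
  finally have "6 * C\<^sup>2 * K \<le> 6 * C\<^sup>2 * (\<Sum>k\<in>{K0..M}. mass k)" using C_ge_1 by simp
  then have "K \<le> (\<Sum>k\<in>{K0..M}. mass k)" using C_ge_1 by simp
  then show ?thesis by blast
qed

end

context steep_fans
begin

lemma divergent_class_exists:
  assumes div: "\<And>K0 K. \<exists>Ks. finite Ks \<and> (\<forall>k\<in>Ks. K0 \<le> k) \<and> K \<le> (\<Sum>k\<in>Ks. \<Sum>j\<in>admissible k. weight k j)"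
  shows "\<exists>c. divergent_class c"
proof -
  define A where "A c K0 n = (\<Sum>k\<in>{k\<in>{K0..n}. k mod 3 = c}. mass k)" for c K0 n
  have split: "(\<Sum>k\<in>{K0..n}. mass k) = A 0 K0 n + A 1 K0 n + A 2 K0 n" for K0 n
  proof -
    have "{K0..n} = {k\<in>{K0..n}. k mod 3 = 0} \<union> {k\<in>{K0..n}. k mod 3 = 1} \<union> {k\<in>{K0..n}. k mod 3 = 2}" by auto
    then have "(\<Sum>k\<in>{K0..n}. mass k) = (\<Sum>k\<in>{k\<in>{K0..n}. k mod 3 = 0} \<union> {k\<in>{K0..n}. k mod 3 = 1} \<union> {k\<in>{K0..n}. k mod 3 = 2}. mass k)"
      by (rule arg_cong)
    also have "\<dots> = A 0 K0 n + A 1 K0 n + A 2 K0 n"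
      unfolding A_def by (subst sum.union_disjoint; auto)+
    finally show ?thesis .
  qed
  have A_mono: "A c K0' n \<le> A c K0 n" if "K0 \<le> K0'" for c K0 K0' n
    unfolding A_def using that mass_nonneg by (intro sum_mono2) auto
  have "\<exists>c. \<forall>K0 K. \<exists>n. K \<le> A c K0 n"
  proof (rule ccontr)
    assume "\<not> ?thesis"
    then obtain K0 K where K: "\<And>c n. A c (K0 c) n < K c" by (metis not_le)
    define m where "m = max (K0 0) (max (K0 1) (K0 2))"
    obtain n where n: "K 0 + K 1 + K 2 \<le> (\<Sum>k\<in>{m..n}. mass k)" using good_sums_unbounded[OF div] by blast
    have "A c m n < K c" if "K0 c \<le> m" for c using K[of c n] A_mono[OF that, of c n] by linarith
    moreover have "K0 0 \<le> m" "K0 1 \<le> m" "K0 2 \<le> m" by (auto simp: m_def)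
    ultimately have "A 0 m n < K 0" "A 1 m n < K 1" "A 2 m n < K 2" by blast+
    then show False using n split[of m n] by linarith
  qed
  then obtain c where c: "\<And>K0 K. \<exists>n. K \<le> A c K0 n" by blast
  have "divergent_class c"
    unfolding divergent_class_def
  proof (intro allI)
    fix K0 K
    show "\<exists>Ks. finite Ks \<and> (\<forall>k\<in>Ks. K0 \<le> k \<and> k mod 3 = c) \<and> K \<le> (\<Sum>k\<in>Ks. mass k)
      \<and> (\<forall>k\<in>Ks. (\<Sum>k'\<in>{k'\<in>Ks. k' < k}. mass k') \<le> K)"
    proof (cases "0 \<le> K")
      case False
      then show ?thesis by (intro exI[of _ "{}"]) auto
    next
      case True
      define n where "n = (LEAST n. K \<le> A c K0 n)"
      have n: "K \<le> A c K0 n" unfolding n_def using c[of K K0] by (metis LeastI)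
      have min: "A c K0 i \<le> K" if "i < n" for i using not_less_Least[of i "\<lambda>n. K \<le> A c K0 n"] that by (simp add: n_def)
      define Ks where "Ks = {k\<in>{K0..n}. k mod 3 = c}"
      have "(\<Sum>k'\<in>{k'\<in>Ks. k' < k}. mass k') \<le> K" if k: "k \<in> Ks" for k
      proof (cases k)
        case 0
        then show ?thesis using True by simp
      next
        case (Suc i)
        then have e: "{k'\<in>Ks. k' < k} = {k\<in>{K0..i}. k mod 3 = c}" using k by (auto simp: Ks_def)
        show ?thesis unfolding e using min[of i] k Suc by (simp add: A_def Ks_def)
      qed
      then show ?thesis using n by (intro exI[of _ Ks]) (auto simp: Ks_def A_def)
    qed
  qed
  then show ?thesis by blast
qed

end

section \<open>Divergence of the series\<close>

locale dirichlet_data =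
  fixes \<psi> f :: "real \<Rightarrow> real" and t0 C x0 :: real
  assumes psi_antimono: "antimono_on {0<..} \<psi>"
    and psi_pos: "\<And>t. t > 0 \<Longrightarrow> \<psi> t > 0"
    and t0_ge_1: "t0 \<ge> 1"
    and psi_lt: "\<And>t. t \<ge> t0 \<Longrightarrow> t * \<psi> t < 1"
    and Psi_mono_on: "mono_on {t0..} (Psi \<psi>)"
    and dim_f: "dimension_function f"
    and slope: "filterlim (\<lambda>x. f x / x) at_top (at_right 0)"
    and C1: "C \<ge> 1" and x0: "x0 > 0"
    and quasi_slope: "\<And>x1 x2. 0 < x1 \<and> x1 < x2 \<and> x2 < x0 \<Longrightarrow> f x2 / x2 \<le> C * (f x1 / x1)"
begin

lemma slope_ge: "\<exists>\<delta>>0. \<forall>x. 0 < x \<and> x < \<delta> \<longrightarrow> M * x \<le> f x"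
proof -
  have "eventually (\<lambda>x. M \<le> f x / x) (at_right 0)" using slope by (auto simp: filterlim_at_top)
  then obtain \<delta> where \<delta>: "\<delta> > 0" "\<And>x. 0 < x \<Longrightarrow> x < \<delta> \<Longrightarrow> M \<le> f x / x"
    by (auto simp: eventually_at_right_field)
  then have "M * x \<le> f x" if "0 < x" "x < \<delta>" for x using \<delta>(2)[OF that] that by (simp add: pos_le_divide_eq)
  then show ?thesis using \<delta>(1) by blast
qed

lemma gauge_mono: "0 < x \<Longrightarrow> x \<le> y \<Longrightarrow> f x \<le> f y"
  using dim_f by (auto simp: dimension_function_def mono_on_def)

sublocale gauge f C x0
proof
  fix x :: real assume x: "0 < x"
  obtain \<delta> where \<delta>: "\<delta> > 0" "\<And>x. 0 < x \<Longrightarrow> x < \<delta> \<Longrightarrow> 1 * x \<le> f x" using slope_ge[of 1] by blast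
  define y where "y = min (\<delta> / 2) x"
  have y: "0 < y" "y < \<delta>" "y \<le> x" using \<delta> x by (auto simp: y_def)
  then show "0 < f x" using \<delta>(2)[of y] gauge_mono[of y x] by linarith
next
  fix x y :: real assume xy: "0 < x" "x \<le> y" "y < x0"
  show "f y * x \<le> C * f x * y"
  proof (cases "x = y")
    case True
    have "0 \<le> f x" using dim_f xy by (auto simp: dimension_function_def)
    then have "1 * (f x * x) \<le> C * (f x * x)" using C1 xy by (intro mult_right_mono) auto
    then show ?thesis using True by simp
  next
    case False
    then have "f y / y \<le> C * (f x / x)" using xy quasi_slope by auto
    then show ?thesis using xy by (simp add: field_simps)
  qed
qed (use gauge_mono C1 x0 in auto)

lemma Psi_pos: "t0 \<le> t \<Longrightarrow> 0 < Psi \<psi> t"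
  using psi_pos[of t] psi_lt[of t] t0_ge_1 by (simp add: Psi_def)

lemma Psi_mono: "t0 \<le> s \<Longrightarrow> s \<le> t \<Longrightarrow> Psi \<psi> s \<le> Psi \<psi> t"
  using Psi_mono_on by (auto simp: mono_on_def)

lemma one_minus_psi: "t0 \<le> t \<Longrightarrow> 1 - t * \<psi> t = 1 / (1 + Psi \<psi> t)"
  using psi_lt[of t] by (simp add: Psi_def field_simps)

text \<open>From this index on \<open>\<Psi>\<close> is known to be monotone at powers of two; \<open>Phi\<close> is made constant before it.\<close>

definition n0 :: nat where "n0 = (SOME n. t0 \<le> 2 ^ n \<and> 1 \<le> n)"

lemma n0: "t0 \<le> 2 ^ n0" "1 \<le> n0"
proof -
  obtain n where "t0 < 2 ^ n" using real_arch_pow[of 2 t0] by auto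
  also have "(2::real) ^ n \<le> 2 ^ Suc n" by simp
  finally have "t0 \<le> 2 ^ Suc n \<and> 1 \<le> Suc n" by simp
  then have "t0 \<le> 2 ^ n0 \<and> 1 \<le> n0" unfolding n0_def by (rule someI)
  then show "t0 \<le> 2 ^ n0" "1 \<le> n0" by auto
qed

lemma t0_le_pow: "n0 \<le> n \<Longrightarrow> t0 \<le> 2 ^ n"
  using n0(1) power_increasing[of n0 n "2::real"] by linarith

definition Phi :: "nat \<Rightarrow> real" where "Phi n = max 1 (Psi \<psi> (2 ^ max n n0))"

sublocale steep_fans f C x0 Phi
proof
  show "1 \<le> Phi n" for n by (simp add: Phi_def)
  show "Phi m \<le> Phi n" if "m \<le> n" for m n
    unfolding Phi_def using that by (intro max.mono order_refl Psi_mono t0_le_pow power_increasing) auto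
  show "\<exists>\<delta>>0. \<forall>x. 0 < x \<and> x < \<delta> \<longrightarrow> M * x \<le> f x" for M by (rule slope_ge)
qed

text \<open>On a spoke the distance to the tip is at most \<open>1 / (16 Q q Phi(k+j))\<close>. Since \<open>1 + \<Psi>(q) \<le> 2 Phi(k+j)\<close>, this is
  below \<open>(1 - q \<psi>(q)) / (Q q)\<close>, which means \<open>Q x - P \<ge> \<psi>(q)\<close>; then the system with \<open>t = q\<close> is unsolvable.\<close>

lemma nonimprovable_of_spokes:
  assumes x: "0 \<le> x" "x < 1" and sp: "\<And>N. \<exists>s. is_spoke s \<and> N \<le> lvl s \<and> x \<in> seg s"
  shows "x \<in> dirichlet_nonimprovable \<psi>"
proof -
  have bad: "\<exists>t>N. \<forall>p q :: int. (p, q) \<noteq> (0, 0) \<longrightarrow> \<bar>of_int q * x - of_int p\<bar> < \<psi> t \<longrightarrow> \<not> \<bar>of_int q\<bar> < t" for N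
  proof -
    obtain k0 where k0: "max N t0 < 2 ^ k0" using real_arch_pow[of 2 "max N t0"] by auto
    obtain s where s: "is_spoke s" "max n0 (k0 + 7) \<le> lvl s" "x \<in> seg s" using sp by blast
    from s(1) obtain k j P Q a q R where s': "s = ((k, j), (P, Q), a)" "q = child_den P Q a"
      "lvl s = k" "cen s = of_int P / of_int Q" "tip s = of_int R / of_int q" "rad s = spoke_length k j"
      "0 < Q" "R * Q - P * q = 1" "2 ^ k < (128 * of_int Q :: real)" "16 * of_int Q \<le> (2 ^ k :: real)" "4 * Q \<le> q"
      by (elim spokeE) auto
    note sz = spoke_sizes[OF s(1)[unfolded s'(1)] s'(2)]
    have "(2::real) ^ (k0 + 7) \<le> 2 ^ k" using s s' by (intro power_increasing) auto
    then have "2 ^ k0 * 128 \<le> (2::real) ^ k" by (simp add: power_add)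
    then have "2 ^ k0 < (of_int Q :: real)" using s'(9) by linarith
    moreover have "(of_int Q :: real) \<le> of_int q" using s' by linarith
    ultimately have qN: "N < of_int q" "t0 \<le> of_int q" using k0 by linarith+
    have q2: "of_int q \<le> (2 ^ (k + j) :: real)"
    proof -
      have "(6/16 * 2 ^ (k + j) :: real) \<le> 1 * 2 ^ (k + j)" by (intro mult_right_mono) auto
      then show ?thesis using sz(1) by linarith
    qed
    have "max (k + j) n0 = k + j" using s s' by auto
    then have "Psi \<psi> (of_int q) \<le> Phi (k + j)" "1 \<le> Phi (k + j)"
      using Psi_mono[OF qN(2) q2] by (auto simp: Phi_def)
    then have Phi2: "1 + Psi \<psi> (of_int q) \<le> 2 * Phi (k + j)" by linarith
    have P0: "0 < Psi \<psi> (of_int q)" by (rule Psi_pos[OF qN(2)])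
    have "of_int Q * of_int q \<le> (2 ^ k / 16 * 2 ^ (k + j) :: real)"
      using q2 s' sz(4) by (intro mult_mono) auto
    then have "of_int Q * of_int q * spoke_length k j \<le> 2 ^ k / 16 * 2 ^ (k + j) * spoke_length k j"
      using spoke_length_pos[of k j] by (intro mult_right_mono) auto
    also have "\<dots> = 1 / (16 * Phi (k + j))" by (simp add: spoke_length_def power_add mult_2)
    also have "\<dots> \<le> 1 / (1 + Psi \<psi> (of_int q))" using Phi2 P0 by (intro divide_left_mono) auto
    also have "\<dots> = 1 - of_int q * \<psi> (of_int q)" using one_minus_psi[OF qN(2)] by simp
    finally have "of_int q * (of_int Q * spoke_length k j) \<le> of_int q * (1 / of_int q - \<psi> (of_int q))"
      using sz(4) by (simp add: algebra_simps)
    then have gap: "\<psi> (of_int q) \<le> 1 / of_int q - of_int Q * spoke_length k j"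
      using sz(4) by (simp add: mult_le_cancel_left)
    have xs: "tip s - spoke_length k j \<le> x" "x \<le> tip s" using s(3) s' by (auto simp: seg_def)
    have "of_int R / of_int q = of_int P / of_int Q + 1 / (of_int Q * of_int q :: real)"
      using det_one_gap[OF s'(8,7) sz(4)] .
    then have "of_int Q * (tip s - spoke_length k j) = of_int P + 1 / of_int q - of_int Q * spoke_length k j"
      using s' by (simp add: field_simps)
    moreover have "of_int Q * (tip s - spoke_length k j) \<le> of_int Q * x" using xs s' by (intro mult_left_mono) auto
    ultimately have err: "\<psi> (of_int q) \<le> of_int Q * x - of_int P" using gap by linarith
    have "0 < \<psi> (of_int q)" using sz(4) by (intro psi_pos) simp
    note unsolvable = unsolvable_between_neighbours[OF s'(8,7) sz(4) _ err this]
    have "\<forall>p q' :: int. (p, q') \<noteq> (0, 0) \<longrightarrow> \<bar>of_int q' * x - of_int p\<bar> < \<psi> (of_int q) \<longrightarrow> \<not> \<bar>of_int q'\<bar> < (of_int q :: real)"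
    proof (intro allI impI notI)
      fix p q' :: int
      assume pq: "(p, q') \<noteq> (0, 0)" "\<bar>of_int q' * x - of_int p\<bar> < \<psi> (of_int q)" "\<bar>of_int q'\<bar> < (of_int q :: real)"
      have "(p, q') = (0, 0)" using xs(2) s'(5) by (intro unsolvable pq(2,3)) simp
      then show False using pq(1) by blast
    qed
    then show ?thesis using qN by blast
  qed
  have "x \<notin> dirichlet_improvable \<psi>"
  proof
    assume "x \<in> dirichlet_improvable \<psi>"
    then obtain N where N: "\<forall>t>N. \<exists>p q :: int. (p, q) \<noteq> (0, 0) \<and>
        \<bar>of_int q * x - of_int p\<bar> < \<psi> t \<and> \<bar>of_int q\<bar> < t"
      unfolding dirichlet_improvable_def by (elim CollectE conjE exE)
    obtain t where t: "N < t" "\<forall>p q :: int. (p, q) \<noteq> (0, 0) \<longrightarrow> \<bar>of_int q * x - of_int p\<bar> < \<psi> t \<longrightarrow> \<not> \<bar>of_int q\<bar> < t"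
      using bad[of N] by (elim exE conjE)
    obtain p q :: int where "(p, q) \<noteq> (0, 0)" "\<bar>of_int q * x - of_int p\<bar> < \<psi> t" "\<bar>of_int q\<bar> < t"
      using N[rule_format, OF t(1)] by (elim exE conjE)
    then show False using t(2)[rule_format, of p q] by simp
  qed
  then show ?thesis using x by (simp add: dirichlet_nonimprovable_def)
qed

definition idx :: "nat set" where "idx = {k. 1 \<le> k \<and> t0 \<le> 2 ^ k}"

text \<open>The range of the inner sum, with the logarithm removed.\<close>

definition inner :: "nat \<Rightarrow> nat set" where "inner k = {j. j = 0 \<or> 2 ^ j < Psi \<psi> (2 ^ k)}"

definition summand :: "nat \<Rightarrow> nat \<Rightarrow> real" where
  "summand k j = 2 ^ (2 * k + j) * f ((1 / 2 ^ (2 * k + j)) / Psi \<psi> (2 ^ (k + j)))"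

lemma inner_eq:
  assumes "t0 \<le> 2 ^ k"
  shows "{j::nat. real j < max 1 (log 2 (Psi \<psi> (2 ^ k)))} = inner k"
proof -
  have P: "0 < Psi \<psi> (2 ^ k)" using Psi_pos assms by simp
  have "real j < log 2 (Psi \<psi> (2 ^ k)) \<longleftrightarrow> 2 ^ j < Psi \<psi> (2 ^ k)" for j
    using P by (subst less_log_iff) (auto simp: powr_realpow)
  then show ?thesis by (auto simp: inner_def less_max_iff_disj)
qed

lemma finite_inner: "finite (inner k)"
  unfolding inner_def by (rule finite_pow2_less)

lemma t0_pow_add: "t0 \<le> 2 ^ k \<Longrightarrow> t0 \<le> 2 ^ (k + j)"
  using power_increasing[of k "k + j" "2::real"] by linarith

lemma summand_pos: "t0 \<le> 2 ^ k \<Longrightarrow> 0 < summand k j"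
  unfolding summand_def using Psi_pos[OF t0_pow_add[of k j]]
  by (intro mult_pos_pos f_pos divide_pos_pos) auto

lemma series_eq_SUP:
  "dirichlet_series f \<psi> t0 = (SUP F\<in>{F. finite F \<and> F \<subseteq> idx}. ennreal (\<Sum>k\<in>F. \<Sum>j\<in>inner k. summand k j))"
proof -
  have "dirichlet_series f \<psi> t0 = (\<Sum>\<^sub>\<infinity>k\<in>idx. ennreal (\<Sum>j\<in>inner k. summand k j))"
    unfolding dirichlet_series_def idx_def[symmetric]
  proof (rule infsum_cong)
    fix k assume "k \<in> idx"
    then have k: "t0 \<le> 2 ^ k" by (simp add: idx_def)
    show "(\<Sum>j\<in>{j. real j < max 1 (log 2 (Psi \<psi> (2 ^ k)))}. ennreal (2 ^ (2 * k + j) * f (1 / 2 ^ (2 * k + j) / Psi \<psi> (2 ^ (k + j)))))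
        = ennreal (\<Sum>j\<in>inner k. summand k j)"
      unfolding inner_eq[OF k] summand_def[symmetric]
      by (rule sum_ennreal) (use summand_pos[OF k] in \<open>auto simp: less_imp_le\<close>)
  qed
  also have "\<dots> = (SUP F\<in>{F. finite F \<and> F \<subseteq> idx}. \<Sum>k\<in>F. ennreal (\<Sum>j\<in>inner k. summand k j))"
    by (rule nonneg_infsum_complete) simp
  also have "\<dots> = (SUP F\<in>{F. finite F \<and> F \<subseteq> idx}. ennreal (\<Sum>k\<in>F. \<Sum>j\<in>inner k. summand k j))"
  proof (rule SUP_cong[OF refl])
    fix F assume "F \<in> {F. finite F \<and> F \<subseteq> idx}"
    then show "(\<Sum>k\<in>F. ennreal (\<Sum>j\<in>inner k. summand k j)) = ennreal (\<Sum>k\<in>F. \<Sum>j\<in>inner k. summand k j)"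
      by (intro sum_ennreal sum_nonneg) (auto simp: idx_def intro!: less_imp_le[OF summand_pos])
  qed
  finally show ?thesis .
qed

text \<open>If \<open>\<Psi>\<close> reaches 1 then \<open>Phi\<close> and \<open>\<Psi>\<close> agree eventually and so do the series. If \<open>\<Psi>\<close> stays below 1 then \<open>Phi\<close> is 1, and
  the terms with \<open>j = 0\<close> tend to infinity because \<open>f x / x\<close> does.\<close>

lemma divergence_of_series:
  assumes inf: "dirichlet_series f \<psi> t0 = \<infinity>"
  shows "\<exists>Ks. finite Ks \<and> (\<forall>k\<in>Ks. K0 \<le> k) \<and> K \<le> (\<Sum>k\<in>Ks. \<Sum>j\<in>admissible k. weight k j)"
proof (cases "\<exists>k\<ge>n0. 1 \<le> Psi \<psi> (2 ^ k)")
  case False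
  have Phi1: "Phi n = 1" for n
  proof -
    have "\<not> 1 \<le> Psi \<psi> (2 ^ max n n0)" using False max.cobounded2[of n0 n] by blast
    then show ?thesis by (simp add: Phi_def)
  qed
  obtain \<delta> where \<delta>: "\<delta> > 0" "\<And>x. 0 < x \<Longrightarrow> x < \<delta> \<Longrightarrow> K * x \<le> f x" using slope_ge by blast
  obtain n :: nat where n: "\<And>k. k \<ge> n \<Longrightarrow> 1 / 2 ^ (2 * k) < \<delta>" using inverse_pow4_small[OF \<delta>(1)] by blast
  define k where "k = max K0 n"
  have "1 / 2 ^ (2 * k) < \<delta>" by (rule n) (simp add: k_def)
  then have "K * (1 / 2 ^ (2 * k)) \<le> f (1 / 2 ^ (2 * k))" by (intro \<delta>(2)) auto
  then have "K \<le> weight k 0" by (simp add: weight_def spoke_length_def Phi1 field_simps)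
  also have "\<dots> \<le> (\<Sum>j\<in>admissible k. weight k j)"
    by (rule member_le_sum) (use weight_pos finite_admissible in \<open>auto simp: admissible_def less_imp_le\<close>)
  finally show ?thesis by (intro exI[of _ "{k}"]) (auto simp: k_def)
next
  case True
  then obtain k1 where k1: "n0 \<le> k1" "1 \<le> Psi \<psi> (2 ^ k1)" by blast
  define K1 where "K1 = max K0 k1"
  define F where "F k = (\<Sum>j\<in>inner k. summand k j)" for k
  have Fpos: "0 \<le> F k" if "k \<in> idx" for k
    unfolding F_def using that by (intro sum_nonneg) (auto simp: idx_def intro!: less_imp_le[OF summand_pos])
  define A where "A = (\<Sum>k\<in>{k\<in>idx. k < K1}. F k)"
  have finA: "finite {k\<in>idx. k < K1}" by auto
  have A0: "0 \<le> A" unfolding A_def using Fpos by (intro sum_nonneg) auto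
  have "ennreal (\<bar>K\<bar> + A) < dirichlet_series f \<psi> t0" using inf by simp
  then obtain G where G: "finite G" "G \<subseteq> idx" "ennreal (\<bar>K\<bar> + A) < ennreal (\<Sum>k\<in>G. F k)"
    unfolding series_eq_SUP F_def[symmetric] by (auto simp: less_SUP_iff)
  then have GK: "\<bar>K\<bar> + A < (\<Sum>k\<in>G. F k)" using A0 by (subst (asm) ennreal_less_iff) auto
  define Ks where "Ks = {k\<in>G. K1 \<le> k}"
  have "(\<Sum>k\<in>G. F k) = (\<Sum>k\<in>Ks. F k) + (\<Sum>k\<in>{k\<in>G. k < K1}. F k)"
    using G(1) by (subst sum.union_disjoint[symmetric]) (auto simp: Ks_def intro: sum.cong)
  moreover have "(\<Sum>k\<in>{k\<in>G. k < K1}. F k) \<le> A"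
    unfolding A_def using finA G(2) Fpos by (intro sum_mono2) auto
  ultimately have "K \<le> (\<Sum>k\<in>Ks. F k)" using GK by linarith
  also have "\<dots> = (\<Sum>k\<in>Ks. \<Sum>j\<in>admissible k. weight k j)"
  proof (rule sum.cong[OF refl])
    fix k assume "k \<in> Ks"
    then have k: "k1 \<le> k" "n0 \<le> k" using k1 by (auto simp: Ks_def K1_def)
    have Phi: "Phi (k + j) = Psi \<psi> (2 ^ (k + j))" for j
    proof -
      have "Psi \<psi> (2 ^ k1) \<le> Psi \<psi> (2 ^ (k + j))"
        using k k1 by (intro Psi_mono t0_le_pow power_increasing) auto
      moreover have "max (k + j) n0 = k + j" using k by auto
      ultimately show ?thesis using k1 by (simp add: Phi_def)
    qed
    have "admissible k = inner k" using Phi[of 0] by (simp add: admissible_def inner_def)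
    moreover have "weight k j = summand k j" for j
      by (simp add: weight_def summand_def spoke_length_def Phi)
    ultimately show "F k = (\<Sum>j\<in>admissible k. weight k j)" by (simp add: F_def)
  qed
  finally show ?thesis using G(1) by (intro exI[of _ Ks]) (auto simp: Ks_def K1_def)
qed

lemma divergence_case:
  assumes "dirichlet_series f \<psi> t0 = \<infinity>"
  shows "hausdorff_measure f (dirichlet_nonimprovable \<psi>) = \<infinity>"
proof -
  obtain c where c: "divergent_class c" using divergent_class_exists[OF divergence_of_series[OF assms]] by blast
  show ?thesis
    by (rule hausdorff_measure_infinite[OF c, of 0 "1/2"]) (auto intro!: nonimprovable_of_spokes)
qed

end

section \<open>Consecutive best approximations\<close>

definition int_dist :: "real \<Rightarrow> nat \<Rightarrow> real" where
  "int_dist x n = \<bar>real n * x - of_int (round (real n * x))\<bar>"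

lemma int_dist_le: "int_dist x n \<le> \<bar>real n * x - of_int p\<bar>"
  unfolding int_dist_def by (rule round_diff_minimal)

text \<open>The fractional parts of \<open>0, x, \<dots>, (q - 1) x\<close> are \<open>q\<close> points on the circle with mutual distance at least \<open>e\<close>.\<close>

lemma best_denominator_bound:
  assumes e: "0 < e" "e \<le> 1/2" and q: "0 < q"
    and far: "\<And>n. 1 \<le> n \<Longrightarrow> n < q \<Longrightarrow> e \<le> int_dist x n"
  shows "real q * e \<le> 1"
proof -
  define X where "X = (\<lambda>n. frac (real n * x)) ` {..<q}"
  have diff: "e \<le> \<bar>frac (real m * x) - frac (real n * x)\<bar>" if "m < q" "n < q" "m \<noteq> n" for m n
  proof -
    have *: "e \<le> \<bar>frac (real m * x) - frac (real n * x)\<bar>" if "m < n" "n < q" for m n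
    proof -
      have "e \<le> int_dist x (n - m)" using that by (intro far) auto
      also have "\<dots> \<le> \<bar>real (n - m) * x - of_int (\<lfloor>real n * x\<rfloor> - \<lfloor>real m * x\<rfloor>)\<bar>" by (rule int_dist_le)
      also have "real (n - m) * x - of_int (\<lfloor>real n * x\<rfloor> - \<lfloor>real m * x\<rfloor>) = frac (real n * x) - frac (real m * x)"
        using that by (simp add: frac_def of_nat_diff algebra_simps)
      finally show ?thesis by (simp add: abs_minus_commute)
    qed
    show ?thesis
      using *[of m n] *[of n m] that by (cases "m < n") (auto simp: abs_minus_commute)
  qed
  have inj: "inj_on (\<lambda>n. frac (real n * x)) {..<q}"
    using diff e by (intro inj_onI) (metis abs_zero cancel_comm_monoid_add_class.diff_cancel lessThan_iff not_le)
  have sub: "X \<subseteq> {0..1 - e}"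
  proof
    fix y assume "y \<in> X"
    then obtain n where n: "n < q" "y = frac (real n * x)" by (auto simp: X_def)
    have "y \<le> 1 - e"
    proof (cases "n = 0")
      case True
      then show ?thesis using n e by simp
    next
      case False
      have "e \<le> int_dist x n" using False n by (intro far) auto
      also have "\<dots> \<le> \<bar>real n * x - of_int (\<lfloor>real n * x\<rfloor> + 1)\<bar>" by (rule int_dist_le)
      also have "\<dots> = 1 - y" using frac_lt_1[of "real n * x"] n by (simp add: frac_def)
      finally show ?thesis by simp
    qed
    then show "y \<in> {0..1 - e}" using n by simp
  qed
  have "real (card X) \<le> (1 - e - 0) / e + 1"
    by (rule card_separated(2)[OF sub]) (use e diff in \<open>auto simp: X_def\<close>)
  also have "\<dots> = 1 / e" using e by (simp add: field_simps)
  finally show ?thesis using e inj by (simp add: X_def card_image field_simps)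
qed

text \<open>The errors at \<open>Q\<close> and \<open>q\<close> have opposite signs, since otherwise the difference \<open>q - Q\<close> would be a better
  denominator than \<open>Q\<close>. Hence the determinant has absolute value \<open>q \<bar>Q x - P\<bar> + Q \<bar>q x - R\<bar>\<close>, which is positive and
  less than 2 by \<open>best_denominator_bound\<close>.\<close>

lemma best_approximation_pair:
  fixes x :: real
  assumes irr: "\<And>(p::int) n::nat. 0 < n \<Longrightarrow> real n * x \<noteq> of_int p"
    and Q: "0 < Q" and q: "Q < q" and lt: "int_dist x q < int_dist x Q"
    and far: "\<And>n. 1 \<le> n \<Longrightarrow> n < q \<Longrightarrow> int_dist x Q \<le> int_dist x n"
  shows "\<bar>round (real q * x) * int Q - round (real Q * x) * int q\<bar> = 1"
    "real q * int_dist x Q + real Q * int_dist x q = 1"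
proof -
  define e where "e = real Q * x - of_int (round (real Q * x))"
  define e' where "e' = real q * x - of_int (round (real q * x))"
  have d: "int_dist x Q = \<bar>e\<bar>" "int_dist x q = \<bar>e'\<bar>" by (simp_all add: int_dist_def e_def e'_def)
  have nz: "e \<noteq> 0" "e' \<noteq> 0" using irr[of Q] irr[of q] Q q by (auto simp: e_def e'_def)
  have opp: "e * e' < 0"
  proof (rule ccontr)
    assume "\<not> e * e' < 0"
    then have "\<bar>e' - e\<bar> < \<bar>e\<bar>" using nz lt d by (auto simp: not_less zero_le_mult_iff)
    moreover have "\<bar>e\<bar> \<le> int_dist x (q - Q)" using far[of "q - Q"] q Q d by simp
    moreover have "int_dist x (q - Q) \<le> \<bar>real (q - Q) * x - of_int (round (real q * x) - round (real Q * x))\<bar>"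
      by (rule int_dist_le)
    moreover have "real (q - Q) * x - of_int (round (real q * x) - round (real Q * x)) = e' - e"
      using q by (simp add: e_def e'_def of_nat_diff algebra_simps)
    ultimately show False by simp
  qed
  define D where "D = round (real q * x) * int Q - round (real Q * x) * int q"
  have "of_int D = real q * e - real Q * e'" by (simp add: D_def e_def e'_def algebra_simps)
  moreover have "\<bar>real q * e - real Q * e'\<bar> = real q * \<bar>e\<bar> + real Q * \<bar>e'\<bar>"
  proof (cases "0 < e")
    case True
    then have "e' < 0" using opp by (simp add: mult_less_0_iff)
    then have "real Q * e' \<le> 0" "0 \<le> real q * e" using True by (auto simp: mult_nonneg_nonpos)
    then have "\<bar>real q * e - real Q * e'\<bar> = real q * e - real Q * e'" by linarith
    then show ?thesis using True \<open>e' < 0\<close> by simp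
  next
    case False
    then have "e < 0" "0 < e'" using opp nz by (auto simp: mult_less_0_iff)
    then have "0 \<le> real Q * e'" "real q * e \<le> 0" by (auto simp: mult_nonneg_nonpos)
    then have "\<bar>real q * e - real Q * e'\<bar> = real Q * e' - real q * e" by linarith
    then show ?thesis using \<open>e < 0\<close> \<open>0 < e'\<close> by simp
  qed
  ultimately have D: "\<bar>of_int D\<bar> = real q * \<bar>e\<bar> + real Q * \<bar>e'\<bar>" by simp
  have "\<bar>e\<bar> \<le> 1/2" unfolding e_def using of_int_round_abs_le[of "real Q * x"] by (simp add: abs_minus_commute)
  then have "real q * \<bar>e\<bar> \<le> 1" using far nz q d by (intro best_denominator_bound[of _ _ x]) auto
  moreover have "real Q * \<bar>e'\<bar> < real q * \<bar>e\<bar>" using lt d q Q nz by (intro mult_strict_mono) auto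
  ultimately have "\<bar>of_int D\<bar> < (2::real)" using D by linarith
  moreover have "0 < real q * \<bar>e\<bar> + real Q * \<bar>e'\<bar>" using nz Q q by (intro add_pos_pos) auto
  then have "(0::real) < \<bar>of_int D\<bar>" using D by simp
  ultimately have "\<bar>D\<bar> = 1" by linarith
  then show "\<bar>round (real q * x) * int Q - round (real Q * x) * int q\<bar> = 1" by (simp add: D_def)
  have "\<bar>of_int D\<bar> = (1::real)" using \<open>\<bar>D\<bar> = 1\<close> by linarith
  then show "real q * int_dist x Q + real Q * int_dist x q = 1" using D d by simp
qed

context dirichlet_data
begin

text \<open>A fraction solves every system with \<open>t\<close> beyond its denominator, because its error zero is less than \<open>\<psi> t\<close>.\<close>

lemma nonimprovable_irrational:
  assumes "x \<in> dirichlet_nonimprovable \<psi>" "0 < n"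
  shows "real n * x \<noteq> of_int p"
proof
  assume eq: "real n * x = of_int p"
  have "x \<in> dirichlet_improvable \<psi>"
    unfolding dirichlet_improvable_def
  proof (intro CollectI conjI exI[of _ "real n"] allI impI)
    show "x \<in> {0..<1}" using assms(1) by (simp add: dirichlet_nonimprovable_def)
    fix t assume t: "real n < t"
    show "\<exists>p q :: int. (p, q) \<noteq> (0, 0) \<and> \<bar>of_int q * x - of_int p\<bar> < \<psi> t \<and> \<bar>of_int q\<bar> < t"
      using eq t assms(2) psi_pos[of t] by (intro exI[of _ p] exI[of _ "int n"]) auto
  qed
  then show False using assms(1) by (simp add: dirichlet_nonimprovable_def)
qed

text \<open>Take an unsolvable system \<open>t\<close>, the best denominator \<open>Q\<close> below \<open>t\<close>, and the first denominator \<open>q\<close> that is better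
  than \<open>Q\<close>. Then \<open>\<psi>(q) \<le> \<psi>(t) \<le> \<bar>Q x - P\<bar>\<close>, and the identity of \<open>best_approximation_pair\<close> turns this into an upper
  bound for the error at \<open>q\<close>.\<close>

lemma nonimprovable_pair:
  assumes x: "x \<in> dirichlet_nonimprovable \<psi>"
  obtains P R :: int and Q q :: nat where "K < Q" "Q < q" "t0 \<le> real q" "0 \<le> P" "P \<le> int Q"
    "\<bar>R * int Q - P * int q\<bar> = 1" "\<bar>x - of_int P / real Q\<bar> \<le> 1 / (real Q * real q)"
    "\<bar>x - of_int R / real q\<bar> \<le> 1 / (real Q * real q * Psi \<psi> (real q))"
proof -
  have x01: "0 \<le> x" "x < 1" using x by (auto simp: dirichlet_nonimprovable_def)
  note irr = nonimprovable_irrational[OF x]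
  have dpos: "0 < int_dist x n" if "0 < n" for n using irr[OF that] by (simp add: int_dist_def)
  \<comment> \<open>approximating \<open>x\<close> better than \<open>\<delta>\<close> requires a denominator larger than \<open>K\<close>\<close>
  define \<delta> where "\<delta> = Min (int_dist x ` {1..Suc K})"
  have \<delta>: "0 < \<delta>" using dpos by (simp add: \<delta>_def)
  have \<delta>_le: "\<delta> \<le> int_dist x n" if "1 \<le> n" "n \<le> Suc K" for n
    unfolding \<delta>_def using that by (intro Min_le) auto
  have dirichlet: "\<exists>n\<ge>1. n \<le> N \<and> int_dist x n < 1 / real N" if N: "0 < N" for N
  proof -
    obtain h k where hk: "0 < k" "k \<le> int N" "\<bar>of_int k * x - of_int h\<bar> < 1 / real N"
      using Dirichlet_approx[OF N] by metis
    have "int_dist x (nat k) \<le> \<bar>real (nat k) * x - of_int h\<bar>" by (rule int_dist_le)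
    then show ?thesis using hk by (intro exI[of _ "nat k"]) auto
  qed
  have arch: "\<exists>N>0. 1 / real N < d" if "0 < d" for d
    using reals_Archimedean[OF that] by (metis inverse_eq_divide zero_less_Suc)
  obtain N where N: "0 < N" "1 / real N < \<delta>" using arch[OF \<delta>] by blast
  have "x \<notin> dirichlet_improvable \<psi>" using x by (simp add: dirichlet_nonimprovable_def)
  then have "\<not> (\<exists>N. \<forall>t>N. \<exists>p q :: int. (p, q) \<noteq> (0, 0) \<and>
        \<bar>of_int q * x - of_int p\<bar> < \<psi> t \<and> \<bar>of_int q\<bar> < t)"
    using x01 unfolding dirichlet_improvable_def by simp
  then obtain t where t: "max t0 (real N) < t"
    and nosol: "\<And>p q :: int. (p, q) \<noteq> (0, 0) \<Longrightarrow> \<bar>of_int q * x - of_int p\<bar> < \<psi> t \<Longrightarrow> \<not> \<bar>of_int q\<bar> < t"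
    by (metis (no_types, lifting))
  define A where "A = {n. 1 \<le> n \<and> real n < t}"
  have "A \<subseteq> {..nat \<lceil>t\<rceil>}" by (auto simp: A_def) linarith
  then have finA: "finite A" by (rule finite_subset) simp
  obtain n1 where n1: "1 \<le> n1" "n1 \<le> N" "int_dist x n1 < \<delta>" using dirichlet[OF N(1)] N(2) by force
  have n1A: "n1 \<in> A" using n1 t by (auto simp: A_def)
  obtain Q where Q: "Q \<in> A" "\<And>n. n \<in> A \<Longrightarrow> int_dist x Q \<le> int_dist x n"
  proof -
    have "Min (int_dist x ` A) \<in> int_dist x ` A" using finA n1A by (intro Min_in) auto
    then obtain Q where Q: "Q \<in> A" "int_dist x Q = Min (int_dist x ` A)" by (metis imageE)
    have "int_dist x Q \<le> int_dist x n" if "n \<in> A" for n using finA that unfolding Q(2) by (intro Min_le) auto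
    then show ?thesis using that Q(1) by blast
  qed
  have Q1: "1 \<le> Q" "real Q < t" using Q(1) by (auto simp: A_def)
  have KQ: "K < Q" using Q(2)[OF n1A] n1(3) \<delta>_le[OF Q1(1)] by linarith
  have psiQ: "\<psi> t \<le> int_dist x Q"
  proof (rule ccontr)
    assume "\<not> ?thesis"
    then have "\<bar>of_int (int Q) * x - of_int (round (real Q * x))\<bar> < \<psi> t" by (simp add: int_dist_def)
    from nosol[OF _ this] show False using Q1 by simp
  qed
  have "0 < int_dist x Q" using Q1 by (intro dpos) simp
  then obtain N' where N': "0 < N'" "1 / real N' < int_dist x Q" using arch by blast
  have ex: "\<exists>n. 1 \<le> n \<and> int_dist x n < int_dist x Q"
    using dirichlet[OF N'(1)] N'(2) less_trans by blast
  define q where "q = (LEAST n. 1 \<le> n \<and> int_dist x n < int_dist x Q)"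
  have q: "1 \<le> q \<and> int_dist x q < int_dist x Q" unfolding q_def by (rule LeastI_ex[OF ex])
  have far: "int_dist x Q \<le> int_dist x n" if "1 \<le> n" "n < q" for n
    using not_less_Least[of n "\<lambda>n. 1 \<le> n \<and> int_dist x n < int_dist x Q"] that by (simp add: q_def not_less)
  have "q \<notin> A" using Q(2)[of q] q by auto
  then have qt: "t \<le> real q" using q by (auto simp: A_def)
  then have Qq: "Q < q" using Q1 by linarith
  have t0q: "t0 \<le> real q" using t qt by linarith
  have irr': "\<And>(p::int) n::nat. 0 < n \<Longrightarrow> real n * x \<noteq> of_int p" using irr by blast
  have Q0: "0 < Q" using Q1 by simp
  note bp = best_approximation_pair[OF irr' Q0 Qq conjunct2[OF q] far]
  define P where "P = round (real Q * x)"
  define R where "R = round (real q * x)"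
  have tpos: "0 < t" using t t0_ge_1 by linarith
  have "\<psi> (real q) \<le> \<psi> t" using psi_antimono tpos qt by (auto simp: monotone_on_def)
  then have "real q * \<psi> (real q) \<le> real q * int_dist x Q" using psiQ by (intro mult_left_mono) auto
  then have "real Q * int_dist x q \<le> 1 / (1 + Psi \<psi> (real q))"
    using bp(2) one_minus_psi[OF t0q] by linarith
  also have "\<dots> \<le> 1 / Psi \<psi> (real q)" using Psi_pos[OF t0q] by (intro divide_left_mono) auto
  finally have "real Q * int_dist x q \<le> 1 / Psi \<psi> (real q)" .
  then have eq: "int_dist x q \<le> 1 / Psi \<psi> (real q) / real Q"
    using Q0 by (subst pos_le_divide_eq) (auto simp: mult.commute)
  have "\<bar>x - of_int R / real q\<bar> = int_dist x q / real q"
  proof -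
    have "x - of_int R / real q = (real q * x - of_int R) / real q" using Qq by (simp add: field_simps)
    then show ?thesis by (simp add: int_dist_def R_def abs_divide)
  qed
  also have "\<dots> \<le> 1 / Psi \<psi> (real q) / real Q / real q" using eq by (intro divide_right_mono) auto
  finally have 1: "\<bar>x - of_int R / real q\<bar> \<le> 1 / (real Q * real q * Psi \<psi> (real q))" by (simp add: mult_ac)
  have "0 \<le> real Q * int_dist x q" using dpos[of q] Qq by simp
  then have "real q * int_dist x Q \<le> 1" using bp(2) by linarith
  then have eQ: "int_dist x Q \<le> 1 / real q" using Qq by (subst pos_le_divide_eq) (auto simp: mult.commute)
  have "\<bar>x - of_int P / real Q\<bar> = int_dist x Q / real Q"
  proof -
    have "x - of_int P / real Q = (real Q * x - of_int P) / real Q" using Q0 by (simp add: field_simps)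
    then show ?thesis by (simp add: int_dist_def P_def abs_divide)
  qed
  also have "\<dots> \<le> 1 / real q / real Q" using eQ by (intro divide_right_mono) auto
  finally have 2: "\<bar>x - of_int P / real Q\<bar> \<le> 1 / (real Q * real q)" by (simp add: mult_ac)
  have "0 \<le> real Q * x" "real Q * x \<le> real Q * 1" using x01 mult_left_mono[of x 1 "real Q"] by auto
  then have P: "0 \<le> P" "P \<le> int Q"
    unfolding P_def using round_mono[of 0 "real Q * x"] round_mono[of "real Q * x" "real Q"] by auto
  show ?thesis
    by (rule that[OF KQ Qq t0q P _ 2 1]) (use bp(1) in \<open>simp add: P_def R_def\<close>)
qed

end

section \<open>Convergence of the series\<close>

context dirichlet_data
begin

definition ball_radius :: "nat \<Rightarrow> nat \<Rightarrow> real" where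
  "ball_radius k j = (1 / 2 ^ (2 * k + j)) / Psi \<psi> (2 ^ (k + j))"

definition fractions :: "nat \<Rightarrow> (nat \<times> int) set" where
  "fractions k = (SIGMA Q:{2 ^ k..<2 ^ Suc k}. {0..int Q})"

text \<open>Denominators of the neighbours of \<open>P/Q\<close> with determinant \<open>\<sigma>\<close>; the numerators are not recorded because such a
  neighbour is \<open>P/Q + \<sigma> / (Q q)\<close>.\<close>

definition neighbour_dens :: "nat \<Rightarrow> nat \<Rightarrow> nat \<Rightarrow> int \<Rightarrow> int \<Rightarrow> nat set" where
  "neighbour_dens k j Q P \<sigma> = {q. 2 ^ (k + j) \<le> q \<and> q < 2 ^ (k + j + 1) \<and> coprime P (int Q) \<and> int Q dvd P * int q + \<sigma>}"

definition coarse_balls :: "nat \<Rightarrow> real set set" where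
  "coarse_balls k = (\<lambda>(Q, P). ball (of_int P / real Q) (2 * ball_radius k 0)) ` fractions k"

definition fine_balls :: "nat \<Rightarrow> nat \<Rightarrow> real set set" where
  "fine_balls k j = (\<lambda>((Q, P), \<sigma>, q). ball (of_int P / real Q + of_int \<sigma> / (real Q * real q)) (2 * ball_radius k j)) `
     (SIGMA s:fractions k. SIGMA \<sigma>:{-1, 1}. neighbour_dens k j (fst s) (snd s) \<sigma>)"

text \<open>The coarse balls serve the points whose \<open>q\<close> is too large compared with \<open>Q\<close> for the offset to be in the range
  of the inner sum.\<close>

definition level_balls :: "nat \<Rightarrow> real set set" where
  "level_balls k = coarse_balls k \<union> (\<Union>j\<in>inner k. fine_balls k j)"

lemma ball_radius_pos: "t0 \<le> 2 ^ k \<Longrightarrow> 0 < ball_radius k j"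
  unfolding ball_radius_def using Psi_pos[OF t0_pow_add[of k j]] by (intro divide_pos_pos) auto

lemma summand_ball_radius: "summand k j = 2 ^ (2 * k + j) * f (ball_radius k j)"
  by (simp add: summand_def ball_radius_def)

lemma card_fractions: "finite (fractions k)" "real (card (fractions k)) \<le> 2 * 2 ^ (2 * k)"
proof -
  show "finite (fractions k)" by (simp add: fractions_def)
  have "card (fractions k) = (\<Sum>Q\<in>{2 ^ k..<2 ^ Suc k}. Q + 1)"
    unfolding fractions_def by (subst card_SigmaI) (auto intro!: sum.cong)
  also have "\<dots> \<le> (\<Sum>Q\<in>{2 ^ k..<2 ^ Suc k::nat}. 2 ^ Suc k)" by (intro sum_mono) auto
  also have "\<dots> = 2 * 2 ^ (2 * k)" by (simp add: mult_2 power_add distrib_left)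
  finally have "real (card (fractions k)) \<le> real (2 * 2 ^ (2 * k))" by (rule of_nat_mono)
  then show "real (card (fractions k)) \<le> 2 * 2 ^ (2 * k)" by simp
qed

lemma card_neighbour_dens:
  assumes Q: "2 ^ k \<le> Q"
  shows "finite (neighbour_dens k j Q P \<sigma>)" "real (card (neighbour_dens k j Q P \<sigma>)) \<le> 2 * 2 ^ j"
proof -
  show fin: "finite (neighbour_dens k j Q P \<sigma>)"
    by (rule finite_subset[of _ "{..2 ^ (k + j + 1)}"]) (auto simp: neighbour_dens_def)
  define X where "X = real ` neighbour_dens k j Q P \<sigma>"
  have sub: "X \<subseteq> {2 ^ (k + j)..2 ^ (k + j + 1)}"
    by (auto simp: X_def neighbour_dens_def numeral_power_le_of_nat_cancel_iff simp flip: power_Suc)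
  have sep: "2 ^ k \<le> \<bar>x - y\<bar>" if xy: "x \<in> X" "y \<in> X" "x \<noteq> y" for x y
  proof -
    obtain q q' where q: "q \<in> neighbour_dens k j Q P \<sigma>" "q' \<in> neighbour_dens k j Q P \<sigma>" "x = real q" "y = real q'"
      using xy by (auto simp: X_def)
    have "int Q dvd (P * int q + \<sigma>) - (P * int q' + \<sigma>)"
      using q by (intro dvd_diff) (auto simp: neighbour_dens_def)
    then have "int Q dvd P * (int q - int q')" by (simp add: algebra_simps)
    moreover have "coprime (int Q) P" using q by (simp add: neighbour_dens_def coprime_commute)
    ultimately have "int Q dvd int q - int q'" by (simp add: coprime_dvd_mult_right_iff)
    moreover have "int q - int q' \<noteq> 0" using xy q by auto
    ultimately have "int Q \<le> \<bar>int q - int q'\<bar>" by (metis dvd_imp_le_int abs_of_nat)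
    then have "real Q \<le> \<bar>x - y\<bar>" using q by linarith
    moreover have "2 ^ k \<le> real Q" using Q by (metis of_nat_le_iff of_nat_numeral of_nat_power)
    ultimately show ?thesis by linarith
  qed
  have "real (card X) \<le> (2 ^ (k + j + 1) - 2 ^ (k + j)) / 2 ^ k + 1"
    by (rule card_separated(2)[OF sub _ _ sep]) auto
  also have "\<dots> = 2 ^ j + 1" by (simp add: power_add)
  also have "\<dots> \<le> 2 * 2 ^ j" by simp
  finally show "real (card (neighbour_dens k j Q P \<sigma>)) \<le> 2 * 2 ^ j"
    by (simp add: X_def card_image)
qed

lemma coarse_balls_card: "finite (coarse_balls k)" "real (card (coarse_balls k)) \<le> 2 * 2 ^ (2 * k)"
proof -
  show "finite (coarse_balls k)" unfolding coarse_balls_def by (intro finite_imageI card_fractions)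
  have "card (coarse_balls k) \<le> card (fractions k)" unfolding coarse_balls_def by (intro card_image_le card_fractions)
  then show "real (card (coarse_balls k)) \<le> 2 * 2 ^ (2 * k)" using card_fractions(2)[of k] by linarith
qed

lemma fine_balls_card: "finite (fine_balls k j)" "real (card (fine_balls k j)) \<le> 8 * 2 ^ (2 * k + j)"
proof -
  define Z where "Z = (SIGMA s:fractions k. SIGMA \<sigma>:{-1, 1::int}. neighbour_dens k j (fst s) (snd s) \<sigma>)"
  have nd: "finite (neighbour_dens k j (fst s) (snd s) \<sigma>)" "real (card (neighbour_dens k j (fst s) (snd s) \<sigma>)) \<le> 2 * 2 ^ j"
    if "s \<in> fractions k" for s \<sigma>
    using card_neighbour_dens[of k "fst s"] that by (auto simp: fractions_def)
  have fin: "finite Z" unfolding Z_def using nd card_fractions(1) by (intro finite_SigmaI) auto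
  then show "finite (fine_balls k j)" unfolding fine_balls_def Z_def[symmetric] by (rule finite_imageI)
  have "card (fine_balls k j) \<le> card Z" unfolding fine_balls_def Z_def[symmetric] by (rule card_image_le[OF fin])
  then have "real (card (fine_balls k j)) \<le> real (card Z)" by simp
  also have "card Z = (\<Sum>s\<in>fractions k. \<Sum>\<sigma>\<in>{-1, 1::int}. card (neighbour_dens k j (fst s) (snd s) \<sigma>))"
    unfolding Z_def using nd card_fractions(1)
    by (subst card_SigmaI) (auto intro!: sum.cong card_SigmaI)
  also have "real \<dots> = (\<Sum>s\<in>fractions k. \<Sum>\<sigma>\<in>{-1, 1::int}. real (card (neighbour_dens k j (fst s) (snd s) \<sigma>)))"
    by simp
  also have "\<dots> \<le> (\<Sum>s\<in>fractions k. \<Sum>\<sigma>\<in>{-1, 1::int}. 2 * 2 ^ j)"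
    using nd by (intro sum_mono) auto
  also have "\<dots> = real (card (fractions k)) * (4 * 2 ^ j)" by simp
  also have "\<dots> \<le> (2 * 2 ^ (2 * k)) * (4 * 2 ^ j)" using card_fractions(2) by (intro mult_right_mono) auto
  finally show "real (card (fine_balls k j)) \<le> 8 * 2 ^ (2 * k + j)" by (simp add: power_add)
qed

text \<open>With \<open>2\<^sup>k \<le> Q < 2\<^bsup>k+1\<^esup>\<close> and \<open>2\<^bsup>k+j\<^esup> \<le> q < 2\<^bsup>k+j+1\<^esup>\<close>, either \<open>j\<close> is in the range of the inner sum and \<open>R/q\<close> is the centre of
  a fine ball, or \<open>\<Psi>(2\<^sup>k) \<le> 2\<^sup>j\<close> and already \<open>\<bar>x - P/Q\<bar> \<le> 1 / (Q q)\<close> is at most the radius for offset 0.\<close>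

lemma covered_at_level:
  assumes x: "x \<in> dirichlet_nonimprovable \<psi>" and K: "n0 \<le> K"
  shows "\<exists>k\<ge>K. x \<in> \<Union>(level_balls k)"
proof -
  obtain P R :: int and Q q :: nat where a: "2 ^ K < Q" "Q < q" "t0 \<le> real q" "0 \<le> P" "P \<le> int Q"
    "\<bar>R * int Q - P * int q\<bar> = 1" "\<bar>x - of_int P / real Q\<bar> \<le> 1 / (real Q * real q)"
    "\<bar>x - of_int R / real q\<bar> \<le> 1 / (real Q * real q * Psi \<psi> (real q))"
    using nonimprovable_pair[OF x, of "2 ^ K"] by metis
  have dy: "\<exists>i. 2 ^ i \<le> n \<and> n < 2 ^ Suc i" if "0 < n" for n :: nat
    using ex_power_ivl1[of 2 n] that by auto
  obtain k where k: "2 ^ k \<le> Q" "Q < 2 ^ Suc k" using dy[of Q] a(1) by (metis gr_zeroI not_less_zero)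
  obtain i where i: "2 ^ i \<le> q" "q < 2 ^ Suc i" using dy[of q] a(2) by (metis gr_zeroI not_less_zero)
  have "(2::nat) ^ K < 2 ^ Suc k" using a(1) k by linarith
  then have Kk: "K \<le> k" by (simp add: power_less_imp_less_exp less_Suc_eq_le flip: power_Suc)
  have "(2::nat) ^ k < 2 ^ Suc i" using k i a(2) by linarith
  then have "k \<le> i" by (simp add: power_less_imp_less_exp less_Suc_eq_le flip: power_Suc)
  then obtain j where j: "i = k + j" using le_Suc_ex by blast
  have fr: "(Q, P) \<in> fractions k" using k a by (auto simp: fractions_def)
  have tk: "t0 \<le> 2 ^ k" "t0 \<le> 2 ^ (k + j)" using t0_le_pow[of k] t0_le_pow[of "k + j"] K Kk by auto
  have Qr: "2 ^ k \<le> real Q" "2 ^ (k + j) \<le> real q"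
    using k(1) i(1) j by (metis of_nat_le_iff of_nat_numeral of_nat_power)+
  have "2 ^ k * 2 ^ (k + j) \<le> real Q * real q" using Qr by (intro mult_mono) auto
  moreover have "(2::real) ^ k * 2 ^ (k + j) = 2 ^ (2 * k + j)" by (simp add: mult_2 power_add)
  ultimately have Qq: "2 ^ (2 * k + j) \<le> real Q * real q" by simp
  have Pk: "0 < Psi \<psi> (2 ^ k)" "0 < Psi \<psi> (2 ^ (k + j))" using Psi_pos tk by auto
  have "x \<in> \<Union>(level_balls k)"
  proof (cases "j \<in> inner k")
    case False
    then have "Psi \<psi> (2 ^ k) \<le> 2 ^ j" by (auto simp: inner_def)
    then have "2 ^ (2 * k) * Psi \<psi> (2 ^ k) \<le> 2 ^ (2 * k) * 2 ^ j" by (intro mult_left_mono) auto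
    also have "\<dots> \<le> real Q * real q" using Qq by (simp add: power_add)
    finally have "1 / (real Q * real q) \<le> 1 / (2 ^ (2 * k) * Psi \<psi> (2 ^ k))"
      using Pk a(1,2) by (intro divide_left_mono mult_pos_pos) auto
    also have "\<dots> = ball_radius k 0" by (simp add: ball_radius_def)
    also have "\<dots> < 2 * ball_radius k 0" using ball_radius_pos[OF tk(1), of 0] by simp
    finally have "x \<in> ball (of_int P / real Q) (2 * ball_radius k 0)"
      using a(7) by (simp add: dist_real_def abs_minus_commute)
    then have "x \<in> \<Union>(coarse_balls k)" unfolding coarse_balls_def using fr by force
    then show ?thesis by (auto simp: level_balls_def)
  next
    case True
    define \<sigma> where "\<sigma> = R * int Q - P * int q"
    have \<sigma>: "\<sigma> \<in> {-1, 1}" using a(6) by (auto simp: \<sigma>_def)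
    have Q0: "0 < Q" "0 < q" using a(1,2) by auto
    have "coprime P (int Q)"
    proof (rule coprimeI)
      fix c assume "c dvd P" "c dvd int Q"
      then have "c dvd \<sigma>" unfolding \<sigma>_def by auto
      then show "is_unit c" using \<sigma> by auto
    qed
    moreover have "P * int q + \<sigma> = R * int Q" by (simp add: \<sigma>_def)
    ultimately have q: "q \<in> neighbour_dens k j Q P \<sigma>" using i j by (simp add: neighbour_dens_def)
    have "real_of_int \<sigma> = of_int R * real Q - of_int P * real q" by (simp add: \<sigma>_def)
    then have c: "of_int P / real Q + of_int \<sigma> / (real Q * real q) = of_int R / real q"
      using Q0 by (simp add: field_simps)
    have "2 ^ (2 * k + j) * Psi \<psi> (2 ^ (k + j)) \<le> real Q * real q * Psi \<psi> (real q)"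
      using Qq Pk Psi_mono[OF tk(2) Qr(2)] by (intro mult_mono) auto
    then have "1 / (real Q * real q * Psi \<psi> (real q)) \<le> 1 / (2 ^ (2 * k + j) * Psi \<psi> (2 ^ (k + j)))"
      using Pk Q0 Psi_pos[OF a(3)] by (intro divide_left_mono mult_pos_pos) auto
    also have "\<dots> = ball_radius k j" by (simp add: ball_radius_def)
    also have "\<dots> < 2 * ball_radius k j" using ball_radius_pos[OF tk(1), of j] by simp
    finally have "x \<in> ball (of_int P / real Q + of_int \<sigma> / (real Q * real q)) (2 * ball_radius k j)"
      unfolding c using a(8) by (simp add: dist_real_def abs_minus_commute)
    moreover have "((Q, P), \<sigma>, q) \<in> (SIGMA s:fractions k. SIGMA \<sigma>:{-1, 1}. neighbour_dens k j (fst s) (snd s) \<sigma>)"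
      using fr \<sigma> q by simp
    ultimately have "x \<in> \<Union>(fine_balls k j)" unfolding fine_balls_def by force
    then show ?thesis using True by (auto simp: level_balls_def)
  qed
  then show ?thesis using Kk by blast
qed

lemma level_ball_shape:
  assumes "B \<in> level_balls k" "t0 \<le> 2 ^ k"
  shows "\<exists>c j. B = ball c (2 * ball_radius k j) \<and> diameter B = 4 * ball_radius k j"
proof -
  have "\<exists>c j. B = ball c (2 * ball_radius k j)"
    using assms(1) by (auto simp: level_balls_def coarse_balls_def fine_balls_def)
  then show ?thesis using ball_radius_pos[OF assms(2)] by (metis diameter_ball less_le mult_pos_pos order_less_imp_not_less zero_less_numeral numeral_Bit0 mult_2 mult.assoc mult.left_commute numeral_times_numeral)
qed

lemma ball_radius_le:
  assumes "n0 \<le> k"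
  shows "ball_radius k j \<le> 1 / (2 ^ (2 * k) * Psi \<psi> (2 ^ n0))"
proof -
  have P: "0 < Psi \<psi> (2 ^ n0)" "Psi \<psi> (2 ^ n0) \<le> Psi \<psi> (2 ^ (k + j))"
    using Psi_pos[OF n0(1)] assms by (auto intro!: Psi_mono n0(1) power_increasing)
  have "2 ^ (2 * k) * Psi \<psi> (2 ^ n0) \<le> 2 ^ (2 * k + j) * Psi \<psi> (2 ^ (k + j))"
    using P by (intro mult_mono power_increasing) auto
  then have "1 / (2 ^ (2 * k + j) * Psi \<psi> (2 ^ (k + j))) \<le> 1 / (2 ^ (2 * k) * Psi \<psi> (2 ^ n0))"
    using P by (intro divide_left_mono mult_pos_pos) auto
  then show ?thesis by (simp add: ball_radius_def)
qed

lemma ball_radius_eventually_small: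
  assumes "0 < e"
  shows "\<exists>K\<ge>n0. \<forall>k\<ge>K. \<forall>j. 4 * ball_radius k j < e"
proof -
  define p where "p = Psi \<psi> (2 ^ n0)"
  have p: "0 < p" unfolding p_def by (rule Psi_pos[OF n0(1)])
  have "0 < e * p / 4" using assms p by simp
  then obtain n :: nat where n: "\<And>k. k \<ge> n \<Longrightarrow> 1 / 2 ^ (2 * k) < e * p / 4" using inverse_pow4_small by blast
  have "4 * ball_radius k j < e" if k: "max n n0 \<le> k" for k j
  proof -
    have "ball_radius k j \<le> 1 / (2 ^ (2 * k) * p)" unfolding p_def using k by (intro ball_radius_le) auto
    also have "\<dots> = 1 / 2 ^ (2 * k) / p" by simp
    also have "\<dots> < e * p / 4 / p" using n[of k] k p by (intro divide_strict_right_mono) auto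
    also have "\<dots> = e / 4" using p by simp
    finally show ?thesis by simp
  qed
  then show ?thesis by (intro exI[of _ "max n n0"]) auto
qed

text \<open>Diameters exceed the lengths in the series by a factor 4, which costs a factor \<open>4 C\<close>. The coarse balls
  are paid for by the term \<open>j = 0\<close>, which is always present.\<close>

lemma level_cost:
  assumes k: "t0 \<le> 2 ^ k" and small: "\<And>j. 4 * ball_radius k j < x0"
  shows "finite (level_balls k)" "(\<Sum>B\<in>level_balls k. f (diameter B)) \<le> 40 * C * (\<Sum>j\<in>inner k. summand k j)"
proof -
  have f4: "f (4 * ball_radius k j) \<le> 4 * C * f (ball_radius k j)" for j
  proof -
    have "f (4 * ball_radius k j) * ball_radius k j \<le> C * f (ball_radius k j) * (4 * ball_radius k j)"
      using ball_radius_pos[OF k, of j] small[of j] by (intro quasi) auto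
    then have "f (4 * ball_radius k j) * ball_radius k j \<le> (4 * C * f (ball_radius k j)) * ball_radius k j" by (simp add: mult_ac)
    then show ?thesis using ball_radius_pos[OF k, of j] by simp
  qed
  have diam: "diameter (ball c (2 * ball_radius k j)) = 4 * ball_radius k j" for c :: real and j
    using ball_radius_pos[OF k, of j] by simp
  have fp: "0 \<le> f (diameter B)" if "B \<in> level_balls k" for B
    using level_ball_shape[OF that k] f_pos ball_radius_pos[OF k] by (auto simp: less_imp_le)
  have fin: "finite (\<Union>j\<in>inner k. fine_balls k j)" using finite_inner fine_balls_card by blast
  then show finL: "finite (level_balls k)" using coarse_balls_card by (simp add: level_balls_def)
  have "(\<Sum>B\<in>coarse_balls k. f (diameter B)) = (\<Sum>B\<in>coarse_balls k. f (4 * ball_radius k 0))"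
    by (rule sum.cong) (auto simp: coarse_balls_def diam simp del: diameter_ball)
  also have "\<dots> = real (card (coarse_balls k)) * f (4 * ball_radius k 0)" by simp
  also have "\<dots> \<le> 2 * 2 ^ (2 * k) * (4 * C * f (ball_radius k 0))"
    using coarse_balls_card(2)[of k] f4[of 0] f_pos ball_radius_pos[OF k] by (intro mult_mono) (auto simp: less_imp_le)
  also have "\<dots> = 8 * C * summand k 0" by (simp add: summand_ball_radius)
  also have "\<dots> \<le> 8 * C * (\<Sum>j\<in>inner k. summand k j)"
  proof (intro mult_left_mono member_le_sum)
    show "0 \<in> inner k" by (simp add: inner_def)
  qed (use finite_inner summand_pos[OF k] C1 in \<open>auto simp: less_imp_le\<close>)
  finally have c: "(\<Sum>B\<in>coarse_balls k. f (diameter B)) \<le> 8 * C * (\<Sum>j\<in>inner k. summand k j)" .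
  have d: "(\<Sum>B\<in>fine_balls k j. f (diameter B)) \<le> 32 * C * summand k j" for j
  proof -
    have "(\<Sum>B\<in>fine_balls k j. f (diameter B)) = (\<Sum>B\<in>fine_balls k j. f (4 * ball_radius k j))"
      by (rule sum.cong) (auto simp: fine_balls_def diam simp del: diameter_ball)
    also have "\<dots> = real (card (fine_balls k j)) * f (4 * ball_radius k j)" by simp
    also have "\<dots> \<le> 8 * 2 ^ (2 * k + j) * (4 * C * f (ball_radius k j))"
      using fine_balls_card(2)[of k j] f4[of j] f_pos ball_radius_pos[OF k] by (intro mult_mono) (auto simp: less_imp_le)
    finally show ?thesis by (simp add: summand_ball_radius mult_ac)
  qed
  have "(\<Sum>B\<in>level_balls k. f (diameter B))
      \<le> (\<Sum>B\<in>coarse_balls k. f (diameter B)) + (\<Sum>B\<in>(\<Union>j\<in>inner k. fine_balls k j). f (diameter B))"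
    unfolding level_balls_def by (intro sum_Un_le coarse_balls_card fin) (auto simp: level_balls_def intro!: fp)
  also have "\<dots> \<le> 8 * C * (\<Sum>j\<in>inner k. summand k j) + (\<Sum>j\<in>inner k. 32 * C * summand k j)"
    by (intro add_mono c order_trans[OF sum_UN_le] sum_mono d finite_inner fine_balls_card fp)
      (auto simp: level_balls_def)
  also have "\<dots> = 40 * C * (\<Sum>j\<in>inner k. summand k j)" by (simp add: sum_distrib_left[symmetric])
  finally show "(\<Sum>B\<in>level_balls k. f (diameter B)) \<le> 40 * C * (\<Sum>j\<in>inner k. summand k j)" .
qed

lemma convergence_case:
  assumes fin: "dirichlet_series f \<psi> t0 < \<infinity>"
  shows "hausdorff_measure f (dirichlet_nonimprovable \<psi>) = 0"
proof -
  define F where "F k = (\<Sum>j\<in>inner k. summand k j)" for k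
  have F0: "0 \<le> F k" if "k \<in> idx" for k
    unfolding F_def using that by (intro sum_nonneg) (auto simp: idx_def intro!: less_imp_le[OF summand_pos])
  obtain S where S: "dirichlet_series f \<psi> t0 = ennreal S" "0 \<le> S" using fin by (cases "dirichlet_series f \<psi> t0") auto
  have le_S: "(\<Sum>k\<in>G. F k) \<le> S" if "finite G" "G \<subseteq> idx" for G
  proof -
    have "ennreal (\<Sum>k\<in>G. F k) \<le> ennreal S"
      unfolding S(1)[symmetric] series_eq_SUP F_def[symmetric] using that by (intro SUP_upper) auto
    then show ?thesis using S(2) by (simp add: ennreal_le_iff)
  qed
  have tail: "\<exists>K. \<forall>G. finite G \<longrightarrow> G \<subseteq> idx \<longrightarrow> (\<forall>k\<in>G. K \<le> k) \<longrightarrow> (\<Sum>k\<in>G. F k) \<le> e" if e: "0 < e" for e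
  proof (cases "S = 0")
    case True
    then show ?thesis using le_S e by (metis order_trans less_imp_le)
  next
    case False
    define e' where "e' = max 0 (S - e)"
    have "ennreal e' < dirichlet_series f \<psi> t0" using S False e by (simp add: e'_def ennreal_less_iff)
    then obtain G0 where G0: "finite G0" "G0 \<subseteq> idx" "ennreal e' < ennreal (\<Sum>k\<in>G0. F k)"
      unfolding series_eq_SUP F_def[symmetric] by (auto simp: less_SUP_iff)
    then have s: "S - e < (\<Sum>k\<in>G0. F k)" by (subst (asm) ennreal_less_iff) (auto simp: e'_def)
    show ?thesis
    proof (intro exI[of _ "Suc (Max (insert 0 G0))"] allI impI)
      fix G assume G: "finite G" "G \<subseteq> idx" "\<forall>k\<in>G. Suc (Max (insert 0 G0)) \<le> k"
      have "k \<le> Max (insert 0 G0)" if "k \<in> G0" for k using G0(1) that by (intro Max_ge) auto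
      then have "G \<inter> G0 = {}" using G(3) by fastforce
      then have "(\<Sum>k\<in>G \<union> G0. F k) = (\<Sum>k\<in>G. F k) + (\<Sum>k\<in>G0. F k)" using G G0 by (intro sum.union_disjoint)
      then show "(\<Sum>k\<in>G. F k) \<le> e" using le_S[of "G \<union> G0"] G G0 s by simp
    qed
  qed
  have pre: "hausdorff_pre f \<rho> (dirichlet_nonimprovable \<psi>) \<le> ennreal (40 * C * e)" if \<rho>: "0 < \<rho>" and e: "0 < e" for \<rho> e
  proof -
    obtain K1 where K1: "\<And>G. finite G \<Longrightarrow> G \<subseteq> idx \<Longrightarrow> (\<And>k. k \<in> G \<Longrightarrow> K1 \<le> k) \<Longrightarrow> (\<Sum>k\<in>G. F k) \<le> e"
      using tail[OF e] by meson
    obtain K2 where K2: "n0 \<le> K2" "\<And>k j. K2 \<le> k \<Longrightarrow> 4 * ball_radius k j < min \<rho> x0"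
      using ball_radius_eventually_small[of "min \<rho> x0"] \<rho> x0 by auto
    define K where "K = max K1 K2"
    have idx: "k \<in> idx" "t0 \<le> 2 ^ k" if "K \<le> k" for k
      using that K2(1) n0(2) t0_le_pow[of k] by (auto simp: idx_def K_def)
    define BB where "BB = (\<Union>k\<in>{K..}. level_balls k)"
    have finL: "finite (level_balls k)" if "K \<le> k" for k
      using level_cost(1)[OF idx(2)[OF that]] K2(2)[of k] that by (auto simp: K_def)
    have cov: "BB \<in> ball_covers \<rho> (dirichlet_nonimprovable \<psi>)"
      unfolding ball_covers_def
    proof (intro CollectI conjI ballI)
      show "countable BB" unfolding BB_def using finL by (intro countable_UN) (auto intro: countable_finite)
      show "\<exists>c. \<exists>r>0. B = ball c r \<and> diameter B \<le> \<rho>" if B: "B \<in> BB" for B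
      proof -
        obtain k where k: "K \<le> k" "B \<in> level_balls k" using B by (auto simp: BB_def)
        obtain c j where c: "B = ball c (2 * ball_radius k j)" "diameter B = 4 * ball_radius k j"
          using level_ball_shape[OF k(2) idx(2)[OF k(1)]] by blast
        have "diameter B \<le> \<rho>" using K2(2)[of k j] k(1) c(2) by (auto simp: K_def)
        then show ?thesis using c(1) ball_radius_pos[OF idx(2)[OF k(1)], of j] by (intro exI[of _ c] exI[of _ "2 * ball_radius k j"]) auto
      qed
      show "dirichlet_nonimprovable \<psi> \<subseteq> \<Union>BB"
      proof
        fix x assume "x \<in> dirichlet_nonimprovable \<psi>"
        moreover have "n0 \<le> K" using K2(1) by (simp add: K_def)
        ultimately obtain k where "K \<le> k" "x \<in> \<Union>(level_balls k)" using covered_at_level by blast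
        then show "x \<in> \<Union>BB" by (auto simp: BB_def)
      qed
    qed
    have fnn: "0 \<le> f (diameter B)" if B: "B \<in> BB" for B
    proof -
      obtain k where k: "K \<le> k" "B \<in> level_balls k" using B by (auto simp: BB_def)
      then show ?thesis using level_ball_shape[OF k(2) idx(2)[OF k(1)]] f_pos ball_radius_pos[OF idx(2)[OF k(1)]]
        by (auto simp: less_imp_le)
    qed
    have "hausdorff_pre f \<rho> (dirichlet_nonimprovable \<psi>) \<le> (\<Sum>\<^sub>\<infinity>B\<in>BB. ennreal (f (diameter B)))"
      unfolding hausdorff_pre_def by (rule INF_lower[OF cov])
    also have "\<dots> = (SUP H\<in>{H. finite H \<and> H \<subseteq> BB}. \<Sum>B\<in>H. ennreal (f (diameter B)))"
      by (rule nonneg_infsum_complete) simp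
    also have "\<dots> \<le> ennreal (40 * C * e)"
    proof (rule SUP_least)
      fix H assume "H \<in> {H. finite H \<and> H \<subseteq> BB}"
      then have H: "finite H" "H \<subseteq> BB" by auto
      then have "\<forall>B\<in>H. \<exists>k. K \<le> k \<and> B \<in> level_balls k" by (auto simp: BB_def)
      then obtain \<kappa> where \<kappa>: "\<And>B. B \<in> H \<Longrightarrow> K \<le> \<kappa> B \<and> B \<in> level_balls (\<kappa> B)" by metis
      define G where "G = \<kappa> ` H"
      have G: "finite G" "\<And>k. k \<in> G \<Longrightarrow> K \<le> k" using H \<kappa> by (auto simp: G_def)
      have "(\<Sum>B\<in>H. f (diameter B)) = (\<Sum>k\<in>G. \<Sum>B\<in>{B\<in>H. \<kappa> B = k}. f (diameter B))"
        unfolding G_def by (rule sum.image_gen[OF H(1)])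
      also have "\<dots> \<le> (\<Sum>k\<in>G. \<Sum>B\<in>level_balls k. f (diameter B))"
      proof (intro sum_mono sum_mono2)
        fix k assume k: "k \<in> G"
        show "finite (level_balls k)" using finL G(2)[OF k] by blast
        show "{B\<in>H. \<kappa> B = k} \<subseteq> level_balls k" using \<kappa> by auto
        show "0 \<le> f (diameter B)" if "B \<in> level_balls k - {B\<in>H. \<kappa> B = k}" for B
          using that G(2)[OF k] by (intro fnn) (auto simp: BB_def)
      qed
      also have "\<dots> \<le> (\<Sum>k\<in>G. 40 * C * F k)"
        unfolding F_def using G(2) idx(2) K2(2) by (intro sum_mono level_cost(2)) (auto simp: K_def)
      also have "\<dots> = 40 * C * (\<Sum>k\<in>G. F k)" by (simp add: sum_distrib_left)
      also have "\<dots> \<le> 40 * C * e"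
        using G idx(1) C1 by (intro mult_left_mono K1) (auto simp: K_def)
      finally have "(\<Sum>B\<in>H. f (diameter B)) \<le> 40 * C * e" .
      moreover have "(\<Sum>B\<in>H. ennreal (f (diameter B))) = ennreal (\<Sum>B\<in>H. f (diameter B))"
        using H fnn by (intro sum_ennreal) auto
      ultimately show "(\<Sum>B\<in>H. ennreal (f (diameter B))) \<le> ennreal (40 * C * e)"
        by (simp add: ennreal_leI)
    qed
    finally show ?thesis .
  qed
  have "hausdorff_pre f \<rho> (dirichlet_nonimprovable \<psi>) = 0" if \<rho>: "0 < \<rho>" for \<rho>
  proof -
    have "hausdorff_pre f \<rho> (dirichlet_nonimprovable \<psi>) \<le> 0"
    proof (rule ennreal_le_epsilon)
      fix e :: real assume e: "0 < e"
      have "hausdorff_pre f \<rho> (dirichlet_nonimprovable \<psi>) \<le> ennreal (40 * C * (e / (40 * C)))"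
        using e C1 by (intro pre[OF \<rho>]) auto
      then show "hausdorff_pre f \<rho> (dirichlet_nonimprovable \<psi>) \<le> 0 + ennreal e" using C1 by simp
    qed
    then show ?thesis by simp
  qed
  then show ?thesis unfolding hausdorff_measure_eq_SUP by (simp add: SUP_eq_const)
qed

end

theorem theorem1p5:
  fixes \<psi> f :: "real \<Rightarrow> real" and t0 :: real
  assumes "antimono_on {0<..} \<psi>"
    and "\<And>t. t > 0 \<Longrightarrow> \<psi> t > 0"
    and "t0 \<ge> 1"
    and "\<And>t. t \<ge> t0 \<Longrightarrow> t * \<psi> t < 1"
    and "mono_on {t0..} (Psi \<psi>)"
    and "dimension_function f"
    and "filterlim (\<lambda>x. f x / x) at_top (at_right 0)"
    and "\<exists>C\<ge>1. \<exists>x0>0. \<forall>x1 x2. 0 < x1 \<and> x1 < x2 \<and> x2 < x0 \<longrightarrow> f x2 / x2 \<le> C * (f x1 / x1)"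
  shows "(dirichlet_series f \<psi> t0 < \<infinity> \<longrightarrow> hausdorff_measure f (dirichlet_nonimprovable \<psi>) = 0) \<and>
         (dirichlet_series f \<psi> t0 = \<infinity> \<longrightarrow> hausdorff_measure f (dirichlet_nonimprovable \<psi>) = \<infinity>)"
proof -
  obtain C x0 where C: "C \<ge> 1" "x0 > 0"
    "\<And>x1 x2. 0 < x1 \<and> x1 < x2 \<and> x2 < x0 \<Longrightarrow> f x2 / x2 \<le> C * (f x1 / x1)"
    using assms(8) by blast
  interpret dirichlet_data \<psi> f t0 C x0
    by unfold_locales (use assms(1-7) C in auto)
  show ?thesis using convergence_case divergence_case by blast
qed

end
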